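(* Let $\mathfrak{S}\subseteq\mathbb{R}^2$ be a simple cone, i.e. $\mathfrak{S}=\{a r_1+b r_2: a,b\geq 0\}$ for two linearly independent vectors $r_1,r_2\in\mathbb{R}^2$ (so that $\mathfrak{S}$ is bounded by two distinct rays making an acute, right or obtuse angle). Let $\mathcal{A}_{\mathfrak{S}}$ be the weak$^*$-closed linear span in $B(L^2(\mathbb{R}))$ of the unitaries $M_\lambda D_\mu$ with $(\lambda,\mu)\in\mathfrak{S}$. Then $\mathcal{A}_{\mathfrak{S}}$ is unitarily equivalent to the parabolic algebra $\mathcal{A}_p$, i.e. there is a unitary $W$ on $L^2(\mathbb{R})$ with $W\mathcal{A}_{\mathfrak{S}}W^*=\mathcal{A}_p$.
   Context: On $L^2(\mathbb{R})$, for real $\lambda,\mu$, let $(M_\lambda f)(x)=e^{i\lambda x}f(x)$ and $(D_\mu f)(x)=f(x-\mu)$. The parabolic algebra $\mathcal{A}_p$ is the weak operator topology closed algebra on $L^2(\mathbb{R})$ generated by $\{M_\lambda:\lambda\geq 0\}$ and $\{D_\mu:\mu\geq0\}$; it equals $\mathcal{A}_{\mathfrak{S}}$ for $\mathfrak{S}=\mathbb{R}_+^2$. *)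

theory Defs
  imports "HOL-Analysis.Analysis"
begin

definition sqint :: "(real \<Rightarrow> complex) \<Rightarrow> bool" where
  "sqint f \<longleftrightarrow> f \<in> borel_measurable lborel \<and> integrable lborel (\<lambda>x. (cmod (f x))\<^sup>2)"

definition aeclass :: "(real \<Rightarrow> complex) \<Rightarrow> (real \<Rightarrow> complex) set" where
  "aeclass f = {g. sqint g \<and> (AE x in lborel. g x = f x)}"

typedef L2 = "{aeclass f | f. sqint f}"
proof -
  have "sqint (\<lambda>_. 0)" by (simp add: sqint_def)
  then show ?thesis by blast
qed

definition rep :: "L2 \<Rightarrow> real \<Rightarrow> complex" where
  "rep x = (SOME f. f \<in> Rep_L2 x)"

definition mk :: "(real \<Rightarrow> complex) \<Rightarrow> L2" where
  "mk f = Abs_L2 (aeclass f)"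

definition l2_zero :: L2 where "l2_zero = mk (\<lambda>_. 0)"
definition l2_plus :: "L2 \<Rightarrow> L2 \<Rightarrow> L2" where
  "l2_plus x y = mk (\<lambda>t. rep x t + rep y t)"
definition l2_scale :: "complex \<Rightarrow> L2 \<Rightarrow> L2" where
  "l2_scale c x = mk (\<lambda>t. c * rep x t)"
definition l2_inner :: "L2 \<Rightarrow> L2 \<Rightarrow> complex" where
  "l2_inner x y = (LINT t|lborel. rep x t * cnj (rep y t))"
definition l2_norm :: "L2 \<Rightarrow> real" where
  "l2_norm x = sqrt (LINT t|lborel. (cmod (rep x t))\<^sup>2)"

definition bop :: "(L2 \<Rightarrow> L2) \<Rightarrow> bool" where
  "bop T \<longleftrightarrow> (\<forall>x y. T (l2_plus x y) = l2_plus (T x) (T y))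
           \<and> (\<forall>c x. T (l2_scale c x) = l2_scale c (T x))
           \<and> (\<exists>C. \<forall>x. l2_norm (T x) \<le> C * l2_norm x)"

definition unitary :: "(L2 \<Rightarrow> L2) \<Rightarrow> bool" where
  "unitary W \<longleftrightarrow> bop W \<and> bij W \<and> (\<forall>x y. l2_inner (W x) (W y) = l2_inner x y)"

definition M_op :: "real \<Rightarrow> L2 \<Rightarrow> L2" where
  "M_op lam x = mk (\<lambda>t. exp (\<i> * complex_of_real (lam * t)) * rep x t)"
definition D_op :: "real \<Rightarrow> L2 \<Rightarrow> L2" where
  "D_op mu x = mk (\<lambda>t. rep x (t - mu))"

inductive_set ospan :: "(L2 \<Rightarrow> L2) set \<Rightarrow> (L2 \<Rightarrow> L2) set" for U where
  zero: "(\<lambda>x. l2_zero) \<in> ospan U"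
| base: "V \<in> U \<Longrightarrow> V \<in> ospan U"
| add: "S \<in> ospan U \<Longrightarrow> T \<in> ospan U \<Longrightarrow> (\<lambda>x. l2_plus (S x) (T x)) \<in> ospan U"
| scale: "T \<in> ospan U \<Longrightarrow> (\<lambda>x. l2_scale c (T x)) \<in> ospan U"

inductive_set oalg :: "(L2 \<Rightarrow> L2) set \<Rightarrow> (L2 \<Rightarrow> L2) set" for U where
  zero: "(\<lambda>x. l2_zero) \<in> oalg U"
| base: "V \<in> U \<Longrightarrow> V \<in> oalg U"
| add: "S \<in> oalg U \<Longrightarrow> T \<in> oalg U \<Longrightarrow> (\<lambda>x. l2_plus (S x) (T x)) \<in> oalg U"
| scale: "T \<in> oalg U \<Longrightarrow> (\<lambda>x. l2_scale c (T x)) \<in> oalg U"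
| comp: "S \<in> oalg U \<Longrightarrow> T \<in> oalg U \<Longrightarrow> S \<circ> T \<in> oalg U"

definition wot_closure :: "(L2 \<Rightarrow> L2) set \<Rightarrow> (L2 \<Rightarrow> L2) set" where
  "wot_closure A = {T. bop T \<and>
     (\<forall>(m::nat) (F::nat \<Rightarrow> L2) (G::nat \<Rightarrow> L2) (e::real). e > 0 \<longrightarrow>
        (\<exists>S\<in>A. \<forall>j<m. cmod (l2_inner (T (F j)) (G j) - l2_inner (S (F j)) (G j)) < e))}"

text \<open>Closure in B(L^2) for the weak* (ultraweak, sigma-weak) topology: basic
  neighbourhoods are given by finitely many normal functionals
  T \<mapsto> sum_k <T f_k, g_k> with sum_k ||f_k||^2, sum_k ||g_k||^2 finite.\<close>
definition wstar_closure :: "(L2 \<Rightarrow> L2) set \<Rightarrow> (L2 \<Rightarrow> L2) set" where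
  "wstar_closure A = {T. bop T \<and>
     (\<forall>(m::nat) (F::nat \<Rightarrow> nat \<Rightarrow> L2) (G::nat \<Rightarrow> nat \<Rightarrow> L2) (e::real).
        e > 0 \<and> (\<forall>j<m. summable (\<lambda>k. (l2_norm (F j k))\<^sup>2) \<and> summable (\<lambda>k. (l2_norm (G j k))\<^sup>2))
        \<longrightarrow> (\<exists>S\<in>A. \<forall>j<m. cmod ((\<Sum>k. l2_inner (T (F j k)) (G j k))
                                   - (\<Sum>k. l2_inner (S (F j k)) (G j k))) < e))}"

definition A_cone :: "(real \<times> real) set \<Rightarrow> (L2 \<Rightarrow> L2) set" where
  "A_cone S = wstar_closure (ospan {M_op lam \<circ> D_op mu | lam mu. (lam, mu) \<in> S})"

definition A_p :: "(L2 \<Rightarrow> L2) set" where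
  "A_p = wot_closure (oalg ({M_op lam | lam. lam \<ge> 0} \<union> {D_op mu | mu. mu \<ge> 0}))"

end

theory Submission
  imports Defs
begin

text \<open>
  The unitaries \<open>M\<^sub>l D\<^sub>m\<close> form a projective representation of the plane on which \<open>SL(2,R)\<close> acts,
  up to unimodular scalars, through the chirps, the dilations and the Fourier transform, so that every
  simple cone can be moved to the quadrant. It remains to see that for the quadrant the weak*-closed span
  and the WOT-closed algebra agree, which is not automatic, as the two closures of a subspace may differ.

  An operator \<open>T\<close> in the WOT closure is triangular for the nests of half-lines in position and in momentum.
  By finite-dimensional separation it suffices that a normal functional vanishing on all \<open>M\<^sub>l D\<^sub>m\<close>
  with \<open>l, m \<ge> 0\<close> vanishes on \<open>T\<close>. Compressing \<open>T\<close> by short averages of translations and modulations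
  gives an integral operator with a bounded continuous kernel, which vanishes above the diagonal by
  triangularity in position. On a parallel to the diagonal the kernel is a matrix coefficient
  \<open>x \<mapsto> \<langle>T D\<^sub>x f, D\<^sub>x g\<rangle>\<close>; cutting momentum into small cells and using triangularity in momentum exhibits it
  as a bounded pointwise limit of trigonometric polynomials with nonnegative frequencies. Hence the
  functional kills the compressions of \<open>T\<close>, and these converge to \<open>T\<close>.
\<close>

section \<open>The Hilbert space of square-integrable functions\<close>

text \<open>WOT continuity controls single matrix coefficients, while a normal functional is an
  infinite sum of them, and WOT approximants of \<open>T\<close> carry no common norm bound. So only
  the two orthogonality relations are taken over from the approximants; everything else concerns
  \<open>T\<close> itself. With \<open>havg d\<close> the average of the characters cis(s x) over 0
  <= s <= d, the compression puts averages of M_s and D_s, always with s >= 0, on both sides of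
  \<open>T\<close>. It is an integral over u of the operators
  \<open>mulop (sy T d u) \<circ> D_op u\<close>. The two nests play separate roles: position leaves
  only u >= 0, momentum leaves only nonnegative frequencies in the symbol \<open>sy T d u\<close>.
  For fixed u a normal functional acts on symbols as integration against an integrable density, so
  bounded pointwise limits of symbols are enough, by dominated convergence. The modulation average
  is moreover square integrable; this makes the kernel integrable against pairs of L2 functions and
  justifies the exchange of integrals.\<close>

lemma borel_measurable_cnj [measurable]:
  "f \<in> borel_measurable M \<Longrightarrow> (\<lambda>x. cnj (f x)) \<in> borel_measurable M"
  by (rule borel_measurable_continuous_on) (auto intro: continuous_intros)

lemma complex_mult_cnj_cmod: "z * cnj z = complex_of_real ((cmod z)\<^sup>2)"
  by (rule complex_norm_square[symmetric])

lemma sqint_integrable_mult: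
  assumes "sqint f" "sqint g"
  shows "integrable lborel (\<lambda>t. f t * g t)"
proof (rule Bochner_Integration.integrable_bound)
  show "integrable lborel (\<lambda>t. (cmod (f t))\<^sup>2 + (cmod (g t))\<^sup>2)"
    using assms by (auto simp: sqint_def)
  show "(\<lambda>t. f t * g t) \<in> borel_measurable lborel"
    using assms by (auto simp: sqint_def)
  have "a * b \<le> a\<^sup>2 + b\<^sup>2" if "a \<ge> 0" "b \<ge> 0" for a b :: real
    using sum_squares_bound[of a b] mult_nonneg_nonneg[OF that] by linarith
  then show "AE t in lborel. norm (f t * g t) \<le> norm ((cmod (f t))\<^sup>2 + (cmod (g t))\<^sup>2)"
    by (intro AE_I2) (simp add: norm_mult)
qed

lemma sqint_cnj: "sqint f \<Longrightarrow> sqint (\<lambda>t. cnj (f t))"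
  by (auto simp: sqint_def)

lemma sqint_bound:
  assumes "sqint g" "f \<in> borel_measurable borel" "AE t in lborel. cmod (f t) \<le> C * cmod (g t)"
  shows "sqint f"
  unfolding sqint_def
proof
  show "f \<in> borel_measurable lborel" using assms by simp
  have [measurable]: "f \<in> borel_measurable borel" by fact
  show "integrable lborel (\<lambda>x. (cmod (f x))\<^sup>2)"
  proof (rule Bochner_Integration.integrable_bound)
    show "integrable lborel (\<lambda>t. C\<^sup>2 * (cmod (g t))\<^sup>2)"
      using assms by (auto simp: sqint_def)
    show "AE t in lborel. norm ((cmod (f t))\<^sup>2) \<le> norm (C\<^sup>2 * (cmod (g t))\<^sup>2)"
      using assms(3) by eventually_elim (simp, metis norm_ge_zero power_mono power_mult_distrib)
  qed auto
qed

lemma sqint_add: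
  assumes "sqint f" "sqint g"
  shows "sqint (\<lambda>t. f t + g t)"
  unfolding sqint_def
proof
  have [measurable]: "f \<in> borel_measurable borel" "g \<in> borel_measurable borel"
    using assms by (auto simp: sqint_def)
  show "(\<lambda>t. f t + g t) \<in> borel_measurable lborel" by simp
  show "integrable lborel (\<lambda>t. (cmod (f t + g t))\<^sup>2)"
  proof (rule Bochner_Integration.integrable_bound)
    show "integrable lborel (\<lambda>t. 2 * (cmod (f t))\<^sup>2 + 2 * (cmod (g t))\<^sup>2)"
      using assms by (auto simp: sqint_def)
    have "(cmod (a + b))\<^sup>2 \<le> 2 * (cmod a)\<^sup>2 + 2 * (cmod b)\<^sup>2" for a b
    proof -
      have "(cmod (a + b))\<^sup>2 \<le> (cmod a + cmod b)\<^sup>2"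
        by (intro power_mono norm_triangle_ineq) auto
      also have "\<dots> \<le> 2 * (cmod a)\<^sup>2 + 2 * (cmod b)\<^sup>2"
        using sum_squares_bound[of "cmod a" "cmod b"] by (simp add: power2_sum)
      finally show ?thesis .
    qed
    then show "AE t in lborel. norm ((cmod (f t + g t))\<^sup>2) \<le> norm (2 * (cmod (f t))\<^sup>2 + 2 * (cmod (g t))\<^sup>2)"
      by (intro AE_I2) simp
  qed auto
qed

lemma sqint_zero [simp]: "sqint (\<lambda>_. 0)" by (simp add: sqint_def)

lemma sqint_scale: "sqint f \<Longrightarrow> sqint (\<lambda>t. c * f t)"
  by (rule sqint_bound[of f _ "cmod c"]) (auto simp: sqint_def norm_mult)

lemma sqint_uminus: "sqint f \<Longrightarrow> sqint (\<lambda>t. - f t)"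
  using sqint_scale[of f "-1"] by simp

lemma sqint_diff: "sqint f \<Longrightarrow> sqint g \<Longrightarrow> sqint (\<lambda>t. f t - g t)"
  using sqint_add[of f "\<lambda>t. - g t"] sqint_uminus[of g] by simp

section \<open>Representatives and almost-everywhere equality\<close>

lemma Rep_L2_obtain:
  obtains f where "sqint f" "Rep_L2 x = aeclass f"
  using Rep_L2[of x] by auto

lemma aeclass_self: "sqint f \<Longrightarrow> f \<in> aeclass f"
  by (simp add: aeclass_def)

lemma rep_in: "rep x \<in> Rep_L2 x"
  unfolding rep_def by (metis Rep_L2_obtain aeclass_self someI)

lemma sqint_rep [simp, intro]: "sqint (rep x)"
  using rep_in[of x] Rep_L2_obtain[of x] by (auto simp: aeclass_def)

lemma rep_measurable [measurable, simp]: "rep x \<in> borel_measurable borel"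
  using sqint_rep[of x] by (simp add: sqint_def)

lemma Rep_mk: "sqint f \<Longrightarrow> Rep_L2 (mk f) = aeclass f"
  unfolding mk_def by (rule Abs_L2_inverse) auto

lemma rep_mk: "sqint f \<Longrightarrow> AE t in lborel. rep (mk f) t = f t"
  using rep_in[of "mk f"] by (simp add: Rep_mk aeclass_def)

lemma aeclass_cong:
  assumes "AE t in lborel. f t = g t"
  shows "aeclass f = aeclass g"
proof -
  have "(AE t in lborel. h t = f t) \<longleftrightarrow> (AE t in lborel. h t = g t)" for h
    by (rule eventually_cong[OF assms]) auto
  then show ?thesis by (simp add: aeclass_def)
qed

lemma mk_cong: "AE t in lborel. f t = g t \<Longrightarrow> mk f = mk g"
  unfolding mk_def using aeclass_cong by metis

lemma mk_rep [simp]: "mk (rep x) = x"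
proof -
  obtain f where f: "sqint f" "Rep_L2 x = aeclass f" by (rule Rep_L2_obtain)
  then have "AE t in lborel. rep x t = f t" using rep_in[of x] by (simp add: aeclass_def)
  then show ?thesis using f mk_cong mk_def Rep_L2_inverse by metis
qed

lemma L2_eqI: "AE t in lborel. rep x t = rep y t \<Longrightarrow> x = y"
  using mk_cong[of "rep x" "rep y"] by simp

lemma mk_eqI: "AE t in lborel. f t = rep y t \<Longrightarrow> mk f = y"
  using mk_cong[of f "rep y"] by simp

lemma rep_l2_zero: "AE t in lborel. rep l2_zero t = 0"
  unfolding l2_zero_def by (rule rep_mk) simp

lemma rep_l2_plus: "AE t in lborel. rep (l2_plus x y) t = rep x t + rep y t"
  unfolding l2_plus_def by (rule rep_mk) (simp add: sqint_add)

lemma rep_l2_scale: "AE t in lborel. rep (l2_scale c x) t = c * rep x t"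
  unfolding l2_scale_def by (rule rep_mk) (simp add: sqint_scale)

lemma l2_inner_integrable: "integrable lborel (\<lambda>t. rep x t * cnj (rep y t))"
  by (intro sqint_integrable_mult sqint_cnj) auto

lemma l2_norm_integrable: "integrable lborel (\<lambda>t. (cmod (rep x t))\<^sup>2)"
  using sqint_rep[of x] by (simp add: sqint_def)

lemma l2_inner_self: "l2_inner x x = complex_of_real (LINT t|lborel. (cmod (rep x t))\<^sup>2)"
  unfolding l2_inner_def
  unfolding complex_mult_cnj_cmod by (rule integral_complex_of_real)

lemma l2_inner_commute: "l2_inner y x = cnj (l2_inner x y)"
  unfolding l2_inner_def
  using Bochner_Integration.integral_cnj[of lborel "\<lambda>t. rep x t * cnj (rep y t)"] by (simp add: mult.commute)

lemma l2_inner_eqI: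
  assumes "AE t in lborel. rep x t = f t" "AE t in lborel. rep y t = g t"
    and [measurable]: "f \<in> borel_measurable borel" "g \<in> borel_measurable borel"
  shows "l2_inner x y = (LINT t|lborel. f t * cnj (g t))"
  unfolding l2_inner_def
proof (rule integral_cong_AE)
  show "AE t in lborel. rep x t * cnj (rep y t) = f t * cnj (g t)"
    using assms(1,2) by eventually_elim simp
qed auto

lemma l2_inner_mk:
  assumes "sqint f" "sqint g"
  shows "l2_inner (mk f) (mk g) = (LINT t|lborel. f t * cnj (g t))"
  using assms by (intro l2_inner_eqI rep_mk) (auto simp: sqint_def)

lemma l2_inner_mk_right:
  assumes "sqint g"
  shows "l2_inner x (mk g) = (LINT t|lborel. rep x t * cnj (g t))"
  using assms l2_inner_mk[of "rep x" g] by simp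

lemma l2_inner_plus_left: "l2_inner (l2_plus x y) z = l2_inner x z + l2_inner y z"
proof -
  have "l2_inner (l2_plus x y) z = (LINT t|lborel. (rep x t + rep y t) * cnj (rep z t))"
    by (intro l2_inner_eqI rep_l2_plus) auto
  also have "\<dots> = (LINT t|lborel. rep x t * cnj (rep z t) + rep y t * cnj (rep z t))"
    by (simp add: algebra_simps)
  also have "\<dots> = l2_inner x z + l2_inner y z"
    unfolding l2_inner_def by (intro Bochner_Integration.integral_add l2_inner_integrable)
  finally show ?thesis .
qed

lemma l2_inner_scale_left: "l2_inner (l2_scale c x) z = c * l2_inner x z"
proof -
  have "l2_inner (l2_scale c x) z = (LINT t|lborel. (c * rep x t) * cnj (rep z t))"
    by (intro l2_inner_eqI rep_l2_scale) auto
  then show ?thesis by (simp add: l2_inner_def mult.assoc)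
qed

text \<open>The real part of \<open>l2_inner\<close> makes \<open>L2\<close> a real inner product
  space with norm \<open>l2_norm\<close>, which gives access to limits, closures and bounded linear
  maps. Complex homogeneity is carried separately through \<open>l2_scale\<close>.\<close>

instantiation L2 :: real_inner
begin

definition plus_L2 :: "L2 \<Rightarrow> L2 \<Rightarrow> L2" where "plus_L2 = l2_plus"
definition zero_L2 :: L2 where "zero_L2 = l2_zero"
definition uminus_L2 :: "L2 \<Rightarrow> L2" where "uminus_L2 = l2_scale (-1)"
definition minus_L2 :: "L2 \<Rightarrow> L2 \<Rightarrow> L2" where "minus_L2 x y = l2_plus x (l2_scale (-1) y)"
definition scaleR_L2 :: "real \<Rightarrow> L2 \<Rightarrow> L2" where "scaleR_L2 r = l2_scale (complex_of_real r)"
definition inner_L2 :: "L2 \<Rightarrow> L2 \<Rightarrow> real" where "inner_L2 x y = Re (l2_inner x y)"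
definition norm_L2 :: "L2 \<Rightarrow> real" where "norm_L2 = l2_norm"
definition sgn_L2 :: "L2 \<Rightarrow> L2" where "sgn_L2 x = l2_scale (complex_of_real (inverse (l2_norm x))) x"
definition dist_L2 :: "L2 \<Rightarrow> L2 \<Rightarrow> real" where "dist_L2 x y = norm (x - y)"
definition uniformity_L2 :: "(L2 \<times> L2) filter"
  where "uniformity_L2 = (INF e\<in>{0<..}. principal {(x, y). dist x y < e})"
definition open_L2 :: "L2 set \<Rightarrow> bool"
  where "open_L2 U \<longleftrightarrow> (\<forall>x\<in>U. eventually (\<lambda>(x', y). x' = x \<longrightarrow> y \<in> U) uniformity)"

instance
proof
  fix a b c x y z :: L2 and r s :: real and U :: "L2 set"
  note defs = plus_L2_def zero_L2_def uminus_L2_def minus_L2_def scaleR_L2_def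
  note reps = rep_l2_plus rep_l2_zero rep_l2_scale
  show "a + b + c = a + (b + c)"
    unfolding defs
    by (rule L2_eqI, use reps(1)[of "l2_plus a b" c] reps(1)[of a b] reps(1)[of a "l2_plus b c"] reps(1)[of b c] in \<open>eventually_elim, simp\<close>)
  show "a + b = b + a"
    unfolding defs by (rule L2_eqI, use reps(1)[of a b] reps(1)[of b a] in \<open>eventually_elim, simp\<close>)
  show "0 + a = a"
    unfolding defs by (rule L2_eqI, use reps(1)[of l2_zero a] reps(2) in \<open>eventually_elim, simp\<close>)
  show "- a + a = 0"
    unfolding defs by (rule L2_eqI, use reps(1)[of "l2_scale (-1) a" a] reps(2) reps(3)[of "-1" a] in \<open>eventually_elim, simp\<close>)
  show "a - b = a + - b" by (simp add: defs)
  show "r *\<^sub>R (x + y) = r *\<^sub>R x + r *\<^sub>R y"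
    unfolding defs
    by (rule L2_eqI, use reps(3)[of r "l2_plus x y"] reps(1)[of x y] reps(1)[of "l2_scale r x" "l2_scale r y"] reps(3)[of r x] reps(3)[of r y] in \<open>eventually_elim, simp add: algebra_simps\<close>)
  show "(r + s) *\<^sub>R x = r *\<^sub>R x + s *\<^sub>R x"
    unfolding defs
    by (rule L2_eqI, use reps(3)[of "complex_of_real (r + s)" x] reps(1)[of "l2_scale r x" "l2_scale s x"] reps(3)[of r x] reps(3)[of s x] in \<open>eventually_elim, simp add: algebra_simps\<close>)
  show "r *\<^sub>R s *\<^sub>R x = (r * s) *\<^sub>R x"
    unfolding defs
    by (rule L2_eqI, use reps(3)[of "complex_of_real (r * s)" x] reps(3)[of r "l2_scale s x"] reps(3)[of s x] in \<open>eventually_elim, simp add: algebra_simps\<close>)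
  show "1 *\<^sub>R x = x"
    unfolding defs by (rule L2_eqI, use reps(3)[of "complex_of_real 1" x] in \<open>eventually_elim, simp\<close>)
  show "inner x y = inner y x"
    unfolding inner_L2_def by (subst l2_inner_commute) simp
  show "inner (x + y) z = inner x z + inner y z"
    by (simp add: inner_L2_def plus_L2_def l2_inner_plus_left)
  show "inner (r *\<^sub>R x) y = r * inner x y"
    by (simp add: inner_L2_def scaleR_L2_def l2_inner_scale_left)
  show "0 \<le> inner x x"
    by (simp add: inner_L2_def l2_inner_self)
  show "inner x x = 0 \<longleftrightarrow> x = 0"
  proof
    assume "inner x x = 0"
    then have "(LINT t|lborel. (cmod (rep x t))\<^sup>2) = 0" by (simp add: inner_L2_def l2_inner_self)
    then have "AE t in lborel. (cmod (rep x t))\<^sup>2 = 0"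
      by (subst (asm) integral_nonneg_eq_0_iff_AE) (auto simp: l2_norm_integrable)
    then have "AE t in lborel. rep x t = rep l2_zero t"
      using rep_l2_zero by eventually_elim simp
    then show "x = 0"
      unfolding zero_L2_def by (rule L2_eqI)
  next
    assume "x = 0"
    moreover have "(LINT t|lborel. (cmod (rep l2_zero t))\<^sup>2) = (LINT t|(lborel :: real measure). 0)"
      using rep_l2_zero by (intro integral_cong_AE) (auto elim!: eventually_mono)
    ultimately show "inner x x = 0" by (simp add: inner_L2_def l2_inner_self zero_L2_def)
  qed
  show "norm x = sqrt (inner x x)"
    by (simp add: norm_L2_def l2_norm_def inner_L2_def l2_inner_self)
qed (simp_all add: sgn_L2_def dist_L2_def norm_L2_def scaleR_L2_def uniformity_L2_def open_L2_def)

end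

lemmas l2_fold = plus_L2_def[symmetric] zero_L2_def[symmetric] norm_L2_def[symmetric]

lemma rep_plus: "AE t in lborel. rep (x + y) t = rep x t + rep y t"
  unfolding plus_L2_def by (rule rep_l2_plus)

lemma rep_zero: "AE t in lborel. rep 0 t = 0"
  unfolding zero_L2_def by (rule rep_l2_zero)

lemma rep_minus: "AE t in lborel. rep (x - y) t = rep x t - rep y t"
  unfolding minus_L2_def
  using rep_l2_plus[of x "l2_scale (-1) y"] rep_l2_scale[of "-1" y] by eventually_elim simp

lemma l2_inner_add_left: "l2_inner (x + y) z = l2_inner x z + l2_inner y z"
  by (simp add: plus_L2_def l2_inner_plus_left)

lemma l2_inner_scaleR_left: "l2_inner (r *\<^sub>R x) z = complex_of_real r * l2_inner x z"
  by (simp add: scaleR_L2_def l2_inner_scale_left)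

lemma l2_inner_add_right: "l2_inner z (x + y) = l2_inner z x + l2_inner z y"
  using l2_inner_commute[of z "x + y"] l2_inner_commute[of z x] l2_inner_commute[of z y]
  by (simp add: l2_inner_add_left)

lemma l2_inner_scale_right: "l2_inner z (l2_scale c x) = cnj c * l2_inner z x"
  using l2_inner_commute[of z "l2_scale c x"] l2_inner_commute[of z x]
  by (simp add: l2_inner_scale_left)

lemma l2_inner_scaleR_right: "l2_inner z (r *\<^sub>R x) = complex_of_real r * l2_inner z x"
  by (simp add: scaleR_L2_def l2_inner_scale_right)

lemma l2_inner_diff_left: "l2_inner (x - y) z = l2_inner x z - l2_inner y z"
  using l2_inner_add_left[of "x - y" y z] by simp

lemma l2_inner_diff_right: "l2_inner z (x - y) = l2_inner z x - l2_inner z y"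
  using l2_inner_add_right[of z "x - y" y] by simp

lemma l2_inner_zero [simp]: "l2_inner 0 x = 0" "l2_inner x 0 = 0"
  using l2_inner_diff_left[of x x x] l2_inner_diff_right[of x x x] by auto

lemma l2_inner_sum_left: "l2_inner (sum f A) z = (\<Sum>i\<in>A. l2_inner (f i) z)"
  by (induction A rule: infinite_finite_induct) (auto simp: l2_inner_add_left)

lemma l2_inner_sum_right: "l2_inner z (sum f A) = (\<Sum>i\<in>A. l2_inner z (f i))"
  by (induction A rule: infinite_finite_induct) (auto simp: l2_inner_add_right)

lemma l2_scale_add_right: "l2_scale c (x + y) = l2_scale c x + l2_scale c y"
  unfolding plus_L2_def
  by (rule L2_eqI, use rep_l2_scale[of c "l2_plus x y"] rep_l2_plus[of x y]
    rep_l2_plus[of "l2_scale c x" "l2_scale c y"] rep_l2_scale[of c x] rep_l2_scale[of c y]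
    in \<open>eventually_elim, simp add: algebra_simps\<close>)

lemma l2_scale_scale: "l2_scale c (l2_scale d x) = l2_scale (c * d) x"
  by (rule L2_eqI, use rep_l2_scale[of c "l2_scale d x"] rep_l2_scale[of d x] rep_l2_scale[of "c * d" x] in \<open>eventually_elim, simp add: algebra_simps\<close>)

lemma l2_scale_one [simp]: "l2_scale 1 x = x"
  by (rule L2_eqI, use rep_l2_scale[of 1 x] in \<open>eventually_elim, simp\<close>)

lemma l2_scale_zero [simp]: "l2_scale c 0 = 0"
  using l2_scale_add_right[of c 0 0] by simp

lemma l2_norm_sq_integral: "(norm x)\<^sup>2 = (LINT t|lborel. (cmod (rep x t))\<^sup>2)"
  by (simp add: norm_L2_def l2_norm_def)

lemma l2_inner_norm: "l2_inner x x = complex_of_real ((norm x)\<^sup>2)"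
  by (simp add: l2_inner_self l2_norm_sq_integral)

lemma norm_mk:
  assumes "sqint f"
  shows "(norm (mk f))\<^sup>2 = (LINT t|lborel. (cmod (f t))\<^sup>2)"
  unfolding l2_norm_sq_integral
proof (rule integral_cong_AE)
  show "AE t in lborel. (cmod (rep (mk f) t))\<^sup>2 = (cmod (f t))\<^sup>2"
    using rep_mk[OF assms] by eventually_elim simp
qed (use assms in \<open>auto simp: sqint_def\<close>)

lemma norm_l2_scale: "norm (l2_scale c x) = cmod c * norm x"
proof -
  have "complex_of_real ((norm (l2_scale c x))\<^sup>2) = c * cnj c * complex_of_real ((norm x)\<^sup>2)"
    unfolding l2_inner_norm[symmetric] l2_inner_scale_left l2_inner_scale_right
    by (simp only: mult_ac)
  also have "\<dots> = complex_of_real ((cmod c * norm x)\<^sup>2)"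
    by (simp only: complex_mult_cnj_cmod of_real_mult power_mult_distrib)
  finally have "(norm (l2_scale c x))\<^sup>2 = (cmod c * norm x)\<^sup>2" by (simp only: of_real_eq_iff)
  then show ?thesis by (simp add: power2_eq_iff_nonneg)
qed

text \<open>Multiplying \<open>x\<close> by a unimodular \<open>c\<close> makes the inner product
  real and nonnegative; then the inequality for the real inner product applies.\<close>

lemma l2_Cauchy_Schwarz: "cmod (l2_inner x y) \<le> norm x * norm y"
proof (cases "l2_inner x y = 0")
  case False
  define c where "c = cnj (l2_inner x y) / cmod (l2_inner x y)"
  have c: "cmod c = 1" using False by (simp add: c_def norm_divide)
  have "c * l2_inner x y = (l2_inner x y * cnj (l2_inner x y)) / cmod (l2_inner x y)"
    by (simp add: c_def)
  also have "\<dots> = complex_of_real (cmod (l2_inner x y))"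
    unfolding complex_mult_cnj_cmod using False by (simp add: power2_eq_square)
  finally have "c * l2_inner x y = complex_of_real (cmod (l2_inner x y))" .
  then have "cmod (l2_inner x y) = inner (l2_scale c x) y"
    by (simp add: inner_L2_def l2_inner_scale_left)
  also have "\<dots> \<le> norm (l2_scale c x) * norm y" by (rule norm_cauchy_schwarz)
  finally show ?thesis by (simp add: norm_l2_scale c)
qed simp

lemma l2_eq_iff_inner: "x = y \<longleftrightarrow> (\<forall>z. l2_inner x z = l2_inner y z)"
proof
  assume "\<forall>z. l2_inner x z = l2_inner y z"
  then have "l2_inner (x - y) (x - y) = 0" by (simp add: l2_inner_diff_left)
  then show "x = y" by (simp add: l2_inner_norm)
qed simp

lemma bounded_bilinear_l2_inner: "bounded_bilinear l2_inner"
proof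
  show "\<exists>K. \<forall>a b. norm (l2_inner a b) \<le> norm a * norm b * K"
    by (intro exI[of _ 1]) (simp add: l2_Cauchy_Schwarz)
qed (auto simp: l2_inner_add_left l2_inner_add_right l2_inner_scaleR_left l2_inner_scaleR_right scaleR_conv_of_real)

lemmas tendsto_l2_inner [tendsto_intros] = bounded_bilinear.tendsto[OF bounded_bilinear_l2_inner]
lemmas continuous_on_l2_inner [continuous_intros] = bounded_bilinear.continuous_on[OF bounded_bilinear_l2_inner]

lemma bounded_linear_l2_scale: "bounded_linear (l2_scale c)"
proof (rule bounded_linear_intro[where K = "cmod c"])
  show "l2_scale c (r *\<^sub>R x) = r *\<^sub>R l2_scale c x" for r x
    by (simp add: scaleR_L2_def l2_scale_scale mult.commute)
qed (auto simp: l2_scale_add_right norm_l2_scale)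

text \<open>Separates the topological content, real linearity and boundedness, from homogeneity for
  complex scalars.\<close>

lemma bop_iff:
  "bop T \<longleftrightarrow> bounded_linear T \<and> (\<forall>c x. T (l2_scale c x) = l2_scale c (T x))"
proof
  assume T: "bop T"
  then obtain C where C: "\<And>x. norm (T x) \<le> norm x * C"
    unfolding bop_def l2_fold by (metis mult.commute)
  show "bounded_linear T \<and> (\<forall>c x. T (l2_scale c x) = l2_scale c (T x))"
    using T C unfolding bop_def l2_fold
    by (auto intro!: bounded_linear_intro[where K = C] simp: scaleR_L2_def)
next
  assume T: "bounded_linear T \<and> (\<forall>c x. T (l2_scale c x) = l2_scale c (T x))"
  then obtain C where "\<And>x. norm (T x) \<le> norm x * C"
    using bounded_linear.bounded by blast
  then show "bop T"
    unfolding bop_def l2_fold using T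
    by (auto simp: bounded_linear.linear linear_add intro!: exI[of _ C] simp: mult.commute)
qed

lemma bop_bounded_linear: "bop T \<Longrightarrow> bounded_linear T"
  by (simp add: bop_iff)

lemma bop_scale: "bop T \<Longrightarrow> T (l2_scale c x) = l2_scale c (T x)"
  by (simp add: bop_iff)

lemma bop_compose: "bop S \<Longrightarrow> bop T \<Longrightarrow> bop (S \<circ> T)"
  by (auto simp: bop_iff o_def intro: bounded_linear_compose)

lemma bop_bound:
  assumes "bop T"
  obtains C where "C \<ge> 0" "\<And>x. norm (T x) \<le> C * norm x"
  using bounded_linear.nonneg_bounded[OF bop_bounded_linear[OF assms]] by (metis mult.commute)

section \<open>Completeness and density of step functions\<close>

text \<open>Monotone convergence: the sum of the norms has finite integral, hence is finite almost
  everywhere.\<close>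

lemma AE_summable_of_integrals:
  fixes f :: "nat \<Rightarrow> real \<Rightarrow> 'a :: {banach, second_countable_topology}"
  assumes int: "\<And>i. integrable lborel (f i)" and sm: "summable (\<lambda>i. LINT x|lborel. norm (f i x))"
  shows "AE x in lborel. summable (\<lambda>i. norm (f i x))"
proof -
  have [measurable]: "f i \<in> borel_measurable borel" for i using int[of i] by auto
  have "AE x in lborel. (\<Sum>i. ennreal (norm (f i x))) \<noteq> \<infinity>"
  proof (rule nn_integral_PInf_AE)
    have "(\<integral>\<^sup>+x. (\<Sum>i. ennreal (norm (f i x))) \<partial>lborel) = (\<Sum>i. \<integral>\<^sup>+x. ennreal (norm (f i x)) \<partial>lborel)"
      by (rule nn_integral_suminf) auto
    also have "\<dots> = (\<Sum>i. ennreal (LINT x|lborel. norm (f i x)))"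
      using int by (intro suminf_cong nn_integral_eq_integral) auto
    also have "\<dots> = ennreal (\<Sum>i. LINT x|lborel. norm (f i x))"
      by (rule suminf_ennreal2[OF _ sm]) auto
    finally show "(\<integral>\<^sup>+x. (\<Sum>i. ennreal (norm (f i x))) \<partial>lborel) \<noteq> \<infinity>" by simp
  qed auto
  then show ?thesis
    by eventually_elim (rule summable_suminf_not_top, auto)
qed

text \<open>Riesz-Fischer. Along indices with geometrically small differences the representatives
  converge pointwise almost everywhere, and Fatou's lemma shows that the pointwise limit is also the
  limit in norm.\<close>

lemma L2_Cauchy_convergent:
  fixes X :: "nat \<Rightarrow> L2"
  assumes "Cauchy X"
  shows "convergent X"
proof -
  have "\<exists>N. \<forall>m\<ge>N. \<forall>k\<ge>N. norm (X m - X k) < (1/4)^n" for n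
    using CauchyD[OF assms, of "(1/4)^n"] by simp
  then obtain N where N: "\<And>n m k. m \<ge> N n \<Longrightarrow> k \<ge> N n \<Longrightarrow> norm (X m - X k) < (1/4)^n"
    by metis
  \<comment> \<open>Summing the thresholds makes the indices monotone while keeping them above
    \<open>N n\<close>.\<close>
  define r where "r n = (\<Sum>i\<le>n. N i)" for n
  have rN: "N n \<le> r n" for n
    unfolding r_def by (rule member_le_sum) auto
  have "mono r" unfolding r_def mono_def by (auto intro!: sum_mono2)
  then have r_le: "N n \<le> r m" if "n \<le> m" for n m
    using rN[of n] that by (meson le_trans monoD)
  define f where "f n = rep (X (r n))" for n
  have [measurable]: "f n \<in> borel_measurable borel" for n by (simp add: f_def)
  have sqi: "sqint (\<lambda>t. f m t - f n t)" for m n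
    unfolding f_def by (intro sqint_diff) auto
  have dist2: "(\<integral>\<^sup>+t. ennreal ((cmod (f m t - f n t))\<^sup>2) \<partial>lborel) \<le> ennreal (((1/4)^n)\<^sup>2)" if "n \<le> m" for n m
  proof -
    note sq = sqi[of m n]
    have "mk (\<lambda>t. f m t - f n t) = X (r m) - X (r n)"
      by (rule mk_eqI, use rep_minus[of "X (r m)" "X (r n)"] in \<open>eventually_elim, simp add: f_def\<close>)
    then have "(LINT t|lborel. (cmod (f m t - f n t))\<^sup>2) = (norm (X (r m) - X (r n)))\<^sup>2"
      using norm_mk[OF sq] by simp
    also have "\<dots> \<le> ((1/4)^n)\<^sup>2"
      using N[OF r_le[OF that] rN[of n]] by (intro power_mono) auto
    finally show ?thesis
      using sq by (subst nn_integral_eq_integral) (auto simp: sqint_def intro: ennreal_leI)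
  qed
  \<comment> \<open>The squared differences have integral at most 16^(-n), so the weight 4^n still
    leaves a summable series of integrals. Boundedness of the weighted terms at a point then forces
    the differences below a multiple of 2^(-n).\<close>
  have "AE t in lborel. summable (\<lambda>n. norm (4^n * (cmod (f (Suc n) t - f n t))\<^sup>2))"
  proof (rule AE_summable_of_integrals)
    show int: "integrable lborel (\<lambda>t. 4^n * (cmod (f (Suc n) t - f n t))\<^sup>2)" for n
      using sqi[of "Suc n" n] by (simp add: sqint_def)
    show "summable (\<lambda>n. LINT t|lborel. norm (4^n * (cmod (f (Suc n) t - f n t))\<^sup>2))"
    proof (rule summable_comparison_test'[of "\<lambda>n. (1/4)^n" 0])
      fix n
      have "ennreal (LINT t|lborel. (cmod (f (Suc n) t - f n t))\<^sup>2) \<le> ennreal (((1/4)^n)\<^sup>2)"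
        using dist2[of n "Suc n"] sqi[of "Suc n" n] by (subst nn_integral_eq_integral[symmetric]) (auto simp: sqint_def)
      then have "4^n * (LINT t|lborel. (cmod (f (Suc n) t - f n t))\<^sup>2) \<le> 4^n * ((1/4)^n)\<^sup>2"
        by (intro mult_left_mono) (simp_all add: ennreal_le_iff)
      then show "norm (LINT t|lborel. norm (4^n * (cmod (f (Suc n) t - f n t))\<^sup>2)) \<le> (1/4)^n"
        by (simp add: power2_eq_square power_divide)
    qed (auto intro: summable_geometric)
  qed
  then have conv: "AE t in lborel. convergent (\<lambda>n. f n t)"
  proof eventually_elim
    case (elim t)
    let ?d = "\<lambda>n. f (Suc n) t - f n t"
    have "summable (\<lambda>n. 4^n * (cmod (?d n))\<^sup>2)"
      using elim by simp
    then have "Bseq (\<lambda>n. 4^n * (cmod (?d n))\<^sup>2)"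
      using summable_LIMSEQ_zero convergentI Bseq_eq_bounded convergent_imp_Bseq by blast
    then obtain K where K: "K > 0" "\<And>n. 4^n * (cmod (?d n))\<^sup>2 \<le> K"
      by (auto simp: Bseq_def)
    have "cmod (?d n) \<le> sqrt K * (1/2)^n" for n
    proof -
      have "(cmod (?d n))\<^sup>2 \<le> K * (1/4)^n"
        using K(2)[of n] by (simp add: power_divide field_simps)
      also have "\<dots> = (sqrt K * (1/2)^n)\<^sup>2"
        using K(1) power_mult_distrib[of "2::real" 2 n]
        by (simp add: power_mult_distrib power_divide power2_eq_square)
      finally show ?thesis by (rule power2_le_imp_le) (use K in auto)
    qed
    then have "summable ?d"
      by (rule summable_comparison_test'[where g = "\<lambda>n. sqrt K * (1/2)^n" and N = 0, rotated])
        (auto intro!: summable_mult summable_geometric)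
    then have "summable (\<lambda>n. f (Suc n) t - f n t)" .
    then have "convergent (\<lambda>n. \<Sum>i<n. f (Suc i) t - f i t)"
      by (simp add: summable_iff_convergent)
    then have "convergent (\<lambda>n. (\<Sum>i<n. f (Suc i) t - f i t) + f 0 t)"
      by (intro convergent_add convergent_const)
    moreover have "(\<lambda>n. (\<Sum>i<n. f (Suc i) t - f i t) + f 0 t) = (\<lambda>n. f n t)"
    proof
      show "(\<Sum>i<n. f (Suc i) t - f i t) + f 0 t = f n t" for n
        by (induction n) (auto simp: algebra_simps)
    qed
    ultimately show ?case by (simp only:)
  qed
  define F where "F t = lim (\<lambda>n. f n t)" for t
  have [measurable]: "F \<in> borel_measurable borel" unfolding F_def by measurable
  have lim: "AE t in lborel. (\<lambda>n. f n t) \<longlonglongrightarrow> F t"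
    using conv by eventually_elim (simp add: F_def convergent_LIMSEQ_iff)
  \<comment> \<open>Fatou in the first index: the bound for \<open>f m - f n\<close> with n <= m
    passes to the limit as m grows.\<close>
  have Fd: "(\<integral>\<^sup>+t. ennreal ((cmod (F t - f n t))\<^sup>2) \<partial>lborel) \<le> ennreal (((1/4)^n)\<^sup>2)" for n
  proof -
    have "(\<integral>\<^sup>+t. ennreal ((cmod (F t - f n t))\<^sup>2) \<partial>lborel)
        = (\<integral>\<^sup>+t. liminf (\<lambda>m. ennreal ((cmod (f m t - f n t))\<^sup>2)) \<partial>lborel)"
    proof (rule nn_integral_cong_AE)
      show "AE t in lborel. ennreal ((cmod (F t - f n t))\<^sup>2) = liminf (\<lambda>m. ennreal ((cmod (f m t - f n t))\<^sup>2))"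
        using lim
      proof eventually_elim
        case (elim t)
        have "(\<lambda>m. ennreal ((cmod (f m t - f n t))\<^sup>2)) \<longlonglongrightarrow> ennreal ((cmod (F t - f n t))\<^sup>2)"
          by (intro tendsto_intros elim)
        then show ?case by (rule lim_imp_Liminf[OF sequentially_bot, symmetric])
      qed
    qed
    also have "\<dots> \<le> liminf (\<lambda>m. \<integral>\<^sup>+t. ennreal ((cmod (f m t - f n t))\<^sup>2) \<partial>lborel)"
      by (rule nn_integral_liminf) auto
    also have "\<dots> \<le> ennreal (((1/4)^n)\<^sup>2)"
      by (rule order_trans[OF Liminf_le_Limsup[OF sequentially_bot] Limsup_bounded])
        (rule eventually_mono[OF eventually_ge_at_top[of n] dist2])
    finally show ?thesis .
  qed
  have sqd: "sqint (\<lambda>t. F t - f n t)" for n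
    unfolding sqint_def
  proof
    show "integrable lborel (\<lambda>t. (cmod (F t - f n t))\<^sup>2)"
    proof (rule integrableI_bounded)
      show "(\<integral>\<^sup>+t. ennreal (norm ((cmod (F t - f n t))\<^sup>2)) \<partial>lborel) < \<infinity>"
        using Fd[of n] by (simp add: less_top[symmetric]) (metis ennreal_less_top leD top.not_eq_extremum)
    qed auto
  qed auto
  have sqF: "sqint F"
    using sqint_add[OF sqd[of 0] sqint_rep[of "X (r 0)"]] by (simp add: f_def)
  have bnd: "norm (mk F - X (r n)) \<le> (1/4)^n" for n
  proof -
    have "mk (\<lambda>t. F t - f n t) = mk F - X (r n)"
      by (rule mk_eqI, use rep_minus[of "mk F" "X (r n)"] rep_mk[OF sqF] in \<open>eventually_elim, simp add: f_def\<close>)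
    then have "ennreal ((norm (mk F - X (r n)))\<^sup>2) \<le> ennreal (((1/4)^n)\<^sup>2)"
      using Fd[of n] norm_mk[OF sqd[of n]] sqd[of n] 
      by (subst (asm) nn_integral_eq_integral) (auto simp: sqint_def)
    then show ?thesis by (subst (asm) ennreal_le_iff) (auto intro: power2_le_imp_le)
  qed
  have "X \<longlonglongrightarrow> mk F"
  proof (rule LIMSEQ_I)
    fix e :: real assume "e > 0"
    then obtain n where n: "(1/4)^n < e / 2"
      using real_arch_pow_inv[of "e/2" "1/4"] by auto
    have "norm (X m - mk F) < e" if "m \<ge> r n" for m
    proof -
      have "norm (X m - mk F) \<le> norm (X m - X (r n)) + norm (mk F - X (r n))"
        using norm_triangle_ineq4[of "X m - X (r n)" "mk F - X (r n)"] by simp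
      also have "\<dots> < e"
        using N[of n m "r n"] rN[of n] that bnd[of n] n by (simp add: le_trans)
      finally show ?thesis .
    qed
    then show "\<exists>no. \<forall>m\<ge>no. norm (X m - mk F) < e" by blast
  qed
  then show ?thesis by (rule convergentI)
qed

instance L2 :: banach
  by standard (rule L2_Cauchy_convergent)

text \<open>The representing vector is the minimiser of |x|^2 - 2 f(x) over \<open>V\<close>. With
  \<open>V = UNIV\<close> this is Riesz representation; for \<open>f = inner x\<close> the minimiser
  is the orthogonal projection of \<open>x\<close> onto \<open>V\<close>.\<close>

lemma riesz_closed_subspace:
  fixes f :: "'a :: {real_inner, complete_space} \<Rightarrow> real"
  assumes f: "bounded_linear f" and V: "subspace V" "closed V"
  obtains v where "v \<in> V" "\<And>y. y \<in> V \<Longrightarrow> f y = inner v y"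
proof -
  interpret f: bounded_linear f by fact
  obtain K where K: "\<And>x. norm (f x) \<le> norm x * K" using f.bounded by blast
  define J where "J x = inner x x - 2 * f x" for x
  have Jlow: "- K\<^sup>2 \<le> J x" for x
  proof -
    have "0 \<le> (norm x - K)\<^sup>2" by simp
    then have "2 * (norm x * K) \<le> (norm x)\<^sup>2 + K\<^sup>2" by (simp add: power2_diff)
    moreover have "f x \<le> norm x * K" using K[of x] by simp
    ultimately have "2 * f x \<le> (norm x)\<^sup>2 + K\<^sup>2" by linarith
    then show ?thesis by (simp add: J_def power2_norm_eq_inner)
  qed
  define I where "I = Inf (J ` V)"
  have bdd: "bdd_below (J ` V)" by (intro bdd_belowI[of _ "- K\<^sup>2"]) (use Jlow in auto)
  have ne: "J ` V \<noteq> {}" using V(1) subspace_0 by blast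
  have IJ: "I \<le> J x" if "x \<in> V" for x
    unfolding I_def using that bdd by (intro cInf_lower) auto
  have "\<exists>x\<in>V. J x < I + inverse (real (Suc n))" for n
  proof -
    have "Inf (J ` V) < I + inverse (real (Suc n))" by (simp add: I_def)
    then show ?thesis using cInf_less_iff[OF ne bdd] by auto
  qed
  then obtain x where xV: "\<And>n. x n \<in> V" and xJ: "\<And>n. J (x n) < I + inverse (real (Suc n))" by metis
  \<comment> \<open>Parallelogram law: the midpoint also lies in \<open>V\<close>, so its value is
    at least the infimum, and near-minimisers are close to each other.\<close>
  have par: "(norm (a - b))\<^sup>2 \<le> 2 * (J a - I) + 2 * (J b - I)" if "a \<in> V" "b \<in> V" for a b
  proof -
    have "(1/2) *\<^sub>R (a + b) \<in> V" using V(1) that by (simp add: subspace_add subspace_scale)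
    then have "I \<le> J ((1/2) *\<^sub>R (a + b))" by (rule IJ)
    moreover have "J ((1/2) *\<^sub>R (a + b)) = inner (a + b) (a + b) / 4 - f a - f b"
      unfolding J_def inner_scaleR_left inner_scaleR_right f.scaleR f.add by (simp add: field_simps)
    moreover have "(norm (a - b))\<^sup>2 = 2 * inner a a + 2 * inner b b - inner (a + b) (a + b)"
      by (simp add: power2_norm_eq_inner inner_diff_left inner_diff_right inner_add_left inner_add_right inner_commute)
    ultimately show ?thesis by (simp add: J_def)
  qed
  have "Cauchy x"
  proof (rule CauchyI)
    fix e :: real assume "e > 0"
    then obtain N where N: "inverse (real (Suc N)) < e\<^sup>2 / 4"
      using reals_Archimedean[of "e\<^sup>2 / 4"] by auto
    have "norm (x m - x n) < e" if "m \<ge> N" "n \<ge> N" for m n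
    proof -
      have *: "inverse (real (Suc k)) \<le> inverse (real (Suc N))" if "k \<ge> N" for k
        using that by (simp add: field_simps)
      have "(norm (x m - x n))\<^sup>2 < e\<^sup>2"
      proof -
        have "q < E" if "q \<le> 2 * (A - I) + 2 * (B - I)" "A < I + p" "B < I + r" "s < E / 4" "p \<le> s" "r \<le> s"
          for q A B p r s E :: real using that by (simp add: field_simps)
        from this[OF par[OF xV[of m] xV[of n]] xJ[of m] xJ[of n] N *[OF that(1)] *[OF that(2)]]
        show ?thesis .
      qed
      then show ?thesis using \<open>e > 0\<close> by (simp add: power2_less_imp_less)
    qed
    then show "\<exists>M. \<forall>m\<ge>M. \<forall>n\<ge>M. norm (x m - x n) < e" by blast
  qed
  then obtain v where v: "x \<longlonglongrightarrow> v" using Cauchy_convergent convergent_def by blast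
  have vV: "v \<in> V" using closed_sequentially[OF V(2) xV v] .
  have Jv: "J v \<le> I"
  proof (rule LIMSEQ_le)
    show "(\<lambda>n. J (x n)) \<longlonglongrightarrow> J v" unfolding J_def by (intro tendsto_intros v f.tendsto)
    show "(\<lambda>n. I + inverse (real (Suc n))) \<longlonglongrightarrow> I"
      using tendsto_add[OF tendsto_const LIMSEQ_inverse_real_of_nat, of I] by simp
  qed (use xJ in \<open>auto intro: less_imp_le\<close>)
  have "f y = inner v y" if y: "y \<in> V" for y
  proof (rule ccontr)
    assume ne: "f y \<noteq> inner v y"
    define d where "d = f y - inner v y"
    \<comment> \<open>The quadratic in t is minimal at d / |y|^2; the 1 added to the denominator
      avoids division by zero and still yields a strict decrease.\<close>
    define t where "t = d / (1 + inner y y)"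
    have "v + t *\<^sub>R y \<in> V" using V(1) vV y by (simp add: subspace_add subspace_scale)
    then have "J v \<le> J (v + t *\<^sub>R y)" using Jv IJ by force
    then have "2 * t * d \<le> t\<^sup>2 * inner y y"
      by (simp add: J_def d_def f.add f.scaleR inner_add_left inner_add_right inner_commute
          algebra_simps power2_eq_square)
    also have "\<dots> \<le> t\<^sup>2 * (1 + inner y y)" by (intro mult_left_mono) auto
    also have "\<dots> = t * d"
    proof -
      have "1 + inner y y > 0" by (simp add: add_pos_nonneg)
      then have "t * (1 + inner y y) = d" by (simp add: t_def)
      then show ?thesis by (simp add: power2_eq_square mult.assoc)
    qed
    finally have "t * d \<le> 0" by (simp add: mult.commute)
    moreover have "t * d = d\<^sup>2 / (1 + inner y y)" by (simp add: t_def power2_eq_square)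
    moreover have "d\<^sup>2 / (1 + inner y y) > 0"
      using ne by (intro divide_pos_pos) (auto simp: d_def add_pos_nonneg)
    ultimately show False by simp
  qed
  then show ?thesis using that vV by blast
qed

text \<open>Representing \<open>inner x\<close> on \<open>V\<close> yields a vector \<open>v\<close>
  of \<open>V\<close> with \<open>x - v\<close> orthogonal to \<open>V\<close>.\<close>

lemma closed_subspace_eq_UNIV:
  fixes V :: "'a :: {real_inner, complete_space} set"
  assumes V: "subspace V" "closed V" and orth: "\<And>z. (\<And>v. v \<in> V \<Longrightarrow> inner z v = 0) \<Longrightarrow> z = 0"
  shows "V = UNIV"
proof -
  have "x \<in> V" for x
  proof -
    obtain v where v: "v \<in> V" "\<And>y. y \<in> V \<Longrightarrow> inner x y = inner v y"
      using riesz_closed_subspace[OF bounded_linear_inner_right[of x] V] by metis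
    then have "x - v = 0" by (intro orth) (simp add: inner_diff_left)
    then show ?thesis using v by simp
  qed
  then show ?thesis by auto
qed

lemma bop_adjoint:
  assumes "bop T"
  obtains w' where "\<And>v. l2_inner (T v) w = l2_inner v w'"
proof -
  have "bounded_linear (\<lambda>v. inner (T v) w)"
    using bounded_linear_compose[OF bounded_linear_inner_left bop_bounded_linear[OF assms], of w]
    by (simp add: o_def)
  then obtain w' where w': "\<And>v. inner (T v) w = inner w' v"
    using riesz_closed_subspace[of "\<lambda>v. inner (T v) w" UNIV] by (auto simp: subspace_UNIV)
  have re: "Re (l2_inner (T v) w) = Re (l2_inner v w')" for v
    using w'[of v] by (metis inner_L2_def inner_commute)
  \<comment> \<open>Riesz controls real parts only; the imaginary part of z is the real part of -i
    z, and \<open>T\<close> commutes with that scalar.\<close>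
  have "Im (l2_inner (T v) w) = Im (l2_inner v w')" for v
    using re[of "l2_scale (-\<i>) v"] by (simp add: bop_scale[OF assms] l2_inner_scale_left)
  then have "l2_inner (T v) w = l2_inner v w'" for v
    using re by (simp add: complex_eq_iff)
  then show ?thesis by (rule that)
qed

text \<open>Lebesgue differentiation: off a negligible set \<open>f\<close> is the limit of its
  averages over shrinking intervals to the right, all of which vanish.\<close>

lemma AE_zero_interval_integrals:
  fixes f :: "real \<Rightarrow> complex"
  assumes int: "\<And>a b. set_integrable lborel {a..b} f"
    and zero: "\<And>a b. (LINT t:{a..b}|lborel. f t) = 0"
  shows "AE t in lborel. f t = 0"
proof -
  have on: "f integrable_on cbox a b" for a b :: real
    using set_borel_integral_eq_integral(1)[OF int[of a b]] by simp
  have z: "integral (cbox a b) f = 0" for a b :: real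
    using set_borel_integral_eq_integral(2)[OF int[of a b]] zero[of a b] by simp
  obtain N where N: "negligible N"
    "\<And>x e. \<lbrakk>x \<notin> N; 0 < e\<rbrakk> \<Longrightarrow> \<exists>d>0. \<forall>h. 0 < h \<and> h < d \<longrightarrow>
        norm (integral (cbox x (x + h *\<^sub>R One)) f /\<^sub>R h ^ DIM(real) - f x) < e"
    using integrable_ccontinuous_explicit[of f] on by metis
  have f0: "f x = 0" if xN: "x \<notin> N" for x
  proof (rule ccontr)
    assume "f x \<noteq> 0"
    then obtain d where d: "d > 0" "\<And>h. 0 < h \<and> h < d \<Longrightarrow>
        norm (integral (cbox x (x + h *\<^sub>R One)) f /\<^sub>R h ^ DIM(real) - f x) < cmod (f x)"
      using N(2)[OF xN, of "cmod (f x)"] by auto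
    show False using d(2)[of "d / 2"] d(1) by (simp only: z) simp
  qed
  have "N \<in> null_sets lebesgue" using N(1) by (simp add: negligible_iff_null_sets)
  then have "AE t in lebesgue. f t = 0"
    by (intro AE_I'[of N]) (use f0 in auto)
  then show ?thesis by (simp add: AE_completion_iff)
qed

definition ind :: "real \<Rightarrow> real \<Rightarrow> L2" where
  "ind a b = mk (\<lambda>t. complex_of_real (indicator {a..b} t))"

lemma sqint_ind: "sqint (\<lambda>t. complex_of_real (indicator {a..b} t))"
proof -
  have "(\<lambda>t. (cmod (complex_of_real (indicator {a..b} t)))\<^sup>2) = (indicator {a..b} :: real \<Rightarrow> real)"
    by (auto simp: indicator_def)
  moreover have "integrable lborel (indicator {a..b} :: real \<Rightarrow> real)"
    by (rule integrable_real_indicator) (auto simp: emeasure_lborel_Icc_eq)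
  ultimately show ?thesis unfolding sqint_def by (simp only:) simp
qed

lemma rep_ind: "AE t in lborel. rep (ind a b) t = complex_of_real (indicator {a..b} t)"
  unfolding ind_def by (rule rep_mk[OF sqint_ind])

lemma rep_set_integrable: "set_integrable lborel {a..b} (rep x)"
  unfolding set_integrable_def
  using sqint_integrable_mult[OF sqint_ind[of a b] sqint_rep[of x]] by (simp add: scaleR_conv_of_real)

lemma l2_inner_ind: "l2_inner x (ind a b) = (LINT t:{a..b}|lborel. rep x t)"
  unfolding ind_def l2_inner_mk_right[OF sqint_ind] set_lebesgue_integral_def
  by (simp add: scaleR_conv_of_real mult.commute)

lemma L2_eq_ind:
  assumes "\<And>a b. l2_inner x (ind a b) = l2_inner y (ind a b)"
  shows "x = y"
proof -
  have "AE t in lborel. rep (x - y) t = 0"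
    by (rule AE_zero_interval_integrals)
      (use assms in \<open>auto simp: rep_set_integrable l2_inner_diff_left simp flip: l2_inner_ind\<close>)
  then have "x - y = 0"
    using rep_zero by (intro L2_eqI) (elim AE_mp, auto)
  then show ?thesis by simp
qed

text \<open>Here \<open>V\<close> is a real subspace and orthogonality refers to the real inner
  product, so a vector is tested against both \<open>ind a b\<close> and its multiple by i to kill
  the real and the imaginary part of \<open>l2_inner\<close>.\<close>

lemma ind_dense:
  assumes V: "subspace V" "closed V" and "\<And>a b c. l2_scale c (ind a b) \<in> V"
  shows "V = UNIV"
proof (rule closed_subspace_eq_UNIV[OF V])
  fix z :: L2 assume z: "\<And>v. v \<in> V \<Longrightarrow> inner z v = 0"
  have "l2_inner z (ind a b) = 0" for a b
    using z[OF assms(3)[of 1 a b]] z[OF assms(3)[of \<i> a b]]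
    by (auto simp: inner_L2_def l2_inner_scale_right complex_eq_iff)
  then show "z = 0" by (intro L2_eq_ind) simp
qed

section \<open>Multiplication and affine substitution operators\<close>

lemma borel_measurable_cis [measurable]:
  "f \<in> borel_measurable M \<Longrightarrow> (\<lambda>x. cis (f x)) \<in> borel_measurable M"
  by (rule borel_measurable_continuous_on) (auto intro: continuous_intros)

text \<open>Fubini integrability by domination. The bound \<open>g y\<close> may vary with
  \<open>y\<close> as long as its mass is constant, which covers product kernels and also translates
  such as |G(y + u)|.\<close>

lemma integrable_pair_bound:
  fixes k :: "real \<times> real \<Rightarrow> complex"
  assumes [measurable]: "k \<in> borel_measurable (lborel \<Otimes>\<^sub>M lborel)"
    and f: "integrable lborel f" and g: "\<And>y. integrable lborel (g y)" "\<And>y. (LINT u|lborel. g y u) = c"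
    and le: "\<And>y u. cmod (k (y, u)) \<le> f y * g y u"
  shows "integrable (lborel \<Otimes>\<^sub>M lborel) k"
    "(LINT y|lborel. LINT u|lborel. cmod (k (y, u))) \<le> (LINT y|lborel. f y) * c"
proof -
  have int: "integrable lborel (\<lambda>u. k (y, u))" for y
  proof (rule Bochner_Integration.integrable_bound)
    show "integrable lborel (\<lambda>u. f y * g y u)" using g by simp
    show "AE u in lborel. norm (k (y, u)) \<le> norm (f y * g y u)"
      unfolding real_norm_def by (intro AE_I2 order_trans[OF le abs_ge_self])
  qed measurable
  have bound: "(LINT u|lborel. cmod (k (y, u))) \<le> f y * c" for y
  proof -
    have "(LINT u|lborel. cmod (k (y, u))) \<le> (LINT u|lborel. f y * g y u)"
      using int g le by (intro integral_mono) auto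
    then show ?thesis by (simp add: g)
  qed
  have oint: "integrable lborel (\<lambda>y. LINT u|lborel. cmod (k (y, u)))"
  proof (rule Bochner_Integration.integrable_bound)
    show "integrable lborel (\<lambda>y. f y * c)" using f by simp
    show "AE y in lborel. norm (LINT u|lborel. cmod (k (y, u))) \<le> norm (f y * c)"
      using bound by (intro AE_I2) (auto intro: order_trans[OF _ abs_ge_self])
  qed measurable
  show "integrable (lborel \<Otimes>\<^sub>M lborel) k"
    by (rule lborel_pair.Fubini_integrable) (use int oint in auto)
  have "(LINT y|lborel. LINT u|lborel. cmod (k (y, u))) \<le> (LINT y|lborel. f y * c)"
    using oint f bound by (intro integral_mono) auto
  then show "(LINT y|lborel. LINT u|lborel. cmod (k (y, u))) \<le> (LINT y|lborel. f y) * c"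
    by simp
qed

definition bmf :: "(real \<Rightarrow> complex) \<Rightarrow> bool" where
  "bmf q \<longleftrightarrow> q \<in> borel_measurable borel \<and> (\<exists>C. \<forall>t. cmod (q t) \<le> C)"

definition mulop :: "(real \<Rightarrow> complex) \<Rightarrow> L2 \<Rightarrow> L2" where
  "mulop q x = mk (\<lambda>t. q t * rep x t)"

lemma bmfI: "q \<in> borel_measurable borel \<Longrightarrow> (\<And>t. cmod (q t) \<le> C) \<Longrightarrow> bmf q"
  by (auto simp: bmf_def)

lemma bmf_measurable: "bmf q \<Longrightarrow> q \<in> borel_measurable borel"
  by (simp add: bmf_def)

lemma bmf_cis: "f \<in> borel_measurable borel \<Longrightarrow> bmf (\<lambda>t. cis (f t))"
  by (rule bmfI[of _ 1]) auto

lemma bmf_mult: "bmf p \<Longrightarrow> bmf q \<Longrightarrow> bmf (\<lambda>t. p t * q t)"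
proof -
  assume p: "bmf p" and q: "bmf q"
  then obtain C D where "\<And>t. cmod (p t) \<le> C" "\<And>t. cmod (q t) \<le> D" by (auto simp: bmf_def)
  then show ?thesis
    using p q by (intro bmfI[of _ "C * D"]) (auto simp: bmf_def norm_mult intro!: mult_mono intro: order_trans[OF norm_ge_zero])
qed

lemma bmf_cnj: "bmf q \<Longrightarrow> bmf (\<lambda>t. cnj (q t))"
  by (auto simp: bmf_def)

lemma integrable_bmf_mult:
  assumes q: "bmf q" and f: "integrable lborel f"
  shows "integrable lborel (\<lambda>x. q x * f x)"
proof -
  have [measurable]: "q \<in> borel_measurable borel" "f \<in> borel_measurable borel"
    using q f by (auto simp: bmf_def)
  obtain C where C: "\<And>t. cmod (q t) \<le> C" using q by (auto simp: bmf_def)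
  show ?thesis
  proof (rule Bochner_Integration.integrable_bound)
    show "integrable lborel (\<lambda>x. C * cmod (f x))" using f by simp
    show "AE x in lborel. norm (q x * f x) \<le> norm (C * cmod (f x))"
      unfolding real_norm_def norm_mult
      by (intro AE_I2 order_trans[OF _ abs_ge_self] mult_right_mono C) auto
  qed auto
qed

lemma sqint_mult:
  assumes q: "bmf q" and f: "sqint f"
  shows "sqint (\<lambda>t. q t * f t)"
proof -
  obtain C where C: "\<And>t. cmod (q t) \<le> C" using q by (auto simp: bmf_def)
  show ?thesis
    by (rule sqint_bound[OF f, of _ C]) (use q f C in \<open>auto simp: bmf_def sqint_def norm_mult intro!: AE_I2 mult_right_mono\<close>)
qed

lemma rep_mulop: "bmf q \<Longrightarrow> AE t in lborel. rep (mulop q x) t = q t * rep x t"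
  unfolding mulop_def by (rule rep_mk) (simp add: sqint_mult)

lemma l2_inner_mulop:
  assumes "bmf q"
  shows "l2_inner (mulop q x) y = (LINT t|lborel. q t * (rep x t * cnj (rep y t)))"
proof -
  have "l2_inner (mulop q x) y = (LINT t|lborel. (q t * rep x t) * cnj (rep y t))"
    using assms by (intro l2_inner_eqI rep_mulop) (auto simp: bmf_def)
  then show ?thesis by (simp add: mult.assoc)
qed

lemma norm_mulop_sq:
  assumes "bmf q"
  shows "(norm (mulop q x))\<^sup>2 = (LINT t|lborel. (cmod (q t * rep x t))\<^sup>2)"
  unfolding mulop_def using assms by (intro norm_mk sqint_mult) auto

lemma norm_mulop_le:
  assumes q: "q \<in> borel_measurable borel" and C: "\<And>t. cmod (q t) \<le> C"
  shows "norm (mulop q x) \<le> C * norm x"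
proof -
  have C0: "C \<ge> 0" using order_trans[OF norm_ge_zero C[of 0]] .
  have b: "bmf q" using bmfI[OF q C] .
  have "(norm (mulop q x))\<^sup>2 \<le> (LINT t|lborel. C\<^sup>2 * (cmod (rep x t))\<^sup>2)"
    unfolding norm_mulop_sq[OF b]
  proof (rule integral_mono)
    show "integrable lborel (\<lambda>t. (cmod (q t * rep x t))\<^sup>2)"
      using sqint_mult[OF b sqint_rep[of x]] by (simp add: sqint_def)
    show "(cmod (q t * rep x t))\<^sup>2 \<le> C\<^sup>2 * (cmod (rep x t))\<^sup>2" for t
      unfolding norm_mult power_mult_distrib by (intro mult_right_mono power_mono C) auto
  qed (simp add: l2_norm_integrable)
  also have "\<dots> = (C * norm x)\<^sup>2"
    by (simp add: power_mult_distrib l2_norm_sq_integral)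
  finally show ?thesis by (rule power2_le_imp_le) (use C0 in auto)
qed

lemma mulop_add:
  assumes q: "bmf q"
  shows "mulop q (x + y) = mulop q x + mulop q y"
  by (rule L2_eqI, use rep_mulop[OF q, of "x + y"] rep_mulop[OF q, of x] rep_mulop[OF q, of y] rep_plus[of x y]
      rep_plus[of "mulop q x" "mulop q y"] in \<open>eventually_elim, simp add: algebra_simps\<close>)

lemma mulop_scale:
  assumes q: "bmf q"
  shows "mulop q (l2_scale c x) = l2_scale c (mulop q x)"
  by (rule L2_eqI, use rep_mulop[OF q, of "l2_scale c x"] rep_mulop[OF q, of x] rep_l2_scale[of c x]
      rep_l2_scale[of c "mulop q x"] in \<open>eventually_elim, simp add: algebra_simps\<close>)

lemma bop_mulop:
  assumes "bmf q"
  shows "bop (mulop q)"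
proof -
  obtain C where C: "q \<in> borel_measurable borel" "\<And>t. cmod (q t) \<le> C" using assms by (auto simp: bmf_def)
  show ?thesis
    unfolding bop_def l2_fold using norm_mulop_le[OF C] mulop_add[OF assms] mulop_scale[OF assms] by auto
qed

lemma mulop_mulop:
  assumes "bmf p" "bmf q"
  shows "mulop p (mulop q x) = mulop (\<lambda>t. p t * q t) x"
  by (rule L2_eqI, use rep_mulop[OF assms(1), of "mulop q x"] rep_mulop[OF assms(2), of x]
      rep_mulop[OF bmf_mult[OF assms], of x] in \<open>eventually_elim, simp add: algebra_simps\<close>)

lemma mulop_one [simp]: "mulop (\<lambda>t. 1) x = x"
  by (simp add: mulop_def)

lemma mulop_adjoint:
  assumes "bmf q"
  shows "l2_inner (mulop q x) y = l2_inner x (mulop (\<lambda>t. cnj (q t)) y)"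
proof -
  have "l2_inner x (mulop (\<lambda>t. cnj (q t)) y) = cnj (LINT t|lborel. cnj (q t) * (rep y t * cnj (rep x t)))"
    by (subst l2_inner_commute) (simp add: l2_inner_mulop[OF bmf_cnj[OF assms]])
  also have "\<dots> = (LINT t|lborel. cnj (cnj (q t) * (rep y t * cnj (rep x t))))"
    by (rule Bochner_Integration.integral_cnj[symmetric])
  finally show ?thesis by (simp add: l2_inner_mulop[OF assms] mult_ac)
qed

text \<open>Strong convergence from bounded pointwise convergence of symbols: dominated convergence
  for |p_n - q|^2 |x|^2, with majorant (2 C)^2 |x|^2.\<close>

lemma mulop_tendsto:
  fixes p :: "nat \<Rightarrow> real \<Rightarrow> complex"
  assumes p: "\<And>n. p n \<in> borel_measurable borel" and q: "q \<in> borel_measurable borel"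
    and bound: "\<And>n t. cmod (p n t) \<le> C" and lim: "\<And>t. (\<lambda>n. p n t) \<longlonglongrightarrow> q t"
  shows "(\<lambda>n. mulop (p n) x) \<longlonglongrightarrow> mulop q x"
proof -
  have [measurable]: "q \<in> borel_measurable borel" "\<And>n. p n \<in> borel_measurable borel" by fact+
  have qC: "cmod (q t) \<le> C" for t
    by (rule LIMSEQ_le_const2[OF tendsto_norm[OF lim]]) (use bound in auto)
  have bp: "bmf (p n)" and bq: "bmf q" for n using bmfI[OF p bound] bmfI[OF q qC] by auto
  have bd: "bmf (\<lambda>t. p n t - q t)" for n
  proof (rule bmfI[of _ "C + C"])
    show "cmod (p n t - q t) \<le> C + C" for t
      by (intro order_trans[OF norm_triangle_ineq4] add_mono bound qC)
  qed auto
  have diff: "mulop (p n) x - mulop q x = mulop (\<lambda>t. p n t - q t) x" for n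
    by (rule L2_eqI, use rep_mulop[OF bp, of n x] rep_mulop[OF bq, of x] rep_mulop[OF bd, of n x]
      rep_minus[of "mulop (p n) x" "mulop q x"] in \<open>eventually_elim, simp add: left_diff_distrib\<close>)
  have "(\<lambda>n. LINT t|lborel. (cmod ((p n t - q t) * rep x t))\<^sup>2) \<longlonglongrightarrow> (LINT t|(lborel :: real measure). 0)"
  proof (rule integral_dominated_convergence)
    show "integrable lborel (\<lambda>t. (2 * C)\<^sup>2 * (cmod (rep x t))\<^sup>2)" by (simp add: l2_norm_integrable)
    show "AE t in lborel. norm ((cmod ((p n t - q t) * rep x t))\<^sup>2) \<le> (2 * C)\<^sup>2 * (cmod (rep x t))\<^sup>2" for n
    proof (rule AE_I2)
      fix t
      have "cmod (p n t - q t) \<le> 2 * C"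
        using norm_triangle_ineq4[of "p n t" "q t"] bound[of n t] qC[of t] by linarith
      then have "(cmod (p n t - q t))\<^sup>2 \<le> (2 * C)\<^sup>2" by (intro power_mono) auto
      then show "norm ((cmod ((p n t - q t) * rep x t))\<^sup>2) \<le> (2 * C)\<^sup>2 * (cmod (rep x t))\<^sup>2"
        unfolding norm_mult power_mult_distrib by (simp add: norm_mult power_mult_distrib mult_right_mono)
    qed
    show "AE t in lborel. (\<lambda>n. (cmod ((p n t - q t) * rep x t))\<^sup>2) \<longlonglongrightarrow> 0"
    proof (rule AE_I2)
      fix t
      have "(\<lambda>n. (cmod ((p n t - q t) * rep x t))\<^sup>2) \<longlonglongrightarrow> (cmod ((q t - q t) * rep x t))\<^sup>2"
        by (intro tendsto_intros lim)
      then show "(\<lambda>n. (cmod ((p n t - q t) * rep x t))\<^sup>2) \<longlonglongrightarrow> 0" by simp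
    qed
  qed auto
  then have "(\<lambda>n. (norm (mulop (p n) x - mulop q x))\<^sup>2) \<longlonglongrightarrow> 0"
    by (simp add: diff norm_mulop_sq[OF bd])
  then have "(\<lambda>n. norm (mulop (p n) x - mulop q x)) \<longlonglongrightarrow> 0"
    by simp
  then show ?thesis by (simp add: LIM_zero_iff tendsto_norm_zero_iff)
qed

text \<open>The factor makes this unitary for every nonzero \<open>a\<close>. Translations are a =
  1, the reflection is a = -1 with b = 0, and the dilations have b = 0.\<close>

definition affop :: "real \<Rightarrow> real \<Rightarrow> L2 \<Rightarrow> L2" where
  "affop a b x = mk (\<lambda>t. complex_of_real (sqrt \<bar>a\<bar>) * rep x (b + a * t))"

lemma sqint_affine:
  assumes "a \<noteq> 0" "sqint f"
  shows "sqint (\<lambda>t. f (b + a * t))"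
proof -
  have [measurable]: "f \<in> borel_measurable borel" using assms by (simp add: sqint_def)
  show ?thesis
    using assms lborel_integrable_real_affine[of "\<lambda>t. (cmod (f t))\<^sup>2" a b] unfolding sqint_def by simp
qed

text \<open>A representative is known only up to a null set, so substituting into it relies on
  affine maps preserving null sets.\<close>

lemma AE_affine:
  assumes "a \<noteq> 0" "AE t in lborel. rep x t = g t" and [measurable]: "g \<in> borel_measurable borel"
  shows "AE t in lborel. rep x (b + a * t) = g (b + a * t)"
  using AE_borel_affine[of a "\<lambda>t. rep x t = g t" b] assms by simp

lemma rep_affop: "a \<noteq> 0 \<Longrightarrow> AE t in lborel. rep (affop a b x) t = complex_of_real (sqrt \<bar>a\<bar>) * rep x (b + a * t)"
  unfolding affop_def by (rule rep_mk) (simp add: sqint_scale sqint_affine)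

lemma affop_inner:
  assumes a: "a \<noteq> 0"
  shows "l2_inner (affop a b x) (affop a b y) = l2_inner x y"
proof -
  have "l2_inner (affop a b x) (affop a b y)
      = (LINT t|lborel. (complex_of_real (sqrt \<bar>a\<bar>) * rep x (b + a * t)) * cnj (complex_of_real (sqrt \<bar>a\<bar>) * rep y (b + a * t)))"
    by (intro l2_inner_eqI rep_affop a) auto
  also have "\<dots> = (LINT t|lborel. \<bar>a\<bar> *\<^sub>R (rep x (b + a * t) * cnj (rep y (b + a * t))))"
  proof (rule Bochner_Integration.integral_cong[OF refl])
    have "(complex_of_real (sqrt \<bar>a\<bar>) * u) * cnj (complex_of_real (sqrt \<bar>a\<bar>) * v)
        = complex_of_real (sqrt \<bar>a\<bar> * sqrt \<bar>a\<bar>) * (u * cnj v)" for u v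
      by (simp only: complex_cnj_mult complex_cnj_complex_of_real of_real_mult mult_ac)
    then show "(complex_of_real (sqrt \<bar>a\<bar>) * rep x (b + a * t)) * cnj (complex_of_real (sqrt \<bar>a\<bar>) * rep y (b + a * t))
        = \<bar>a\<bar> *\<^sub>R (rep x (b + a * t) * cnj (rep y (b + a * t)))" for t
      unfolding scaleR_conv_of_real by (simp only: real_sqrt_mult_self abs_idempotent)
  qed
  also have "\<dots> = \<bar>a\<bar> *\<^sub>R (LINT t|lborel. rep x (b + a * t) * cnj (rep y (b + a * t)))" by simp
  also have "\<dots> = l2_inner x y"
    unfolding l2_inner_def by (rule lborel_integral_real_affine[OF a, symmetric])
  finally show ?thesis .
qed

lemma affop_norm: "a \<noteq> 0 \<Longrightarrow> norm (affop a b x) = norm x"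
  using affop_inner[of a b x x] by (simp add: l2_inner_norm flip: of_real_power)

lemma affop_add:
  assumes a: "a \<noteq> 0"
  shows "affop a b (x + y) = affop a b x + affop a b y"
proof -
  have "AE t in lborel. rep (x + y) (b + a * t) = rep x (b + a * t) + rep y (b + a * t)"
    by (rule AE_affine[OF a rep_plus]) auto
  then have "AE t in lborel. rep (affop a b (x + y)) t = rep (affop a b x + affop a b y) t"
    using rep_affop[OF a, of b "x + y"] rep_affop[OF a, of b x] rep_affop[OF a, of b y]
      rep_plus[of "affop a b x" "affop a b y"] by eventually_elim (simp add: algebra_simps)
  then show ?thesis by (rule L2_eqI)
qed

lemma affop_scale:
  assumes a: "a \<noteq> 0"
  shows "affop a b (l2_scale c x) = l2_scale c (affop a b x)"
proof -
  have "AE t in lborel. rep (l2_scale c x) (b + a * t) = c * rep x (b + a * t)"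
    by (rule AE_affine[OF a rep_l2_scale]) auto
  then have "AE t in lborel. rep (affop a b (l2_scale c x)) t = rep (l2_scale c (affop a b x)) t"
    using rep_affop[OF a, of b "l2_scale c x"] rep_affop[OF a, of b x]
      rep_l2_scale[of c "affop a b x"] by eventually_elim (simp add: algebra_simps)
  then show ?thesis by (rule L2_eqI)
qed

lemma bop_affop: "a \<noteq> 0 \<Longrightarrow> bop (affop a b)"
  unfolding bop_def l2_fold by (auto simp: affop_add affop_scale affop_norm intro!: exI[of _ 1])

lemma affop_affop:
  assumes a: "a \<noteq> 0" and c: "c \<noteq> 0"
  shows "affop a b (affop c d x) = affop (a * c) (d + c * b) x"
proof -
  have ac: "a * c \<noteq> 0" using a c by simp
  have "AE t in lborel. rep (affop c d x) (b + a * t) = complex_of_real (sqrt \<bar>c\<bar>) * rep x (d + c * (b + a * t))"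
    by (rule AE_affine[OF a rep_affop[OF c]]) auto
  then have "AE t in lborel. rep (affop a b (affop c d x)) t = rep (affop (a * c) (d + c * b) x) t"
    using rep_affop[OF a, of b "affop c d x"] rep_affop[OF ac, of "d + c * b" x]
    by eventually_elim (simp add: algebra_simps abs_mult real_sqrt_mult)
  then show ?thesis by (rule L2_eqI)
qed

lemma affop_id [simp]: "affop 1 0 x = x"
  by (simp add: affop_def)

lemma bij_affop:
  assumes "a \<noteq> 0"
  shows "bij (affop a b)"
proof (rule o_bij)
  show "affop (1/a) (- b / a) \<circ> affop a b = id" "affop a b \<circ> affop (1/a) (- b / a) = id"
    using assms by (auto simp: fun_eq_iff affop_affop)
qed

lemma bmf_affine: "bmf q \<Longrightarrow> bmf (\<lambda>t. q (b + a * t))"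
  by (auto simp: bmf_def)

lemma affop_mulop:
  assumes a: "a \<noteq> 0" and q: "bmf q"
  shows "affop a b (mulop q x) = mulop (\<lambda>t. q (b + a * t)) (affop a b x)"
proof -
  have "AE t in lborel. rep (mulop q x) (b + a * t) = q (b + a * t) * rep x (b + a * t)"
    by (rule AE_affine[OF a rep_mulop[OF q]]) (use q in \<open>auto simp: bmf_def\<close>)
  then have "AE t in lborel. rep (affop a b (mulop q x)) t = rep (mulop (\<lambda>t. q (b + a * t)) (affop a b x)) t"
    using rep_affop[OF a, of b "mulop q x"] rep_mulop[OF bmf_affine[OF q], of b a "affop a b x"]
      rep_affop[OF a, of b x]
    by eventually_elim (simp add: algebra_simps)
  then show ?thesis by (rule L2_eqI)
qed

lemma affop_ind:
  assumes "\<bar>a\<bar> = 1" "\<And>t. b + a * t \<in> {c..d} \<longleftrightarrow> t \<in> {e..f}"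
  shows "affop a b (ind c d) = ind e f"
proof -
  have a: "a \<noteq> 0" using assms by auto
  have "AE t in lborel. rep (ind c d) (b + a * t) = complex_of_real (indicator {c..d} (b + a * t))"
    by (rule AE_affine[OF a rep_ind]) auto
  then have "AE t in lborel. rep (affop a b (ind c d)) t = rep (ind e f) t"
    using rep_affop[OF a, of b "ind c d"] rep_ind[of e f]
    by eventually_elim (use assms in \<open>simp add: indicator_def\<close>)
  then show ?thesis by (rule L2_eqI)
qed

lemma affop_ind_neg: "affop (-1) 0 (ind a b) = ind (-b) (-a)"
  by (rule affop_ind) auto

lemma M_op_eq: "M_op lam = mulop (\<lambda>t. cis (lam * t))"
  by (rule ext) (simp add: M_op_def mulop_def cis_conv_exp)

lemma D_op_eq: "D_op mu = affop 1 (- mu)"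
  by (rule ext) (simp add: D_op_def affop_def)

lemma rep_D_op: "AE t in lborel. rep (D_op mu x) t = rep x (t - mu)"
  using rep_affop[of 1 "-mu" x] by (simp add: D_op_eq)

lemma rep_M_op: "AE t in lborel. rep (M_op lam x) t = cis (lam * t) * rep x t"
  unfolding M_op_eq by (rule rep_mulop) (auto intro: bmf_cis)

lemma bop_M_op: "bop (M_op lam)"
  unfolding M_op_eq by (rule bop_mulop) (auto intro: bmf_cis)

lemma bop_D_op: "bop (D_op mu)"
  unfolding D_op_eq by (rule bop_affop) simp

lemma D_op_ind: "D_op mu (ind a b) = ind (a + mu) (b + mu)"
  unfolding D_op_eq by (rule affop_ind) auto

section \<open>The Fourier transform on step functions\<close>

text \<open>The arctangent bounds the integral over the right half-line, and reflection gives the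
  left one.\<close>

lemma integrable_inverse_one_plus_sq: "integrable lborel (\<lambda>x::real. inverse (1 + x\<^sup>2))"
proof -
  define g where "g x = inverse (1 + x\<^sup>2) * indicator {0..} x" for x :: real
  have [measurable]: "g \<in> borel_measurable borel" unfolding g_def by measurable
  have "(\<integral>\<^sup>+x. ennreal (inverse (1 + x\<^sup>2)) * indicator {0..} x \<partial>lborel) = ennreal (pi / 2 - arctan 0)"
  proof (rule nn_integral_FTC_atLeast)
    show "(arctan has_real_derivative inverse (1 + x\<^sup>2)) (at x)" for x by (rule DERIV_arctan)
  qed (auto intro: tendsto_arctan_at_top)
  moreover have "ennreal (inverse (1 + x\<^sup>2)) * indicator {0..} x = ennreal (norm (g x))" for x
    by (auto simp: g_def indicator_def)
  ultimately have g: "integrable lborel g" by (intro integrableI_bounded) auto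
  have "integrable lborel (\<lambda>x. g x + g (0 + (-1) * x))"
    using lborel_integrable_real_affine[OF g, of "-1" 0] g by (intro Bochner_Integration.integrable_add) auto
  then show ?thesis
    by (rule Bochner_Integration.integrable_bound) (auto simp: g_def indicator_def intro!: AE_I2)
qed

lemma one_minus_cos_le: "1 - cos x \<le> x\<^sup>2 / 2" for x :: real
proof -
  have "1 - cos x = 2 * (sin (x / 2))\<^sup>2" using cos_double_sin[of "x / 2"] by simp
  also have "\<dots> \<le> 2 * (x / 2)\<^sup>2"
    using abs_le_square_iff[THEN iffD1, OF abs_sin_x_le_abs_x[of "x / 2"]] by (intro mult_left_mono) simp_all
  finally show ?thesis by (simp add: power2_eq_square)
qed

text \<open>Up to scaling the Fejer kernel. At 0 the division convention gives 0, which changes a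
  single point.\<close>

definition kf :: "real \<Rightarrow> real" where "kf x = (1 - cos x) / x\<^sup>2"

lemma kf_measurable [measurable]: "kf \<in> borel_measurable borel"
  unfolding kf_def[abs_def] by measurable

lemma kf_nonneg: "0 \<le> kf x"
  by (simp add: kf_def)

lemma integrable_kf: "integrable lborel kf"
proof (rule Bochner_Integration.integrable_bound)
  show "integrable lborel (\<lambda>x::real. 4 * inverse (1 + x\<^sup>2))"
    using integrable_inverse_one_plus_sq by simp
  \<comment> \<open>Near 0 one has 1 - cos x <= x^2 / 2, far away 1 - cos x <= 2; together (1 - cos
    x)(1 + x^2) <= (5/2) x^2, and 4 leaves room.\<close>
  have "kf x \<le> 4 * inverse (1 + x\<^sup>2)" for x
  proof (cases "x = 0")
    case False
    have p: "1 + x\<^sup>2 > 0" by (simp add: add_pos_nonneg)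
    have "(1 - cos x) * x\<^sup>2 \<le> 2 * x\<^sup>2" by (intro mult_right_mono) (use cos_ge_minus_one[of x] in auto)
    moreover have "(1 - cos x) * (1 + x\<^sup>2) = (1 - cos x) + (1 - cos x) * x\<^sup>2"
      by (simp add: distrib_left)
    ultimately have "(1 - cos x) * (1 + x\<^sup>2) \<le> 4 * x\<^sup>2"
      using one_minus_cos_le[of x] zero_le_power2[of x] by linarith
    then show ?thesis using False p by (simp add: kf_def field_simps)
  qed (simp add: kf_def)
  then show "AE x in lborel. norm (kf x) \<le> norm (4 * inverse (1 + x\<^sup>2))"
    by (intro AE_I2) (use kf_nonneg in \<open>auto intro: order_trans[OF _ abs_ge_self]\<close>)
qed auto

text \<open>The value of this integral is irrelevant: the Plancherel formula for intervals only needs that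
  \<open>(1 - cos (a x)) / x\<^sup>2\<close> has integral proportional to \<open>\<bar>a\<bar>\<close>, which follows by scaling.\<close>
definition cI :: real where "cI = (LINT x|lborel. kf x)"

lemma cI_pos: "cI > 0"
proof -
  \<comment> \<open>On [1, 2] the cosine is at most cos 1 and x^2 is at most 4, which bounds
    \<open>kf\<close> below by this constant.\<close>
  let ?c = "(1 - cos 1) / 4 :: real"
  have c1: "cos 1 < (1::real)" using cos_monotone_0_pi[of 0 1] pi_gt3 by simp
  have int: "integrable lborel (\<lambda>x::real. ?c * indicator {1..2} x :: real)"
    by (intro integrable_mult_right integrable_real_indicator) (auto simp: emeasure_lborel_Icc_eq)
  have "?c * indicator {1..2} x \<le> kf x" for x :: real
  proof (cases "x \<in> {1..2}")
    case True
    then have "cos x \<le> cos 1" using cos_monotone_0_pi_le[of 1 x] pi_gt3 by auto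
    moreover have "x\<^sup>2 \<le> 2\<^sup>2" using True by (intro power_mono) auto
    ultimately have "(1 - cos 1) / 4 \<le> (1 - cos x) / x\<^sup>2"
      using True c1 by (intro frac_le) auto
    then show ?thesis using True by (simp add: kf_def)
  qed (simp add: kf_nonneg)
  then have "(LINT x|lborel. ?c * indicator {1..2::real} x) \<le> cI"
    unfolding cI_def by (intro integral_mono int integrable_kf)
  moreover have "(LINT x|lborel. ?c * indicator {1..2::real} x) = ?c" by simp
  ultimately show ?thesis using c1 by simp
qed

lemma kf_scale: "(1 - cos (a * x)) / x\<^sup>2 = a\<^sup>2 * kf (0 + a * x)" if "a \<noteq> 0" for a x :: real
  using that by (simp add: kf_def power_mult_distrib)

lemma integral_one_minus_cos:
  fixes a :: real
  shows "integrable lborel (\<lambda>x. (1 - cos (a * x)) / x\<^sup>2)" "(LINT x|lborel. (1 - cos (a * x)) / x\<^sup>2) = \<bar>a\<bar> * cI"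
proof -
  have "integrable lborel (\<lambda>x. (1 - cos (a * x)) / x\<^sup>2) \<and> (LINT x|lborel. (1 - cos (a * x)) / x\<^sup>2) = \<bar>a\<bar> * cI"
  proof (cases "a = 0")
    case False
    have "(LINT x|lborel. a\<^sup>2 * kf (0 + a * x)) = \<bar>a\<bar> * (\<bar>a\<bar> *\<^sub>R (LINT x|lborel. kf (0 + a * x)))"
      by (simp add: power2_eq_square)
    also have "\<dots> = \<bar>a\<bar> * cI"
      using lborel_integral_real_affine[OF False, of kf 0] by (simp add: cI_def)
    finally have "(LINT x|lborel. a\<^sup>2 * kf (0 + a * x)) = \<bar>a\<bar> * cI" .
    moreover have "integrable lborel (\<lambda>x. a\<^sup>2 * kf (0 + a * x))"
      using lborel_integrable_real_affine[OF integrable_kf False, of 0] by simp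
    ultimately show ?thesis unfolding kf_scale[OF False] by simp
  qed simp
  then show "integrable lborel (\<lambda>x. (1 - cos (a * x)) / x\<^sup>2)" "(LINT x|lborel. (1 - cos (a * x)) / x\<^sup>2) = \<bar>a\<bar> * cI"
    by auto
qed

section \<open>The integral transform of integrable functions and of intervals\<close>

definition ftr :: "(real \<Rightarrow> complex) \<Rightarrow> real \<Rightarrow> complex" where
  "ftr f \<xi> = (LINT x|lborel. cis (- (\<xi> * x)) * f x)"

lemma integrable_cis_mult:
  fixes f :: "real \<Rightarrow> complex"
  assumes "integrable lborel f" "g \<in> borel_measurable borel"
  shows "integrable lborel (\<lambda>x. cis (g x) * f x)"
  by (rule integrable_bmf_mult[OF bmf_cis[OF assms(2)] assms(1)])

lemma ftr_measurable [measurable]: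
  assumes [measurable]: "f \<in> borel_measurable borel"
  shows "ftr f \<in> borel_measurable borel"
  unfolding ftr_def[abs_def] by measurable

lemma ftr_bound:
  assumes "integrable lborel f"
  shows "cmod (ftr f \<xi>) \<le> (LINT x|lborel. cmod (f x))"
  unfolding ftr_def
  by (rule order_trans[OF integral_norm_bound]) (simp add: norm_mult)

lemma ftr_cong_AE:
  assumes "AE x in lborel. f x = g x" and [measurable]: "f \<in> borel_measurable borel" "g \<in> borel_measurable borel"
  shows "ftr f = ftr g"
  unfolding ftr_def[abs_def]
  by (intro ext integral_cong_AE) (use assms(1) in \<open>auto elim!: eventually_mono\<close>)

lemma ftr_add:
  assumes "integrable lborel f" "integrable lborel g"
  shows "ftr (\<lambda>x. f x + g x) \<xi> = ftr f \<xi> + ftr g \<xi>"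
  unfolding ftr_def using assms by (simp add: distrib_left integrable_cis_mult)

lemma ftr_scale: "ftr (\<lambda>x. c * f x) \<xi> = c * ftr f \<xi>"
  unfolding ftr_def by (subst integral_mult_right_zero[symmetric]) (simp add: mult_ac)

text \<open>The multiplication formula: the exponential is symmetric in both variables, so Fubini
  moves the transform to the other factor. It later yields the adjoint of \<open>Fo\<close> and the
  stability of \<open>annih\<close> under averages.\<close>

lemma integral_mult_ftr:
  assumes f: "integrable lborel f" and g: "integrable lborel g"
  shows "(LINT \<xi>|lborel. g \<xi> * ftr f \<xi>) = (LINT x|lborel. f x * ftr g x)"
proof -
  have [measurable]: "f \<in> borel_measurable borel" "g \<in> borel_measurable borel" using f g by auto
  let ?k = "\<lambda>\<xi> x. g \<xi> * (cis (- (\<xi> * x)) * f x)"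
  have int: "integrable (lborel \<Otimes>\<^sub>M lborel) (case_prod ?k)"
    by (rule integrable_pair_bound(1)[where f = "\<lambda>x. cmod (g x)" and g = "\<lambda>_ x. cmod (f x)"])
      (use f g in \<open>auto simp: norm_mult\<close>)
  have "(LINT \<xi>|lborel. g \<xi> * ftr f \<xi>) = (LINT \<xi>|lborel. LINT x|lborel. ?k \<xi> x)"
    by (simp add: ftr_def)
  also have "\<dots> = (LINT x|lborel. LINT \<xi>|lborel. ?k \<xi> x)"
    by (rule lborel_pair.Fubini_integral[OF int, symmetric])
  also have "\<dots> = (LINT x|lborel. f x * ftr g x)"
  proof (rule Bochner_Integration.integral_cong[OF refl])
    fix x
    have "(LINT \<xi>|lborel. ?k \<xi> x) = (LINT \<xi>|lborel. f x * (cis (- (x * \<xi>)) * g \<xi>))"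
      by (simp add: mult_ac)
    then show "(LINT \<xi>|lborel. ?k \<xi> x) = f x * ftr g x" by (simp add: ftr_def)
  qed
  finally show ?thesis .
qed

abbreviation indf :: "real \<Rightarrow> real \<Rightarrow> real \<Rightarrow> complex" where
  "indf a b \<equiv> (\<lambda>t. complex_of_real (indicator {a..b} t))"

lemma integrable_indf: "integrable lborel (indf a b)"
  by (intro integrable_of_real integrable_real_indicator) (auto simp: emeasure_lborel_Icc_eq)

lemma ftr_rep_ind: "ftr (rep (ind a b)) = ftr (indf a b)"
  by (rule ftr_cong_AE[OF rep_ind]) auto

lemma ftr_indf_neg: "ftr (indf (-b) (-a)) t = cnj (ftr (indf a b) t)"
proof -
  have "ftr (indf (-b) (-a)) t = (LINT x|lborel. cis (- (t * (0 + (-1) * x))) * indf (-b) (-a) (0 + (-1) * x))"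
    unfolding ftr_def by (subst lborel_integral_real_affine[of "-1" _ 0]) simp_all
  also have "\<dots> = (LINT x|lborel. cnj (cis (- (t * x)) * indf a b x))"
    by (intro Bochner_Integration.integral_cong) (auto simp: cis_cnj indicator_def)
  also have "\<dots> = cnj (ftr (indf a b) t)"
    unfolding ftr_def by (rule Bochner_Integration.integral_cnj)
  finally show ?thesis .
qed

lemma ftr_indf_shift: "ftr (indf (a + m) (b + m)) t = cis (- (m * t)) * ftr (indf a b) t"
proof -
  have "ftr (indf (a + m) (b + m)) t = (LINT x|lborel. cis (- (t * (m + 1 * x))) * indf (a + m) (b + m) (m + 1 * x))"
    unfolding ftr_def by (subst lborel_integral_real_affine[of 1 _ m]) simp_all
  also have "\<dots> = (LINT x|lborel. cis (- (m * t)) * (cis (- (t * x)) * indf a b x))"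
    by (intro Bochner_Integration.integral_cong)
      (auto simp: cis_mult indicator_def algebra_simps)
  finally show ?thesis by (simp add: ftr_def)
qed

text \<open>The transform of the indicator of \<open>{a..b}\<close>, except that division by zero gives \<open>eab a b 0 = 0\<close>.\<close>
definition eab :: "real \<Rightarrow> real \<Rightarrow> real \<Rightarrow> complex" where
  "eab a b \<xi> = \<i> / \<xi> * (cis (- (\<xi> * b)) - cis (- (\<xi> * a)))"

lemma eab_measurable [measurable]: "eab a b \<in> borel_measurable borel"
  unfolding eab_def[abs_def] by measurable

lemma ftr_indf:
  assumes "a \<le> b" "\<xi> \<noteq> 0"
  shows "ftr (indf a b) \<xi> = eab a b \<xi>"
proof -
  let ?F = "\<lambda>x. \<i> / \<xi> * cis (- (\<xi> * x))"
  have "(LINT x|lborel. indicator {a..b} x *\<^sub>R cis (- (\<xi> * x))) = ?F b - ?F a"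
  proof (rule integral_FTC_Icc[OF assms(1)])
    fix x
    have "((\<lambda>x. cis (- (\<xi> * x))) has_derivative (\<lambda>t. (- (\<xi> * t)) *\<^sub>R (\<i> * cis (- (\<xi> * x))))) (at x within {a..b})"
      by (rule has_derivative_cis) (auto intro!: derivative_eq_intros)
    from has_derivative_mult_right[OF this, of "\<i> / \<xi>"]
    show "(?F has_vector_derivative cis (- (\<xi> * x))) (at x within {a..b})"
      unfolding has_vector_derivative_def
      by (rule has_derivative_eq_rhs) (use assms(2) in \<open>auto simp: fun_eq_iff scaleR_conv_of_real field_simps\<close>)
  qed (auto intro!: continuous_intros)
  then show ?thesis
    unfolding ftr_def eab_def by (simp add: scaleR_conv_of_real mult.commute right_diff_distrib)
qed

lemma AE_nonzero: "AE \<xi> in lborel. \<xi> \<noteq> (0::real)"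
  by (rule AE_lborel_singleton)

lemma eab_prod:
  "eab a b \<xi> * cnj (eab c d \<xi>) =
    (cis (\<xi> * (d - b)) - cis (\<xi> * (c - b)) - cis (\<xi> * (d - a)) + cis (\<xi> * (c - a))) / complex_of_real (\<xi>\<^sup>2)"
proof -
  have "eab a b \<xi> * cnj (eab c d \<xi>)
      = (cis (- (\<xi> * b)) - cis (- (\<xi> * a))) * (cis (\<xi> * d) - cis (\<xi> * c)) / complex_of_real (\<xi>\<^sup>2)"
  proof -
    let ?A = "cis (- (\<xi> * b)) - cis (- (\<xi> * a))" and ?B = "cis (\<xi> * d) - cis (\<xi> * c)"
    have "cnj (eab c d \<xi>) = cnj (\<i> / \<xi>) * ?B" unfolding eab_def by (simp add: cis_cnj)
    then have "eab a b \<xi> * cnj (eab c d \<xi>) = (\<i> / \<xi> * cnj (\<i> / \<xi>)) * (?A * ?B)"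
      unfolding eab_def by (simp only: mult_ac)
    also have "\<i> / \<xi> * cnj (\<i> / \<xi>) = 1 / complex_of_real (\<xi>\<^sup>2)"
      by (simp add: power2_eq_square)
    finally show ?thesis by simp
  qed
  also have "(cis (- (\<xi> * b)) - cis (- (\<xi> * a))) * (cis (\<xi> * d) - cis (\<xi> * c))
      = cis (\<xi> * (d - b)) - cis (\<xi> * (c - b)) - cis (\<xi> * (d - a)) + cis (\<xi> * (c - a))"
    by (simp add: left_diff_distrib right_diff_distrib cis_mult)
  finally show ?thesis .
qed

lemma sqint_eab: "sqint (eab a b)"
  unfolding sqint_def
proof
  have "(cmod (eab a b \<xi>))\<^sup>2 = 2 * ((1 - cos ((b - a) * \<xi>)) / \<xi>\<^sup>2)" for \<xi>
  proof -
    have "(cmod (eab a b \<xi>))\<^sup>2 = Re (eab a b \<xi> * cnj (eab a b \<xi>))"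
      unfolding complex_mult_cnj_cmod by simp
    also have "\<dots> = (2 - cos (\<xi> * (a - b)) - cos (\<xi> * (b - a))) / \<xi>\<^sup>2"
      unfolding eab_prod Re_divide_of_real by simp
    also have "cos (\<xi> * (a - b)) = cos (\<xi> * (b - a))"
      by (metis cos_minus minus_diff_eq mult_minus_right)
    finally show ?thesis by (simp add: mult.commute)
  qed
  then show "integrable lborel (\<lambda>x. (cmod (eab a b x))\<^sup>2)"
    using integrable_mult_right[OF integral_one_minus_cos(1)[of "b - a"], of 2] by (simp only:)
qed simp

text \<open>The four exponentials of \<open>eab_prod\<close> have coefficients summing to zero, so
  in the real part every cosine may be replaced by 1 - cos with the opposite sign; each summand is
  then integrable by itself. The imaginary part vanishes because reflection conjugates the
  integrand.\<close>

lemma eab_inner: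
  "(LINT \<xi>|lborel. eab a b \<xi> * cnj (eab c d \<xi>)) = complex_of_real (cI * (\<bar>c - b\<bar> + \<bar>d - a\<bar> - \<bar>d - b\<bar> - \<bar>c - a\<bar>))" (is "_ = complex_of_real ?A")
proof (rule complex_eqI)
  let ?P = "\<lambda>\<xi>. eab a b \<xi> * cnj (eab c d \<xi>)"
  let ?k = "\<lambda>t x. (1 - cos (t * x)) / x\<^sup>2 :: real"
  have int: "integrable lborel ?P" by (intro sqint_integrable_mult sqint_cnj sqint_eab)
  have "Re (?P \<xi>) = ?k (c - b) \<xi> + ?k (d - a) \<xi> - ?k (d - b) \<xi> - ?k (c - a) \<xi>" for \<xi>
    unfolding eab_prod Re_divide_of_real by (simp add: mult.commute diff_divide_distrib add_divide_distrib)
  then have "Re (LINT \<xi>|lborel. ?P \<xi>) = (LINT \<xi>|lborel. ?k (c - b) \<xi> + ?k (d - a) \<xi> - ?k (d - b) \<xi> - ?k (c - a) \<xi>)"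
    using integral_Re[OF int] by simp
  also have "\<dots> = \<bar>c - b\<bar> * cI + \<bar>d - a\<bar> * cI - \<bar>d - b\<bar> * cI - \<bar>c - a\<bar> * cI"
    using integral_one_minus_cos
    by (simp add: Bochner_Integration.integral_add Bochner_Integration.integral_diff)
  finally show "Re (LINT \<xi>|lborel. ?P \<xi>) = Re (complex_of_real (?A))"
    by (simp add: algebra_simps)
  have "(LINT \<xi>|lborel. ?P \<xi>) = (LINT \<xi>|lborel. ?P (0 + (-1) * \<xi>))"
    by (subst lborel_integral_real_affine[of "-1" _ 0]) simp_all
  also have "\<dots> = (LINT \<xi>|lborel. cnj (?P \<xi>))"
    by (intro Bochner_Integration.integral_cong) (simp_all add: eab_def cis_cnj)
  also have "\<dots> = cnj (LINT \<xi>|lborel. ?P \<xi>)" by (rule Bochner_Integration.integral_cnj)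
  finally have "Im (LINT \<xi>|lborel. ?P \<xi>) = Im (cnj (LINT \<xi>|lborel. ?P \<xi>))" by (rule arg_cong)
  then show "Im (LINT \<xi>|lborel. ?P \<xi>) = Im (complex_of_real (?A))"
    by simp
qed

text \<open>Writing the overlap length through absolute values makes it the right-hand side of
  \<open>eab_inner\<close> divided by \<open>2 * cI\<close>; this is Plancherel's formula for
  intervals.\<close>

lemma l2_inner_ind_ind:
  assumes "a \<le> b" "c \<le> d"
  shows "l2_inner (ind a b) (ind c d) = complex_of_real ((\<bar>c - b\<bar> + \<bar>d - a\<bar> - \<bar>d - b\<bar> - \<bar>c - a\<bar>) / 2)"
proof -
  have "l2_inner (ind a b) (ind c d) = (LINT t|lborel. indf a b t * cnj (indf c d t))"
    unfolding ind_def by (rule l2_inner_mk[OF sqint_ind sqint_ind])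
  also have "\<dots> = (LINT t|lborel. complex_of_real (indicator {max a c..min b d} t))"
    by (intro Bochner_Integration.integral_cong) (auto simp: indicator_def)
  also have "\<dots> = complex_of_real (measure lborel {max a c..min b d})"
    by (subst integral_complex_of_real) simp
  also have "measure lborel {max a c..min b d} = (\<bar>c - b\<bar> + \<bar>d - a\<bar> - \<bar>d - b\<bar> - \<bar>c - a\<bar>) / 2"
    using assms by (auto simp: measure_def emeasure_lborel_Icc_eq max_def min_def abs_if)
  finally show ?thesis .
qed

section \<open>The Fourier transform as a unitary\<close>

lemma ind_empty: "b < a \<Longrightarrow> ind a b = 0"
  unfolding ind_def by (rule mk_eqI, use rep_zero in \<open>eventually_elim, simp\<close>)

text \<open>Normalises Plancherel: its square times \<open>2 * cI\<close> is 1. Classically cI = pi,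
  so this is the factor 1 / sqrt (2 pi).\<close>

definition foc :: real where "foc = 1 / sqrt (2 * cI)"

lemma foc_sq: "foc * foc * (2 * cI) = 1"
  using cI_pos by (simp add: foc_def)

definition F0 :: "L2 \<Rightarrow> L2" where
  "F0 x = mk (\<lambda>\<xi>. complex_of_real foc * ftr (rep x) \<xi>)"

text \<open>Vectors on which the integral formula is literally valid. The set contains
  \<open>V0\<close> and is closed under sums and scalars, so \<open>F0\<close> is linear there
  before anything is known about isometry.\<close>

definition P0 :: "L2 set" where
  "P0 = {x. integrable lborel (rep x) \<and> sqint (ftr (rep x))}"

definition V0 :: "L2 set" where
  "V0 = span {l2_scale c (ind a b) | c a b. a \<le> b}"

lemma rep_F0: "x \<in> P0 \<Longrightarrow> AE \<xi> in lborel. rep (F0 x) \<xi> = complex_of_real foc * ftr (rep x) \<xi>"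
  unfolding F0_def P0_def by (rule rep_mk) (auto intro: sqint_scale)

lemma AE_ftr_rep_ind: "a \<le> b \<Longrightarrow> AE \<xi> in lborel. ftr (rep (ind a b)) \<xi> = eab a b \<xi>"
  unfolding ftr_rep_ind using AE_nonzero by eventually_elim (simp add: ftr_indf)

lemma integrable_rep_ind: "integrable lborel (rep (ind a b))"
proof -
  have "integrable lborel (rep (ind a b)) \<longleftrightarrow> integrable lborel (indf a b)"
    by (intro integrable_cong_AE rep_ind) auto
  then show ?thesis using integrable_indf by simp
qed

lemma ind_P0: "a \<le> b \<Longrightarrow> ind a b \<in> P0"
  unfolding P0_def using AE_ftr_rep_ind[of a b]
  by (auto intro!: integrable_rep_ind sqint_bound[OF sqint_eab[of a b], of _ 1] elim!: eventually_mono)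

lemma add_P0:
  assumes "x \<in> P0" "y \<in> P0"
  shows "ftr (rep (x + y)) \<xi> = ftr (rep x) \<xi> + ftr (rep y) \<xi>" "x + y \<in> P0"
proof -
  have "ftr (rep (x + y)) = ftr (\<lambda>t. rep x t + rep y t)"
    by (rule ftr_cong_AE[OF rep_plus]) auto
  then have f: "ftr (rep (x + y)) = (\<lambda>\<xi>. ftr (rep x) \<xi> + ftr (rep y) \<xi>)"
    using assms by (auto simp: P0_def ftr_add)
  then show "ftr (rep (x + y)) \<xi> = ftr (rep x) \<xi> + ftr (rep y) \<xi>" by simp
  have "integrable lborel (rep (x + y)) \<longleftrightarrow> integrable lborel (\<lambda>t. rep x t + rep y t)"
    by (intro integrable_cong_AE rep_plus) auto
  then show "x + y \<in> P0" using assms by (simp add: P0_def f sqint_add)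
qed

lemma scale_P0:
  assumes "x \<in> P0"
  shows "ftr (rep (l2_scale c x)) \<xi> = c * ftr (rep x) \<xi>" "l2_scale c x \<in> P0"
proof -
  have "ftr (rep (l2_scale c x)) = ftr (\<lambda>t. c * rep x t)"
    by (rule ftr_cong_AE[OF rep_l2_scale]) auto
  then have f: "ftr (rep (l2_scale c x)) = (\<lambda>\<xi>. c * ftr (rep x) \<xi>)" by (auto simp: ftr_scale)
  then show "ftr (rep (l2_scale c x)) \<xi> = c * ftr (rep x) \<xi>" by simp
  have "integrable lborel (rep (l2_scale c x)) \<longleftrightarrow> integrable lborel (\<lambda>t. c * rep x t)"
    by (intro integrable_cong_AE rep_l2_scale) auto
  then show "l2_scale c x \<in> P0" using assms by (simp add: P0_def f sqint_scale)
qed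

lemma l2_scale_0 [simp]: "l2_scale 0 x = 0"
  using norm_l2_scale[of 0 x] by simp

lemma zero_P0: "0 \<in> P0"
  using scale_P0(2)[OF ind_P0[of 0 0], of 0] by simp

lemma F0_add:
  assumes "x \<in> P0" "y \<in> P0"
  shows "F0 (x + y) = F0 x + F0 y"
  by (rule L2_eqI, use rep_F0[OF add_P0(2)[OF assms]] rep_F0[OF assms(1)] rep_F0[OF assms(2)] rep_plus[of "F0 x" "F0 y"]
      in \<open>eventually_elim, simp add: add_P0(1)[OF assms] distrib_left\<close>)

lemma F0_scale:
  assumes "x \<in> P0"
  shows "F0 (l2_scale c x) = l2_scale c (F0 x)"
  by (rule L2_eqI, use rep_F0[OF scale_P0(2)[OF assms, of c]] rep_F0[OF assms(1)] rep_l2_scale[of c "F0 x"]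
      in \<open>eventually_elim, simp add: scale_P0(1)[OF assms]\<close>)

lemma subspaceI_L2:
  assumes "0 \<in> S" "\<And>x y. x \<in> S \<Longrightarrow> y \<in> S \<Longrightarrow> x + y \<in> S" "\<And>c x. x \<in> S \<Longrightarrow> l2_scale c x \<in> S"
  shows "subspace S"
  using assms by (auto simp: subspace_def scaleR_L2_def)

lemma V0_subset:
  assumes "subspace S" "\<And>c a b. a \<le> b \<Longrightarrow> l2_scale c (ind a b) \<in> S"
  shows "V0 \<subseteq> S"
  unfolding V0_def by (rule span_minimal) (use assms in auto)

lemma V0_P0: "V0 \<subseteq> P0"
  by (rule V0_subset) (auto intro!: subspaceI_L2 zero_P0 add_P0 scale_P0 ind_P0)

lemma subspace_V0: "subspace V0"
  by (simp add: V0_def subspace_span)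

lemma V0_gen: "a \<le> b \<Longrightarrow> l2_scale c (ind a b) \<in> V0"
  unfolding V0_def by (rule span_base) auto

lemma V0_scale:
  assumes "x \<in> V0"
  shows "l2_scale c x \<in> V0"
proof -
  have "V0 \<subseteq> l2_scale c -` V0"
  proof (rule V0_subset)
    show "subspace (l2_scale c -` V0)"
      by (intro linear_subspace_vimage subspace_V0 bounded_linear.linear bounded_linear_l2_scale)
  qed (simp add: l2_scale_scale V0_gen)
  then show ?thesis using assms by auto
qed

lemma F0_inner_ind:
  assumes "a \<le> b" "c \<le> d"
  shows "l2_inner (F0 (ind a b)) (F0 (ind c d)) = l2_inner (ind a b) (ind c d)"
proof -
  have r: "AE \<xi> in lborel. rep (F0 (ind a b)) \<xi> = complex_of_real foc * eab a b \<xi>" if "a \<le> b" for a b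
    using rep_F0[OF ind_P0[OF that]] AE_ftr_rep_ind[OF that] by eventually_elim simp
  have "l2_inner (F0 (ind a b)) (F0 (ind c d))
      = (LINT \<xi>|lborel. (complex_of_real foc * eab a b \<xi>) * cnj (complex_of_real foc * eab c d \<xi>))"
    by (intro l2_inner_eqI r assms) auto
  also have "\<dots> = (LINT \<xi>|lborel. complex_of_real (foc * foc) * (eab a b \<xi> * cnj (eab c d \<xi>)))"
    by (simp add: mult_ac)
  also have "\<dots> = complex_of_real (foc * foc) * (LINT \<xi>|lborel. eab a b \<xi> * cnj (eab c d \<xi>))"
    by (rule integral_mult_right_zero)
  also have "\<dots> = complex_of_real (foc * foc * (2 * cI) * ((\<bar>c - b\<bar> + \<bar>d - a\<bar> - \<bar>d - b\<bar> - \<bar>c - a\<bar>) / 2))"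
    unfolding eab_inner of_real_mult[symmetric] by (simp add: algebra_simps)
  also have "\<dots> = l2_inner (ind a b) (ind c d)"
    unfolding l2_inner_ind_ind[OF assms] foc_sq by simp
  finally show ?thesis .
qed

text \<open>Sesquilinearity spreads the formula from pairs of intervals first over the left
  argument, then over the right one.\<close>

lemma F0_inner:
  assumes "x \<in> V0" "y \<in> V0"
  shows "l2_inner (F0 x) (F0 y) = l2_inner x y"
proof -
  note inner_rules = F0_add F0_scale l2_inner_add_left l2_inner_add_right l2_inner_scale_left l2_inner_scale_right
  have F00: "F0 0 = 0" using F0_scale[OF zero_P0, of 0] by simp
  have 1: "V0 \<subseteq> {x \<in> P0. l2_inner (F0 x) (F0 (ind c d)) = l2_inner x (ind c d)}" if "c \<le> d" for c d
    by (rule V0_subset)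
      (auto intro!: subspaceI_L2 zero_P0 add_P0 scale_P0 ind_P0 simp: inner_rules F00 ind_P0 F0_inner_ind that)
  have "V0 \<subseteq> {y \<in> P0. l2_inner (F0 x) (F0 y) = l2_inner x y}"
    by (rule V0_subset)
      (use 1 assms(1) in \<open>auto intro!: subspaceI_L2 zero_P0 add_P0 scale_P0 ind_P0 simp: inner_rules F00 ind_P0\<close>)
  then show ?thesis using assms by auto
qed

lemma subspace_closure:
  fixes S :: "'a :: real_normed_vector set"
  assumes "subspace S"
  shows "subspace (closure S)"
  unfolding subspace_def
proof (intro conjI ballI allI)
  show "0 \<in> closure S" using subspace_0[OF assms] closure_subset by blast
next
  fix x y assume "x \<in> closure S" "y \<in> closure S"
  then obtain f g where "\<And>n. f n \<in> S" "f \<longlonglongrightarrow> x" "\<And>n. g n \<in> S" "g \<longlonglongrightarrow> y"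
    by (auto simp: closure_sequential)
  then show "x + y \<in> closure S"
    unfolding closure_sequential
    by (intro exI[of _ "\<lambda>n. f n + g n"]) (auto intro: subspace_add[OF assms] tendsto_add)
next
  fix c x assume "x \<in> closure S"
  then obtain f where "\<And>n. f n \<in> S" "f \<longlonglongrightarrow> x"
    by (auto simp: closure_sequential)
  then show "c *\<^sub>R x \<in> closure S"
    unfolding closure_sequential
    by (intro exI[of _ "\<lambda>n. c *\<^sub>R f n"]) (auto intro: subspace_scale[OF assms] tendsto_scaleR)
qed

lemma V0_dense:
  assumes "closed S" "V0 \<subseteq> S"
  shows "S = UNIV"
proof -
  have "closure V0 = UNIV"
  proof (rule ind_dense)
    show "l2_scale c (ind a b) \<in> closure V0" for a b c
    proof (cases "a \<le> b")
      case True
      then show ?thesis using V0_gen closure_subset by blast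
    next
      case False
      then show ?thesis using subspace_0[OF subspace_V0] closure_subset by (auto simp: ind_empty)
    qed
  qed (simp_all add: subspace_V0 subspace_closure)
  then show ?thesis using closure_minimal[OF assms(2,1)] by auto
qed

lemma F0_diff_norm:
  assumes "x \<in> V0" "y \<in> V0"
  shows "norm (F0 x - F0 y) = norm (x - y)"
proof -
  have y: "y \<in> P0" "x \<in> P0" using V0_P0 assms by auto
  have d: "x - y = x + l2_scale (-1) y" by (simp add: minus_L2_def plus_L2_def)
  have "x - y \<in> V0" using assms by (simp add: subspace_diff subspace_V0)
  then have "l2_inner (F0 (x - y)) (F0 (x - y)) = l2_inner (x - y) (x - y)" by (intro F0_inner)
  moreover have "F0 (x - y) = F0 x - F0 y"
    unfolding d by (simp add: F0_add y scale_P0 F0_scale) (simp add: uminus_L2_def)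
  ultimately show ?thesis by (simp add: l2_inner_norm flip: of_real_power)
qed

text \<open>The extension exists because \<open>F0\<close> is isometric on \<open>V0\<close>, hence
  uniformly continuous; density of \<open>V0\<close> makes the chosen function the only one.\<close>

definition Fo :: "L2 \<Rightarrow> L2" where
  "Fo = (SOME g. continuous_on UNIV g \<and> (\<forall>x\<in>V0. g x = F0 x))"

lemma Fo_props: "continuous_on UNIV Fo" "x \<in> V0 \<Longrightarrow> Fo x = F0 x"
proof -
  have "uniformly_continuous_on V0 F0"
    unfolding uniformly_continuous_on_def dist_norm using F0_diff_norm by metis
  then obtain g where "uniformly_continuous_on (closure V0) g" "\<And>x. x \<in> V0 \<Longrightarrow> F0 x = g x"
    by (rule uniformly_continuous_on_extension_on_closure) blast
  moreover have "closure V0 = UNIV" by (rule V0_dense) (simp_all add: closure_subset)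
  ultimately have "\<exists>g. continuous_on UNIV g \<and> (\<forall>x\<in>V0. g x = F0 x)"
    using uniformly_continuous_imp_continuous by metis
  then have "continuous_on UNIV Fo \<and> (\<forall>x\<in>V0. Fo x = F0 x)"
    unfolding Fo_def by (rule someI_ex)
  then show "continuous_on UNIV Fo" "x \<in> V0 \<Longrightarrow> Fo x = F0 x" by auto
qed

lemma Fo_continuous [continuous_intros]: "continuous_on S f \<Longrightarrow> continuous_on S (\<lambda>x. Fo (f x))"
  by (rule continuous_on_compose2[OF Fo_props(1)]) auto

lemma V0_eqI:
  fixes f g :: "L2 \<Rightarrow> 'b :: t2_space"
  assumes "continuous_on UNIV f" "continuous_on UNIV g" "\<And>x. x \<in> V0 \<Longrightarrow> f x = g x"
  shows "f x = g x"
  using V0_dense[OF closed_Collect_eq[OF assms(1,2)]] assms(3) by auto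

lemma Fo_add: "Fo (x + y) = Fo x + Fo y"
proof (rule V0_eqI[of "\<lambda>y. Fo (x + y)"])
  fix y assume y: "y \<in> V0"
  show "Fo (x + y) = Fo x + Fo y"
  proof (rule V0_eqI[of "\<lambda>x. Fo (x + y)"])
    show "Fo (x + y) = Fo x + Fo y" if "x \<in> V0" for x
      using that y V0_P0 subspace_add[OF subspace_V0] by (auto simp: Fo_props(2) F0_add subset_iff)
  qed (intro continuous_intros)+
qed (intro continuous_intros)+

lemma continuous_on_l2_scale [continuous_intros]: "continuous_on S f \<Longrightarrow> continuous_on S (\<lambda>x. l2_scale c (f x))"
  by (rule bounded_linear.continuous_on[OF bounded_linear_l2_scale])

lemma Fo_scale: "Fo (l2_scale c x) = l2_scale c (Fo x)"
proof (rule V0_eqI[of "\<lambda>x. Fo (l2_scale c x)"])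
  show "Fo (l2_scale c x) = l2_scale c (Fo x)" if "x \<in> V0" for x
    using that V0_P0 V0_scale by (auto simp: Fo_props(2) F0_scale subset_iff)
qed (intro continuous_intros)+

lemma Fo_inner: "l2_inner (Fo x) (Fo y) = l2_inner x y"
proof (rule V0_eqI[of "\<lambda>y. l2_inner (Fo x) (Fo y)"])
  fix y assume y: "y \<in> V0"
  show "l2_inner (Fo x) (Fo y) = l2_inner x y"
  proof (rule V0_eqI[of "\<lambda>x. l2_inner (Fo x) (Fo y)"])
    show "l2_inner (Fo x) (Fo y) = l2_inner x y" if "x \<in> V0" for x
      using that y by (simp add: Fo_props(2) F0_inner)
  qed (intro continuous_intros)+
qed (intro continuous_intros)+

lemma isometry_norm:
  assumes "\<And>x y. l2_inner (W x) (W y) = l2_inner x y"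
  shows "norm (W x) = norm x"
  using assms[of x x] by (simp add: l2_inner_norm flip: of_real_power)

lemma bop_Fo: "bop Fo"
  unfolding bop_def l2_fold by (auto simp: Fo_add Fo_scale isometry_norm[OF Fo_inner] intro!: exI[of _ 1])

text \<open>Reflecting an interval conjugates its transform, so the multiplication formula moves the
  transform from the indicator to \<open>x\<close>. Since every integrable \<open>x\<close> is
  allowed, this identifies \<open>Fo x\<close> beyond step functions.\<close>

lemma Fo_adjoint_ind_aux:
  assumes "integrable lborel (rep x)" "a \<le> b"
  shows "l2_inner x (F0 (ind (-b) (-a))) = (LINT \<xi>:{a..b}|lborel. complex_of_real foc * ftr (rep x) \<xi>)"
proof -
  have "l2_inner x (F0 (ind (-b) (-a))) = (LINT t|lborel. rep x t * cnj (complex_of_real foc * ftr (indf (-b) (-a)) t))"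
    using rep_F0[OF ind_P0[of "-b" "-a"]] assms(2) by (intro l2_inner_eqI) (auto simp: ftr_rep_ind)
  also have "\<dots> = (LINT t|lborel. complex_of_real foc * (rep x t * ftr (indf a b) t))"
    by (simp add: ftr_indf_neg mult_ac)
  also have "\<dots> = complex_of_real foc * (LINT t|lborel. rep x t * ftr (indf a b) t)"
    by (rule integral_mult_right_zero)
  also have "\<dots> = complex_of_real foc * (LINT \<xi>|lborel. indf a b \<xi> * ftr (rep x) \<xi>)"
    using integral_mult_ftr[OF assms(1) integrable_indf] by simp
  also have "\<dots> = (LINT \<xi>|lborel. complex_of_real foc * (indf a b \<xi> * ftr (rep x) \<xi>))"
    by (rule integral_mult_right_zero[symmetric])
  also have "\<dots> = (LINT \<xi>:{a..b}|lborel. complex_of_real foc * ftr (rep x) \<xi>)"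
    unfolding set_lebesgue_integral_def by (simp add: scaleR_conv_of_real mult_ac)
  finally show ?thesis .
qed

lemma ind_V0: "a \<le> b \<Longrightarrow> ind a b \<in> V0"
  using V0_gen[of a b 1] by simp

lemma Fo_adjoint_ind: "l2_inner (Fo x) (ind a b) = l2_inner x (Fo (ind (-b) (-a)))"
proof (cases "a \<le> b")
  case True
  show ?thesis
  proof (rule V0_eqI[of "\<lambda>x. l2_inner (Fo x) (ind a b)"])
    fix x assume x: "x \<in> V0"
    then have xP: "x \<in> P0" using V0_P0 by auto
    have "l2_inner (F0 x) (ind a b) = (LINT \<xi>:{a..b}|lborel. rep (F0 x) \<xi>)" by (rule l2_inner_ind)
    also have "\<dots> = (LINT \<xi>:{a..b}|lborel. complex_of_real foc * ftr (rep x) \<xi>)"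
      unfolding set_lebesgue_integral_def
      by (intro integral_cong_AE) (use rep_F0[OF xP] in \<open>auto elim!: eventually_mono\<close>)
    also have "\<dots> = l2_inner x (F0 (ind (-b) (-a)))"
      using Fo_adjoint_ind_aux[of x a b] xP True by (simp add: P0_def)
    finally show "l2_inner (Fo x) (ind a b) = l2_inner x (Fo (ind (-b) (-a)))"
      using x True by (simp add: Fo_props(2) ind_V0)
  qed (intro continuous_intros)+
next
  case False
  moreover have "Fo 0 = 0" using Fo_scale[of 0 0] by simp
  ultimately show ?thesis by (simp add: ind_empty)
qed

text \<open>Both sides have the same integral over every bounded interval, by the adjoint relation
  tested on indicators.\<close>

lemma rep_Fo:
  assumes "integrable lborel (rep x)"
  shows "AE \<xi> in lborel. rep (Fo x) \<xi> = complex_of_real foc * ftr (rep x) \<xi>"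
proof -
  let ?G = "\<lambda>\<xi>. complex_of_real foc * ftr (rep x) \<xi>"
  have intG: "set_integrable lborel {a..b} ?G" for a b
    unfolding set_integrable_def
  proof (rule integrableI_bounded_set_indicator[where B = "cmod (complex_of_real foc) * (LINT t|lborel. cmod (rep x t))"])
    show "AE \<xi> in lborel. \<xi> \<in> {a..b} \<longrightarrow> norm (?G \<xi>) \<le> cmod (complex_of_real foc) * (LINT t|lborel. cmod (rep x t))"
      using ftr_bound[OF assms] by (intro AE_I2) (auto simp: norm_mult intro!: mult_left_mono)
  qed (auto simp: emeasure_lborel_Icc_eq)
  have "AE \<xi> in lborel. rep (Fo x) \<xi> - ?G \<xi> = 0"
  proof (rule AE_zero_interval_integrals)
    show "set_integrable lborel {a..b} (\<lambda>\<xi>. rep (Fo x) \<xi> - ?G \<xi>)" for a b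
      by (intro set_integral_diff rep_set_integrable intG)
    show "(LINT \<xi>:{a..b}|lborel. rep (Fo x) \<xi> - ?G \<xi>) = 0" for a b
    proof (cases "a \<le> b")
      case True
      have "(LINT \<xi>:{a..b}|lborel. rep (Fo x) \<xi> - ?G \<xi>) = (LINT \<xi>:{a..b}|lborel. rep (Fo x) \<xi>) - (LINT \<xi>:{a..b}|lborel. ?G \<xi>)"
        by (intro set_integral_diff rep_set_integrable intG)
      also have "\<dots> = 0"
        using Fo_adjoint_ind[of x a b] Fo_adjoint_ind_aux[OF assms True] True
        by (simp add: l2_inner_ind Fo_props(2) ind_V0)
      finally show ?thesis .
    qed (simp add: set_lebesgue_integral_def)
  qed
  then show ?thesis by eventually_elim simp
qed

abbreviation Rop :: "L2 \<Rightarrow> L2" where "Rop \<equiv> affop (-1) 0"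

text \<open>Induction for closed properties with interval indicators as base case; it serves to
  prove identities between continuous maps on \<open>L2\<close>.\<close>

lemma L2_dense_induct:
  assumes cl: "closed {x. P x}" and "\<And>a b. P (ind a b)"
    and "\<And>x y. P x \<Longrightarrow> P y \<Longrightarrow> P (x + y)" "\<And>c x. P x \<Longrightarrow> P (l2_scale c x)"
  shows "P x"
proof -
  have "P 0" using assms(4)[OF assms(2)[of 0 0], of 0] by simp
  have "{x. P x} = UNIV"
    by (rule ind_dense[OF _ cl]) (use assms \<open>P 0\<close> in \<open>auto intro!: subspaceI_L2\<close>)
  then show ?thesis by auto
qed

lemma continuous_on_bop: "bop T \<Longrightarrow> continuous_on S f \<Longrightarrow> continuous_on S (\<lambda>x. T (f x))"
  by (rule bounded_linear.continuous_on[OF bop_bounded_linear])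

lemma bop_add: "bop T \<Longrightarrow> T (x + y) = T x + T y"
  by (simp add: bop_def l2_fold)

lemma Fo_adjoint: "l2_inner (Fo x) y = l2_inner x (Fo (Rop y))"
proof (induction y rule: L2_dense_induct)
  show "closed {y. l2_inner (Fo x) y = l2_inner x (Fo (Rop y))}"
    by (intro closed_Collect_eq continuous_intros continuous_on_bop[OF bop_affop]) auto
qed (auto simp: affop_ind_neg Fo_adjoint_ind affop_add affop_scale Fo_add Fo_scale l2_inner_add_right l2_inner_scale_right)

text \<open>Fourier inversion from isometry alone: by \<open>Fo_adjoint\<close> the adjoint of
  \<open>Fo\<close> is \<open>Fo\<close> after the reflection, and an isometry followed by its
  adjoint is the identity.\<close>

lemma Fo_Rop_Fo: "Fo (Rop (Fo y)) = y"
proof -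
  have "l2_inner (Fo (Rop (Fo y))) x = l2_inner y x" for x
    using Fo_adjoint[of x "Fo y"] Fo_inner[of x y] by (metis l2_inner_commute)
  then show ?thesis by (simp add: l2_eq_iff_inner)
qed

definition Foi :: "L2 \<Rightarrow> L2" where "Foi y = Rop (Fo y)"

lemma Fo_Foi [simp]: "Fo (Foi y) = y"
  by (simp add: Foi_def Fo_Rop_Fo)

lemma Fo_inj: "Fo x = Fo y \<Longrightarrow> x = y"
  by (metis Fo_inner l2_eq_iff_inner)

lemma Foi_Fo [simp]: "Foi (Fo y) = y"
  by (rule Fo_inj) simp

lemma bop_Foi: "bop Foi"
  using bop_compose[OF bop_affop bop_Fo, of "-1" 0] by (simp add: Foi_def[abs_def] o_def)

lemma Foi_inner: "l2_inner (Foi x) (Foi y) = l2_inner x y"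
  using Fo_inner[of "Foi x" "Foi y"] by simp

lemma Foi_Fo_inner: "l2_inner (Foi x) y = l2_inner x (Fo y)"
  using Fo_inner[of "Foi x" y] by simp

lemma unitary_Fo: "unitary Fo"
  unfolding unitary_def
  by (auto simp: bop_Fo Fo_inner intro!: o_bij[of Foi] simp: fun_eq_iff)

lemma Fo_D_op: "Fo (D_op m x) = M_op (- m) (Fo x)"
proof (induction x rule: L2_dense_induct)
  show "closed {x. Fo (D_op m x) = M_op (- m) (Fo x)}"
    by (intro closed_Collect_eq continuous_intros continuous_on_bop[OF bop_D_op] continuous_on_bop[OF bop_M_op])
  show "Fo (D_op m (ind a b)) = M_op (- m) (Fo (ind a b))" for a b
    by (rule L2_eqI, use rep_Fo[OF integrable_rep_ind[of a b]] rep_Fo[OF integrable_rep_ind[of "a + m" "b + m"]]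
      rep_M_op[of "-m" "Fo (ind a b)"] in \<open>eventually_elim, simp add: D_op_ind ftr_rep_ind ftr_indf_shift\<close>)
qed (auto simp: bop_add[OF bop_D_op] bop_add[OF bop_M_op] bop_scale[OF bop_D_op] bop_scale[OF bop_M_op] Fo_add Fo_scale)

lemma Foi_D_op: "Foi (D_op m x) = M_op m (Foi x)"
  unfolding Foi_def Fo_D_op M_op_eq by (subst affop_mulop) (auto intro: bmf_cis)

lemma Fo_M_op: "Fo (M_op l x) = D_op l (Fo x)"
  using Foi_D_op[of l "Fo x"] by (metis Fo_Foi Foi_Fo)

section \<open>Metaplectic unitaries\<close>

lemma unitary_inverse:
  assumes "unitary W"
  shows "W (inv W x) = x" "inv W (W x) = x"
  using assms by (simp_all add: unitary_def bij_is_surj surj_f_inv_f bij_is_inj)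

lemma unitary_inner: "unitary W \<Longrightarrow> l2_inner (W x) (W y) = l2_inner x y"
  by (simp add: unitary_def)

lemma unitary_bop: "unitary W \<Longrightarrow> bop W"
  by (simp add: unitary_def)

lemma unitary_norm: "unitary W \<Longrightarrow> norm (W x) = norm x"
  by (rule isometry_norm) (simp add: unitary_inner)

lemma unitaryI:
  assumes "bop W" "\<And>x. V (W x) = x" "\<And>x. W (V x) = x" "\<And>x y. l2_inner (W x) (W y) = l2_inner x y"
  shows "unitary W"
  unfolding unitary_def using assms by (auto intro!: o_bij[of V] simp: fun_eq_iff)

lemma unitary_inv:
  assumes W: "unitary W"
  shows "unitary (inv W)"
proof (rule unitaryI[of _ W])
  note i = unitary_inverse[OF W]
  show inner: "l2_inner (inv W x) (inv W y) = l2_inner x y" for x y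
    using unitary_inner[OF W, of "inv W x" "inv W y"] by (simp add: i)
  have inj: "W x = W y \<Longrightarrow> x = y" for x y by (metis i(2))
  show "bop (inv W)"
    unfolding bop_def l2_fold
  proof (intro conjI allI exI[of _ 1])
    show "inv W (x + y) = inv W x + inv W y" for x y
      by (rule inj) (simp add: i bop_add[OF unitary_bop[OF W]])
    show "inv W (l2_scale c x) = l2_scale c (inv W x)" for c x
      by (rule inj) (simp add: i bop_scale[OF unitary_bop[OF W]])
    show "norm (inv W x) \<le> 1 * norm x" for x
      using unitary_norm[OF W, of "inv W x"] by (simp add: i)
  qed
qed (simp_all add: unitary_inverse[OF W])

lemma unitary_compose:
  assumes "unitary V" "unitary W"
  shows "unitary (V \<circ> W)"
  using assms unfolding unitary_def by (auto intro: bop_compose bij_comp)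

lemma bop_conj: "unitary W \<Longrightarrow> bop T \<Longrightarrow> bop (W \<circ> T \<circ> inv W)"
  by (intro bop_compose) (auto intro: unitary_bop unitary_inv)

lemma conj_conj:
  assumes "unitary W"
  shows "inv W \<circ> (W \<circ> T \<circ> inv W) \<circ> W = T" "W \<circ> (inv W \<circ> T \<circ> W) \<circ> inv W = T"
  using unitary_inverse[OF assms] by (auto simp: fun_eq_iff)

lemma inv_inv_unitary: "unitary W \<Longrightarrow> inv (inv W) = W"
  by (simp add: unitary_def inv_inv_eq)

text \<open>A normal functional of the conjugate is the normal functional with vectors
  \<open>inv W (F j k)\<close> and \<open>inv W (G j k)\<close>, whose norms are unchanged, so
  square summability persists.\<close>

lemma wstar_closure_conj_sub:
  assumes W: "unitary W" and T: "T \<in> wstar_closure A"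
  shows "W \<circ> T \<circ> inv W \<in> wstar_closure ((\<lambda>T. W \<circ> T \<circ> inv W) ` A)"
proof -
  let ?c = "\<lambda>T. W \<circ> T \<circ> inv W"
  have inner: "l2_inner (?c S x) y = l2_inner (S (inv W x)) (inv W y)" for S x y
    using unitary_inner[OF W, of "S (inv W x)" "inv W y"] by (simp add: unitary_inverse[OF W])
  have n: "l2_norm (inv W x) = l2_norm x" for x
    using unitary_norm[OF unitary_inv[OF W], of x] by (simp add: l2_fold)
  have bT: "bop T" using T by (simp add: wstar_closure_def)
  have "\<exists>S\<in>?c ` A. \<forall>j<m. cmod ((\<Sum>k. l2_inner (?c T (F j k)) (G j k)) - (\<Sum>k. l2_inner (S (F j k)) (G j k))) < e"
    if "e > 0" "\<forall>j<m. summable (\<lambda>k. (l2_norm (F j k))\<^sup>2) \<and> summable (\<lambda>k. (l2_norm (G j k))\<^sup>2)"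
    for m :: nat and F G :: "nat \<Rightarrow> nat \<Rightarrow> L2" and e :: real
  proof -
    have "\<exists>S\<in>A. \<forall>j<m. cmod ((\<Sum>k. l2_inner (T (inv W (F j k))) (inv W (G j k))) - (\<Sum>k. l2_inner (S (inv W (F j k))) (inv W (G j k)))) < e"
      using T that unfolding wstar_closure_def
      by (auto dest!: spec[of _ m] spec[of _ "\<lambda>j k. inv W (F j k)"] spec[of _ "\<lambda>j k. inv W (G j k)"] spec[of _ e] simp: n)
    then show ?thesis unfolding inner[symmetric] by blast
  qed
  then show ?thesis
    unfolding wstar_closure_def using bop_conj[OF W bT] by auto
qed

lemma wstar_closure_conj:
  assumes W: "unitary W"
  shows "(\<lambda>T. W \<circ> T \<circ> inv W) ` wstar_closure A = wstar_closure ((\<lambda>T. W \<circ> T \<circ> inv W) ` A)"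
proof
  show "(\<lambda>T. W \<circ> T \<circ> inv W) ` wstar_closure A \<subseteq> wstar_closure ((\<lambda>T. W \<circ> T \<circ> inv W) ` A)"
    using wstar_closure_conj_sub[OF W] by auto
  show "wstar_closure ((\<lambda>T. W \<circ> T \<circ> inv W) ` A) \<subseteq> (\<lambda>T. W \<circ> T \<circ> inv W) ` wstar_closure A"
  proof
    fix T assume "T \<in> wstar_closure ((\<lambda>T. W \<circ> T \<circ> inv W) ` A)"
    from wstar_closure_conj_sub[OF unitary_inv[OF W] this]
    have "inv W \<circ> T \<circ> W \<in> wstar_closure A"
      by (simp add: image_image inv_inv_unitary[OF W] conj_conj[OF W])
    then show "T \<in> (\<lambda>T. W \<circ> T \<circ> inv W) ` wstar_closure A"
      using conj_conj(2)[OF W, of T] by (metis imageI)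
  qed
qed

text \<open>Conjugation only has to send generators to scalar multiples of generators, since a span
  absorbs the scalars.\<close>

lemma ospan_conj_sub:
  assumes W: "unitary W"
    and U: "\<And>V. V \<in> U \<Longrightarrow> \<exists>k. \<exists>V'\<in>U'. W \<circ> V \<circ> inv W = (\<lambda>x. l2_scale k (V' x))"
    and T: "T \<in> ospan U"
  shows "W \<circ> T \<circ> inv W \<in> ospan U'"
  using T
proof induction
  case zero
  have "W l2_zero = l2_zero"
    using linear_0[OF bounded_linear.linear[OF bop_bounded_linear[OF unitary_bop[OF W]]]] by (simp add: l2_fold)
  then show ?case using ospan.zero by (simp add: o_def)
next
  case (base V)
  then obtain k V' where "V' \<in> U'" "W \<circ> V \<circ> inv W = (\<lambda>x. l2_scale k (V' x))" using U by blast
  then show ?case using ospan.scale[OF ospan.base] by metis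
next
  case (add S T)
  then show ?case
    using ospan.add[OF add.IH] unitary_bop[OF W] by (simp add: o_def bop_def)
next
  case (scale T c)
  then show ?case
    using ospan.scale[OF scale.IH, of c] unitary_bop[OF W] by (simp add: o_def bop_def)
qed

text \<open>The matrix with rows (a, b) and (c, d) acts on the parameters (l, m). The phase may
  depend on l and m, as M_l D_m is multiplicative only up to unimodular scalars.\<close>

definition implements :: "(L2 \<Rightarrow> L2) \<Rightarrow> real \<Rightarrow> real \<Rightarrow> real \<Rightarrow> real \<Rightarrow> bool" where
  "implements W a b c d \<longleftrightarrow> unitary W \<and>
    (\<forall>l m. \<exists>k. cmod k = 1 \<and>
      (\<forall>x. W (M_op l (D_op m x)) = l2_scale k (M_op (a * l + b * m) (D_op (c * l + d * m) (W x)))))"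

lemma implementsI:
  assumes "unitary W" "\<And>l m. cmod (k l m) = 1"
    "\<And>l m x. W (M_op l (D_op m x)) = l2_scale (k l m) (M_op (a * l + b * m) (D_op (c * l + d * m) (W x)))"
  shows "implements W a b c d"
  unfolding implements_def using assms by blast

lemma implements_compose:
  assumes V: "implements V a' b' c' d'" and W: "implements W a b c d"
  shows "implements (V \<circ> W) (a' * a + b' * c) (a' * b + b' * d) (c' * a + d' * c) (c' * b + d' * d)"
  unfolding implements_def
proof (intro conjI allI)
  have uV: "unitary V" using V by (simp add: implements_def)
  show "unitary (V \<circ> W)" using V W by (auto simp: implements_def intro: unitary_compose)
  fix l m
  obtain k where k: "cmod k = 1" "\<And>x. W (M_op l (D_op m x)) = l2_scale k (M_op (a * l + b * m) (D_op (c * l + d * m) (W x)))"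
    using W unfolding implements_def by blast
  obtain k' where k': "cmod k' = 1" "\<And>x. V (M_op (a * l + b * m) (D_op (c * l + d * m) x)) =
      l2_scale k' (M_op (a' * (a * l + b * m) + b' * (c * l + d * m)) (D_op (c' * (a * l + b * m) + d' * (c * l + d * m)) (V x)))"
    using V unfolding implements_def by blast
  have "(V \<circ> W) (M_op l (D_op m x)) = l2_scale (k * k') (M_op ((a' * a + b' * c) * l + (a' * b + b' * d) * m)
      (D_op ((c' * a + d' * c) * l + (c' * b + d' * d) * m) ((V \<circ> W) x)))" for x
    by (simp add: k(2) bop_scale[OF unitary_bop[OF uV]] k'(2) l2_scale_scale algebra_simps)
  then show "\<exists>k. cmod k = 1 \<and> (\<forall>x. (V \<circ> W) (M_op l (D_op m x)) = l2_scale k (M_op ((a' * a + b' * c) * l + (a' * b + b' * d) * m)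
      (D_op ((c' * a + d' * c) * l + (c' * b + d' * d) * m) ((V \<circ> W) x))))"
    using k(1) k'(1) by (intro exI[of _ "k * k'"]) (auto simp: norm_mult)
qed

section \<open>The generators: chirps, dilations and the Fourier transform\<close>

lemma l2_scale_mulop: "l2_scale k = mulop (\<lambda>_. k)"
  by (rule ext) (simp add: l2_scale_def mulop_def)

lemma bmf_const: "bmf (\<lambda>_. k)"
  by (rule bmfI[of _ "cmod k"]) auto

lemma D_op_mulop: "bmf q \<Longrightarrow> D_op m (mulop q x) = mulop (\<lambda>t. q (t - m)) (D_op m x)"
  unfolding D_op_eq using affop_mulop[of 1 q "- m" x] by simp

lemma unitary_mulop:
  assumes "q \<in> borel_measurable borel" "\<And>t. cmod (q t) = 1"
  shows "unitary (mulop q)"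
proof -
  have b: "bmf q" using assms by (intro bmfI[of q 1]) auto
  have 1: "q t * cnj (q t) = 1" for t using assms(2)[of t] by (simp add: complex_mult_cnj_cmod)
  have inv: "mulop (\<lambda>t. cnj (q t)) (mulop q x) = x" "mulop q (mulop (\<lambda>t. cnj (q t)) x) = x" for x
    using 1 by (simp_all add: mulop_mulop b bmf_cnj mult.commute)
  show ?thesis
    by (rule unitaryI[of _ "mulop (\<lambda>t. cnj (q t))"]) (auto simp: bop_mulop b inv mulop_adjoint)
qed

text \<open>A quadratic phase is a shear: translating it by m produces a linear phase, which amounts
  to an extra modulation by t m.\<close>

lemma implements_chirp: "implements (mulop (\<lambda>s. cis (t * s\<^sup>2 / 2))) 1 t 0 1"
proof (rule implementsI)
  \<comment> \<open>\<open>?k\<close> cancels the constant term of t (s - m)^2 / 2 = t s^2 / 2 - t m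
    s + t m^2 / 2.\<close>
  let ?q = "\<lambda>s::real. cis (t * s\<^sup>2 / 2)" and ?k = "\<lambda>l m :: real. cis (- (t * m\<^sup>2 / 2))"
  show "unitary (mulop ?q)" by (rule unitary_mulop) auto
  show "cmod (?k l m) = 1" for l m by simp
  have bq: "bmf ?q" by (rule bmf_cis) auto
  fix l m x
  have "mulop ?q (M_op l (D_op m x)) = mulop (\<lambda>s. cis (t * s\<^sup>2 / 2 + l * s)) (D_op m x)"
    unfolding M_op_eq by (subst mulop_mulop) (auto intro!: bmf_cis simp: cis_mult)
  moreover have "l2_scale (?k l m) (M_op (1 * l + t * m) (D_op (0 * l + 1 * m) (mulop ?q x)))
      = mulop (\<lambda>s. ?k l m * (cis ((l + t * m) * s) * cis (t * (s - m)\<^sup>2 / 2))) (D_op m x)"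
    unfolding M_op_eq l2_scale_mulop by (simp add: D_op_mulop bq mulop_mulop bmf_cis bmf_const bmf_mult)
  moreover have "?k l m * (cis ((l + t * m) * s) * cis (t * (s - m)\<^sup>2 / 2)) = cis (t * s\<^sup>2 / 2 + l * s)" for s
    unfolding cis_mult by (rule arg_cong[of _ _ cis]) (simp add: power2_eq_square field_simps)
  ultimately show "mulop ?q (M_op l (D_op m x)) = l2_scale (?k l m) (M_op (1 * l + t * m) (D_op (0 * l + 1 * m) (mulop ?q x)))"
    by simp
qed

lemma implements_dilation:
  assumes a: "a \<noteq> 0"
  shows "implements (affop a 0) a 0 0 (1 / a)"
proof (rule implementsI[where k = "\<lambda>_ _. 1"])
  show "unitary (affop a 0)"
    using a by (auto simp: unitary_def bop_affop bij_affop affop_inner)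
  show "affop a 0 (M_op l (D_op m x)) = l2_scale 1 (M_op (a * l + 0 * m) (D_op (0 * l + 1 / a * m) (affop a 0 x)))" for l m x
    unfolding M_op_eq D_op_eq using a by (simp add: affop_mulop bmf_cis affop_affop mult_ac)
qed simp

text \<open>A quarter turn of the parameter plane; the phase comes from exchanging
  \<open>D_op l\<close> with \<open>M_op (- m)\<close>.\<close>

lemma implements_Fo: "implements Fo 0 (-1) 1 0"
proof (rule implementsI[OF unitary_Fo, where k = "\<lambda>l m. cis (m * l)"])
  show "Fo (M_op l (D_op m x)) = l2_scale (cis (m * l)) (M_op (0 * l + (-1) * m) (D_op (1 * l + 0 * m) (Fo x)))" for l m x
    unfolding Fo_M_op Fo_D_op
    unfolding M_op_eq l2_scale_mulop
    by (simp add: D_op_mulop bmf_cis mulop_mulop bmf_const cis_mult algebra_simps)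
qed simp

lemma implements_SL2: \<comment> \<open>Bruhat decomposition\<close>
  assumes det: "a * d - b * c = 1"
  shows "\<exists>W. implements W a b c d"
proof (cases "c = 0")
  case True
  then have ad: "a * d = 1" using det by simp
  then have a: "a \<noteq> 0" by auto
  with ad have d: "d = 1 / a" by (metis nonzero_mult_div_cancel_left)
  have "\<exists>W. implements W (1 * a + a * b * 0) (1 * 0 + a * b * (1 / a)) (0 * a + 1 * 0) (0 * 0 + 1 * (1 / a))"
    using implements_compose[OF implements_chirp implements_dilation[OF a]] by blast
  then show ?thesis using True a d by simp
next
  case False
  \<comment> \<open>Read from the right, the factors are a shear by d / c, the dilation by c, the
    quarter turn and a shear by a / c. The product has upper right entry (a d - 1) / c, which is
    b.\<close>
  have "\<exists>W. implements W (c * 1 + 0 * 0) (c * (d / c) + 0 * 1) (0 * 1 + 1 / c * 0) (0 * (d / c) + 1 / c * 1)"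
    using implements_compose[OF implements_dilation[OF False] implements_chirp] by blast
  then obtain W1 where 1: "implements W1 c d 0 (1 / c)" using False by auto
  have "\<exists>W. implements W (0 * c + (-1) * 0) (0 * d + (-1) * (1 / c)) (1 * c + 0 * 0) (1 * d + 0 * (1 / c))"
    using implements_compose[OF implements_Fo 1] by blast
  then obtain W2 where 2: "implements W2 0 (- (1 / c)) c d" by auto
  have "\<exists>W. implements W (1 * 0 + a / c * c) (1 * (- (1 / c)) + a / c * d) (0 * 0 + 1 * c) (0 * (- (1 / c)) + 1 * d)"
    using implements_compose[OF implements_chirp 2] by blast
  moreover have "1 * (- (1 / c)) + a / c * d = b" using False det by (simp add: field_simps)
  ultimately show ?thesis using False by simp
qed

text \<open>The hypotheses say that the matrix maps \<open>C\<close> onto \<open>C'\<close>. The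
  reverse inclusion of spans repeats the argument for \<open>inv W\<close>, with inverted
  phases.\<close>

lemma A_cone_conj:
  assumes W: "implements W a b c d"
    and C: "\<And>l m. (l, m) \<in> C \<Longrightarrow> (a * l + b * m, c * l + d * m) \<in> C'"
    and C': "\<And>l' m'. (l', m') \<in> C' \<Longrightarrow> \<exists>l m. (l, m) \<in> C \<and> l' = a * l + b * m \<and> m' = c * l + d * m"
  shows "(\<lambda>T. W \<circ> T \<circ> inv W) ` A_cone C = A_cone C'"
proof -
  have uW: "unitary W" using W by (simp add: implements_def)
  note i = unitary_inverse[OF uW]
  let ?U = "\<lambda>C. {M_op lam \<circ> D_op mu | lam mu. (lam, mu) \<in> C}"
  have imp: "\<exists>k. cmod k = 1 \<and> (\<forall>x. W (M_op l (D_op m x)) = l2_scale k (M_op (a * l + b * m) (D_op (c * l + d * m) (W x))))" for l m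
    using W unfolding implements_def by blast
  have 1: "\<exists>k. \<exists>V'\<in>?U C'. W \<circ> V \<circ> inv W = (\<lambda>x. l2_scale k (V' x))" if "V \<in> ?U C" for V
  proof -
    obtain l m where V: "V = M_op l \<circ> D_op m" "(l, m) \<in> C" using \<open>V \<in> ?U C\<close> by blast
    obtain k where k: "\<And>x. W (M_op l (D_op m x)) = l2_scale k (M_op (a * l + b * m) (D_op (c * l + d * m) (W x)))"
      using imp by blast
    have "W \<circ> V \<circ> inv W = (\<lambda>x. l2_scale k ((M_op (a * l + b * m) \<circ> D_op (c * l + d * m)) x))"
      by (simp add: fun_eq_iff V(1) k i)
    then show ?thesis using C[OF V(2)] by blast
  qed
  have 2: "\<exists>k. \<exists>V\<in>?U C. inv W \<circ> V' \<circ> inv (inv W) = (\<lambda>x. l2_scale k (V x))" if "V' \<in> ?U C'" for V'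
  proof -
    obtain l' m' where V': "V' = M_op l' \<circ> D_op m'" "(l', m') \<in> C'" using \<open>V' \<in> ?U C'\<close> by blast
    obtain l m where lm: "(l, m) \<in> C" "l' = a * l + b * m" "m' = c * l + d * m" using C'[OF V'(2)] by blast
    obtain k where k: "cmod k = 1" "\<And>x. W (M_op l (D_op m x)) = l2_scale k (M_op l' (D_op m' (W x)))"
      using imp lm by blast
    have "inv W (M_op l' (D_op m' (W x))) = l2_scale (1 / k) (M_op l (D_op m x))" for x
    proof -
      have "inv W (W (M_op l (D_op m x))) = l2_scale k (inv W (M_op l' (D_op m' (W x))))"
        by (simp add: k(2) bop_scale[OF unitary_bop[OF unitary_inv[OF uW]]])
      then have "l2_scale (1 / k) (M_op l (D_op m x)) = l2_scale (1 / k) (l2_scale k (inv W (M_op l' (D_op m' (W x)))))"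
        by (simp add: i)
      then show ?thesis using k(1) by (auto simp: l2_scale_scale)
    qed
    then have "inv W \<circ> V' \<circ> inv (inv W) = (\<lambda>x. l2_scale (1 / k) ((M_op l \<circ> D_op m) x))"
      by (simp add: fun_eq_iff V'(1) inv_inv_unitary[OF uW])
    then show ?thesis using lm(1) by blast
  qed
  have "(\<lambda>T. W \<circ> T \<circ> inv W) ` ospan (?U C) = ospan (?U C')"
  proof
    show "(\<lambda>T. W \<circ> T \<circ> inv W) ` ospan (?U C) \<subseteq> ospan (?U C')"
      using ospan_conj_sub[OF uW 1] by blast
    show "ospan (?U C') \<subseteq> (\<lambda>T. W \<circ> T \<circ> inv W) ` ospan (?U C)"
    proof
      fix T assume "T \<in> ospan (?U C')"
      from ospan_conj_sub[OF unitary_inv[OF uW] 2 this]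
      have "inv W \<circ> T \<circ> W \<in> ospan (?U C)" by (simp add: inv_inv_unitary[OF uW])
      then show "T \<in> (\<lambda>T. W \<circ> T \<circ> inv W) ` ospan (?U C)"
        using conj_conj(2)[OF uW, of T] by (metis (no_types, lifting) image_eqI)
    qed
  qed
  then show ?thesis unfolding A_cone_def wstar_closure_conj[OF uW] by simp
qed

lemma cone_unitary_equiv_quadrant:
  fixes p1 q1 p2 q2 :: real
  assumes pos: "p1 * q2 - p2 * q1 > 0"
  shows "\<exists>W. unitary W \<and> (\<lambda>T. W \<circ> T \<circ> inv W) ` A_cone {a *\<^sub>R (p1, q1) + b *\<^sub>R (p2, q2) | a b :: real. a \<ge> 0 \<and> b \<ge> 0}
    = A_cone {(l, m). l \<ge> 0 \<and> m \<ge> 0}"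
    (is "\<exists>W. unitary W \<and> _ ` A_cone ?C = A_cone ?Q")
proof -
  define e where "e = p1 * q2 - p2 * q1"
  \<comment> \<open>The inverse of the matrix with columns (p1, q1) and (p2, q2) has determinant 1 /
    e; multiplied by sqrt e it lies in SL(2). It maps the point with cone coordinates (a, b) to (s
    a, s b), so the image of the cone is still the whole quadrant.\<close>
  define s where "s = sqrt e"
  have s: "s > 0" "s * s = e" using pos by (auto simp: s_def e_def)
  have e0: "e > 0" using pos by (simp add: e_def)
  have "(q2 / s) * (p1 / s) - (- p2 / s) * (- q1 / s) = (p1 * q2 - p2 * q1) / (s * s)"
    by (simp add: diff_divide_distrib mult.commute)
  also have "\<dots> = 1" using s e0 by (simp add: e_def)
  finally obtain W where W: "implements W (q2 / s) (- p2 / s) (- q1 / s) (p1 / s)"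
    using implements_SL2 by blast
  have comp: "q2 / s * (a * p1 + b * p2) + - p2 / s * (a * q1 + b * q2) = s * a"
    "- q1 / s * (a * p1 + b * p2) + p1 / s * (a * q1 + b * q2) = s * b" for a b
  proof -
    have "q2 / s * (a * p1 + b * p2) + - p2 / s * (a * q1 + b * q2)
        = (q2 * (a * p1 + b * p2) - p2 * (a * q1 + b * q2)) / s" by (simp add: diff_divide_distrib)
    also have "q2 * (a * p1 + b * p2) - p2 * (a * q1 + b * q2) = a * e" by (simp add: e_def algebra_simps)
    finally have "q2 / s * (a * p1 + b * p2) + - p2 / s * (a * q1 + b * q2) = a * e / s" .
    then show "q2 / s * (a * p1 + b * p2) + - p2 / s * (a * q1 + b * q2) = s * a" using s(1) by (simp flip: s(2))
    have "- q1 / s * (a * p1 + b * p2) + p1 / s * (a * q1 + b * q2)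
        = (p1 * (a * q1 + b * q2) - q1 * (a * p1 + b * p2)) / s" by (simp add: diff_divide_distrib)
    also have "p1 * (a * q1 + b * q2) - q1 * (a * p1 + b * p2) = b * e" by (simp add: e_def algebra_simps)
    finally have "- q1 / s * (a * p1 + b * p2) + p1 / s * (a * q1 + b * q2) = b * e / s" .
    then show "- q1 / s * (a * p1 + b * p2) + p1 / s * (a * q1 + b * q2) = s * b" using s(1) by (simp flip: s(2))
  qed
  have "(\<lambda>T. W \<circ> T \<circ> inv W) ` A_cone ?C
    = A_cone ?Q"
  proof (rule A_cone_conj[OF W])
    fix l m assume "(l, m) \<in> ?C"
    then obtain a b where ab: "a \<ge> 0" "b \<ge> 0" "l = a * p1 + b * p2" "m = a * q1 + b * q2" by auto
    show "(q2 / s * l + - p2 / s * m, - q1 / s * l + p1 / s * m) \<in> ?Q"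
      unfolding ab(3,4) comp using ab s by auto
  next
    fix l' m' :: real assume "(l', m') \<in> ?Q"
    then have pos': "l' / s \<ge> 0" "m' / s \<ge> 0" using s by auto
    let ?a = "l' / s" and ?b = "m' / s"
    have "(?a * p1 + ?b * p2, ?a * q1 + ?b * q2) \<in> ?C"
      unfolding mem_Collect_eq by (rule exI[of _ ?a], rule exI[of _ ?b]) (use pos' in simp)
    moreover have "l' = q2 / s * (?a * p1 + ?b * p2) + - p2 / s * (?a * q1 + ?b * q2)"
      "m' = - q1 / s * (?a * p1 + ?b * p2) + p1 / s * (?a * q1 + ?b * q2)"
      unfolding comp using s by auto
    ultimately show "\<exists>l m. (l, m) \<in> ?C \<and>
        l' = q2 / s * l + - p2 / s * m \<and> m' = - q1 / s * l + p1 / s * m" by blast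
  qed
  then show ?thesis using W by (auto simp: implements_def)
qed

section \<open>Weak closures and triangularity\<close>

text \<open>Gaussian elimination on the last coordinate: a vector of \<open>V\<close> with nonzero
  last entry serves as pivot, and the other coordinates are handled inside the kernel of that
  coordinate. Sequences of which only the first m entries count let the induction on m stay within
  one type.\<close>

lemma coordinate_separation:
  fixes V :: "(nat \<Rightarrow> complex) set" and v :: "nat \<Rightarrow> complex"
  assumes "(\<lambda>_. 0) \<in> V"
    and "\<And>u w. u \<in> V \<Longrightarrow> w \<in> V \<Longrightarrow> (\<lambda>j. u j + w j) \<in> V"
    and "\<And>c w. w \<in> V \<Longrightarrow> (\<lambda>j. c * w j) \<in> V"
    and "\<And>c. (\<And>w. w \<in> V \<Longrightarrow> (\<Sum>j<m. c j * w j) = 0) \<Longrightarrow> (\<Sum>j<m. c j * v j) = 0"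
  shows "\<exists>w\<in>V. \<forall>j<m. w j = v j"
  using assms
proof (induction m arbitrary: V v)
  case 0
  then show ?case by auto
next
  case (Suc m)
  note zero = Suc.prems(1) and add = Suc.prems(2) and scale = Suc.prems(3) and sep = Suc.prems(4)
  show ?case
  proof (cases "\<forall>w\<in>V. w m = 0")
    case True
    have vm: "v m = 0" using sep[of "\<lambda>j. if j = m then 1 else 0"] True by simp
    have "\<exists>w\<in>V. \<forall>j<m. w j = v j"
    proof (rule Suc.IH[OF zero add scale])
      fix c assume "\<And>w. w \<in> V \<Longrightarrow> (\<Sum>j<m. c j * w j) = 0"
      then have "(\<Sum>j<Suc m. c j * v j) = 0" using True by (intro sep) simp
      then show "(\<Sum>j<m. c j * v j) = 0" using vm by simp
    qed
    then show ?thesis using True vm by (metis less_Suc_eq)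
  next
    case False
    then obtain w1 where w1: "w1 \<in> V" "w1 m \<noteq> 0" by auto
    define w0 where "w0 = (\<lambda>j. 1 / w1 m * w1 j)"
    have w0: "w0 \<in> V" "w0 m = 1" unfolding w0_def using scale[OF w1(1), of "1 / w1 m"] w1(2) by simp_all
    define V' where "V' = {w \<in> V. w m = 0}"
    have "\<exists>w\<in>V'. \<forall>j<m. w j = v j - v m * w0 j"
    proof (rule Suc.IH)
      fix c assume c: "\<And>w. w \<in> V' \<Longrightarrow> (\<Sum>j<m. c j * w j) = 0"
      \<comment> \<open>The last coefficient is chosen so that \<open>c'\<close> sees only what is
        left of a vector after subtracting its multiple of the pivot.\<close>
      define c' where "c' j = (if j < m then c j else - (\<Sum>j<m. c j * w0 j))" for j
      have c'_eq: "(\<Sum>j<Suc m. c' j * w j) = (\<Sum>j<m. c j * (w j - w m * w0 j))" for w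
        by (simp add: c'_def right_diff_distrib sum_subtractf sum_distrib_left sum_distrib_right mult_ac)
      have "(\<Sum>j<Suc m. c' j * v j) = 0"
      proof (rule sep)
        fix w assume w: "w \<in> V"
        have "(\<lambda>j. w j + - w m * w0 j) \<in> V" using w w0(1) by (intro add scale)
        then have "(\<lambda>j. w j - w m * w0 j) \<in> V'" by (simp add: V'_def w0(2))
        from c[OF this] show "(\<Sum>j<Suc m. c' j * w j) = 0" unfolding c'_eq .
      qed
      then show "(\<Sum>j<m. c j * (v j - v m * w0 j)) = 0" unfolding c'_eq .
    qed (auto simp: V'_def zero add scale)
    then obtain w where w: "w \<in> V" "w m = 0" "\<And>j. j < m \<Longrightarrow> w j = v j - v m * w0 j" by (auto simp: V'_def)
    have in_V: "(\<lambda>j. w j + v m * w0 j) \<in> V" using w w0 by (intro add scale)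
    have "\<forall>j<Suc m. w j + v m * w0 j = v j" using w w0 by (auto simp: less_Suc_eq)
    then show ?thesis by (rule bexI[OF _ in_V])
  qed
qed

lemma summable_norm_prod:
  fixes F G :: "nat \<Rightarrow> L2"
  assumes "summable (\<lambda>k. (norm (F k))\<^sup>2)" "summable (\<lambda>k. (norm (G k))\<^sup>2)"
  shows "summable (\<lambda>k. norm (F k) * norm (G k))"
proof (rule summable_comparison_test'[of "\<lambda>k. (norm (F k))\<^sup>2 + (norm (G k))\<^sup>2" 0])
  show "summable (\<lambda>k. (norm (F k))\<^sup>2 + (norm (G k))\<^sup>2)" using assms by (rule summable_add)
  fix n
  have "0 \<le> norm (F n) * norm (G n)" by simp
  show "norm (norm (F n) * norm (G n)) \<le> (norm (F n))\<^sup>2 + (norm (G n))\<^sup>2"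
    using sum_squares_bound[of "norm (F n)" "norm (G n)"] \<open>0 \<le> norm (F n) * norm (G n)\<close> unfolding real_norm_def mult.assoc abs_of_nonneg[OF \<open>0 \<le> norm (F n) * norm (G n)\<close>] by linarith
qed

lemma summable_bop_inner:
  assumes "bop S" "summable (\<lambda>k. (norm (F k))\<^sup>2)" "summable (\<lambda>k. (norm (G k))\<^sup>2)"
  shows "summable (\<lambda>k. l2_inner (S (F k)) (G k))"
proof -
  obtain C where C: "C \<ge> 0" "\<And>x. norm (S x) \<le> C * norm x" using bop_bound[OF assms(1)] by blast
  show ?thesis
  proof (rule summable_comparison_test'[of "\<lambda>k. C * (norm (F k) * norm (G k))" 0])
    show "summable (\<lambda>k. C * (norm (F k) * norm (G k)))"
      by (intro summable_mult summable_norm_prod assms)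
    show "norm (l2_inner (S (F n)) (G n)) \<le> C * (norm (F n) * norm (G n))" for n
      using order_trans[OF l2_Cauchy_Schwarz mult_right_mono[OF C(2)[of "F n"] norm_ge_zero[of "G n"]]]
      by (simp add: mult.assoc)
  qed
qed

lemma bop_zero: "bop (\<lambda>x. l2_zero)"
  unfolding bop_def l2_fold by (auto intro!: exI[of _ 0])

lemma bop_plus: "bop S \<Longrightarrow> bop T \<Longrightarrow> bop (\<lambda>x. l2_plus (S x) (T x))"
  unfolding bop_iff l2_fold by (auto intro: bounded_linear_add simp: l2_scale_add_right)

lemma bop_l2_scale: "bop T \<Longrightarrow> bop (\<lambda>x. l2_scale c (T x))"
  unfolding bop_iff
  by (auto intro: bounded_linear_compose[OF bounded_linear_l2_scale] simp: l2_scale_scale mult.commute)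

lemma ospan_bop:
  assumes "\<And>V. V \<in> U \<Longrightarrow> bop V" "T \<in> ospan U"
  shows "bop T"
  using assms(2) by induction (auto intro: assms bop_zero bop_plus bop_l2_scale)

text \<open>A basic weak* neighbourhood involves finitely many functionals, so separation produces
  an element of the span with exactly the same m values as \<open>T\<close>. In \<open>sep\<close>,
  the combination with coefficients \<open>c\<close> is again one normal functional.\<close>

lemma wstar_closure_ospanI:
  assumes U: "\<And>V. V \<in> U \<Longrightarrow> bop V" and T: "bop T"
    and sep: "\<And>m (F :: nat \<Rightarrow> nat \<Rightarrow> L2) G c.
      (\<And>j. j < m \<Longrightarrow> summable (\<lambda>k. (norm (F j k))\<^sup>2)) \<Longrightarrow> (\<And>j. j < m \<Longrightarrow> summable (\<lambda>k. (norm (G j k))\<^sup>2)) \<Longrightarrow>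
      (\<And>S. S \<in> U \<Longrightarrow> (\<Sum>j<m. c j * (\<Sum>k. l2_inner (S (F j k)) (G j k))) = 0) \<Longrightarrow>
      (\<Sum>j<m. c j * (\<Sum>k. l2_inner (T (F j k)) (G j k))) = 0"
  shows "T \<in> wstar_closure (ospan U)"
  unfolding wstar_closure_def
proof (intro CollectI conjI T allI impI)
  fix m :: nat and F G :: "nat \<Rightarrow> nat \<Rightarrow> L2" and e :: real
  assume A: "e > 0 \<and> (\<forall>j<m. summable (\<lambda>k. (l2_norm (F j k))\<^sup>2) \<and> summable (\<lambda>k. (l2_norm (G j k))\<^sup>2))"
  then have sF: "\<And>j. j < m \<Longrightarrow> summable (\<lambda>k. (norm (F j k))\<^sup>2)" and sG: "\<And>j. j < m \<Longrightarrow> summable (\<lambda>k. (norm (G j k))\<^sup>2)"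
    by (auto simp: norm_L2_def)
  define ps where "ps S j = (\<Sum>k. l2_inner (S (F j k)) (G j k))" for S j
  \<comment> \<open>Coordinates from m on are left free: there the series may diverge, so
    \<open>ps\<close> need not be additive.\<close>
  define V where "V = {w. \<exists>S\<in>ospan U. \<forall>j<m. w j = ps S j}"
  have sm: "summable (\<lambda>k. l2_inner (S (F j k)) (G j k))" if "S \<in> ospan U" "j < m" for S j
    by (rule summable_bop_inner[OF ospan_bop[OF U] sF sG]) (use that in auto)
  have "\<exists>w\<in>V. \<forall>j<m. w j = ps T j"
  proof (rule coordinate_separation)
    have "ps (\<lambda>x. l2_zero) j = 0" for j by (simp add: ps_def l2_fold)
    then show "(\<lambda>_. 0) \<in> V" unfolding V_def using ospan.zero[of U] by (intro CollectI bexI[of _ "\<lambda>x. l2_zero"]) auto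
  next
    fix u w assume "u \<in> V" "w \<in> V"
    then obtain S R where S: "S \<in> ospan U" "\<forall>j<m. u j = ps S j" and R: "R \<in> ospan U" "\<forall>j<m. w j = ps R j"
      by (auto simp: V_def)
    have "ps (\<lambda>x. l2_plus (S x) (R x)) j = ps S j + ps R j" if "j < m" for j
      unfolding ps_def l2_inner_plus_left by (rule suminf_add[symmetric]) (intro sm S R that)+
    then show "(\<lambda>j. u j + w j) \<in> V"
      unfolding V_def using S R by (intro CollectI bexI[OF _ ospan.add[OF S(1) R(1)]]) auto
  next
    fix c w assume "w \<in> V"
    then obtain R where R: "R \<in> ospan U" "\<forall>j<m. w j = ps R j" by (auto simp: V_def)
    have "ps (\<lambda>x. l2_scale c (R x)) j = c * ps R j" if "j < m" for j
      unfolding ps_def l2_inner_scale_left by (rule suminf_mult[OF sm[OF R(1) that]])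
    then show "(\<lambda>j. c * w j) \<in> V"
      unfolding V_def using R by (intro CollectI bexI[OF _ ospan.scale[OF R(1), of c]]) auto
  next
    fix c assume c: "\<And>w. w \<in> V \<Longrightarrow> (\<Sum>j<m. c j * w j) = 0"
    show "(\<Sum>j<m. c j * ps T j) = 0"
      unfolding ps_def
    proof (rule sep[OF sF sG])
      fix S assume "S \<in> U"
      then have "ps S \<in> V" unfolding V_def by (auto intro: ospan.base)
      from c[OF this] show "(\<Sum>j<m. c j * (\<Sum>k. l2_inner (S (F j k)) (G j k))) = 0" by (simp add: ps_def)
    qed auto
  qed
  then obtain S where "S \<in> ospan U" "\<forall>j<m. ps S j = ps T j" by (auto simp: V_def)
  then show "\<exists>S\<in>ospan U. \<forall>j<m. cmod ((\<Sum>k. l2_inner (T (F j k)) (G j k)) - (\<Sum>k. l2_inner (S (F j k)) (G j k))) < e"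
    using A by (intro bexI[of _ S]) (auto simp: ps_def)
qed

section \<open>Half-line supports and the two nests\<close>

definition supp_ge :: "real \<Rightarrow> L2 \<Rightarrow> bool" where
  "supp_ge a x \<longleftrightarrow> (AE t in lborel. t < a \<longrightarrow> rep x t = 0)"

definition supp_le :: "real \<Rightarrow> L2 \<Rightarrow> bool" where
  "supp_le a x \<longleftrightarrow> (AE t in lborel. a < t \<longrightarrow> rep x t = 0)"

text \<open>The two half-lines share only the point \<open>a\<close>, a null set.\<close>

lemma supp_orthogonal:
  assumes "supp_ge a x" "supp_le a y"
  shows "l2_inner x y = 0"
proof -
  have "AE t in lborel. rep x t * cnj (rep y t) = 0"
    using assms AE_lborel_singleton[of a] unfolding supp_ge_def supp_le_def
    by eventually_elim (metis complex_cnj_zero linorder_less_linear mult_eq_0_iff)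
  then show ?thesis
    unfolding l2_inner_def by (rule integral_eq_zero_AE)
qed

lemma supp_ge_zero: "supp_ge a 0"
  unfolding supp_ge_def using rep_zero by eventually_elim simp

lemma supp_ge_add:
  assumes "supp_ge a x" "supp_ge a y"
  shows "supp_ge a (x + y)"
  using assms rep_plus[of x y] unfolding supp_ge_def by eventually_elim auto

lemma supp_ge_scale:
  assumes "supp_ge a x"
  shows "supp_ge a (l2_scale c x)"
  using assms rep_l2_scale[of c x] unfolding supp_ge_def by eventually_elim auto

lemma supp_le_scale:
  assumes "supp_le a x"
  shows "supp_le a (l2_scale c x)"
  using assms rep_l2_scale[of c x] unfolding supp_le_def by eventually_elim auto

lemma supp_ge_M:
  assumes "supp_ge a x"
  shows "supp_ge a (M_op l x)"
  using assms rep_M_op[of l x] unfolding supp_ge_def by eventually_elim auto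

lemma supp_ge_D:
  assumes "supp_ge a x" "0 \<le> m"
  shows "supp_ge a (D_op m x)"
proof -
  have "AE t in lborel. - m + 1 * t < a \<longrightarrow> rep x (- m + 1 * t) = 0"
    using AE_borel_affine[of 1 "\<lambda>t. t < a \<longrightarrow> rep x t = 0" "- m"] assms(1) by (simp add: supp_ge_def)
  then show ?thesis
    unfolding supp_ge_def using rep_D_op[of m x] by eventually_elim (use assms(2) in auto)
qed

abbreviation p_gens :: "(L2 \<Rightarrow> L2) set" where
  "p_gens \<equiv> {M_op lam | lam. lam \<ge> 0} \<union> {D_op mu | mu. mu \<ge> 0}"

lemma oalg_invariant:
  assumes base: "\<And>V x. V \<in> U \<Longrightarrow> x \<in> N \<Longrightarrow> V x \<in> N"
    and N: "0 \<in> N" "\<And>x y. x \<in> N \<Longrightarrow> y \<in> N \<Longrightarrow> x + y \<in> N" "\<And>c x. x \<in> N \<Longrightarrow> l2_scale c x \<in> N"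
    and S: "S \<in> oalg U" and x: "x \<in> N"
  shows "S x \<in> N"
  using S x by (induction arbitrary: x) (auto simp: l2_fold N base)

text \<open>A single matrix coefficient is WOT continuous; the neighbourhood of radius |<T x, y>|
  around \<open>T\<close> already gives a contradiction.\<close>

lemma wot_closure_orthogonal:
  assumes T: "T \<in> wot_closure A" and A: "\<And>S. S \<in> A \<Longrightarrow> l2_inner (S x) y = 0"
  shows "l2_inner (T x) y = 0"
proof (rule ccontr)
  assume "l2_inner (T x) y \<noteq> 0"
  then have pos: "cmod (l2_inner (T x) y) > 0" by simp
  have "\<forall>(m::nat) F G e. e > 0 \<longrightarrow> (\<exists>S\<in>A. \<forall>j<m. cmod (l2_inner (T (F j)) (G j) - l2_inner (S (F j)) (G j)) < e)"
    using T by (simp add: wot_closure_def)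
  from this[THEN spec[of _ 1], THEN spec[of _ "\<lambda>_. x"], THEN spec[of _ "\<lambda>_. y"],
      THEN spec[of _ "cmod (l2_inner (T x) y)"], THEN mp, OF pos]
  obtain S where "S \<in> A" "cmod (l2_inner (T x) y - l2_inner (S x) y) < cmod (l2_inner (T x) y)" by auto
  then show False using A by simp
qed

text \<open>Vectors supported in [a, infinity) form a subspace invariant under all generators:
  modulations keep supports, and the translations move them to the right.\<close>

lemma wot_position_triangular:
  assumes "T \<in> wot_closure (oalg p_gens)" "supp_ge a x" "supp_le a y"
  shows "l2_inner (T x) y = 0"
proof (rule wot_closure_orthogonal[OF assms(1)])
  fix S assume "S \<in> oalg p_gens"
  then have "S x \<in> {x. supp_ge a x}"
    by (rule oalg_invariant[rotated -2]) (use assms(2) in \<open>auto intro: supp_ge_zero supp_ge_add supp_ge_scale supp_ge_M supp_ge_D\<close>)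
  then show "l2_inner (S x) y = 0" using supp_orthogonal assms(3) by auto
qed

text \<open>The same invariance after \<open>Fo\<close>, which exchanges the two kinds of
  generators: now the modulations push the support to the right.\<close>

lemma wot_momentum_triangular:
  assumes "T \<in> wot_closure (oalg p_gens)" "supp_ge a (Fo x)" "supp_le a (Fo y)"
  shows "l2_inner (T x) y = 0"
proof (rule wot_closure_orthogonal[OF assms(1)])
  have Fo0: "Fo 0 = 0" using Fo_scale[of 0 0] by simp
  fix S assume "S \<in> oalg p_gens"
  then have "S x \<in> {x. supp_ge a (Fo x)}"
    by (rule oalg_invariant[rotated -2])
      (use assms(2) in \<open>auto simp: Fo_add Fo_scale Fo0 Fo_M_op Fo_D_op intro: supp_ge_zero supp_ge_add supp_ge_scale supp_ge_M supp_ge_D\<close>)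
  then have "l2_inner (Fo (S x)) (Fo y) = 0" using supp_orthogonal assms(3) by auto
  then show "l2_inner (S x) y = 0" by (simp add: Fo_inner)
qed

text \<open>The functional q -> integral of q m kills every character of nonnegative frequency;
  classically such \<open>m\<close> are the boundary values of functions in the Hardy space H^1 of
  the upper half-plane. Further on, multiplying \<open>m\<close> by suitable symbols is shown to
  stay in this class, so that symbols can be treated one factor at a time.\<close>

definition annih :: "(real \<Rightarrow> complex) \<Rightarrow> bool" where
  "annih m \<longleftrightarrow> integrable lborel m \<and> (\<forall>l\<ge>0. (LINT x|lborel. cis (l * x) * m x) = 0)"

lemma annih_integral: "annih m \<Longrightarrow> (LINT x|lborel. m x) = 0"
  unfolding annih_def by (drule conjunct2, drule spec[of _ 0]) simp

lemma annih_cis: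
  assumes "annih m" "0 \<le> l"
  shows "annih (\<lambda>x. cis (l * x) * m x)"
  unfolding annih_def
proof (intro conjI allI impI)
  show "integrable lborel (\<lambda>x. cis (l * x) * m x)"
    using assms by (intro integrable_cis_mult) (auto simp: annih_def)
  fix l' :: real assume "0 \<le> l'"
  then have "(LINT x|lborel. cis ((l' + l) * x) * m x) = 0" using assms by (simp add: annih_def)
  then show "(LINT x|lborel. cis (l' * x) * (cis (l * x) * m x)) = 0"
    by (simp add: cis_mult distrib_right flip: mult.assoc)
qed

lemma annih_scale: "annih m \<Longrightarrow> annih (\<lambda>x. c * m x)"
  by (auto simp: annih_def mult.left_commute)

lemma annih_zero: "annih (\<lambda>x. 0)"
  by (simp add: annih_def)

lemma annih_add: "annih m \<Longrightarrow> annih n \<Longrightarrow> annih (\<lambda>x. m x + n x)"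
  by (auto simp: annih_def distrib_left integrable_cis_mult)

lemma annih_sum: "(\<And>i. i \<in> I \<Longrightarrow> annih (f i)) \<Longrightarrow> annih (\<lambda>x. \<Sum>i\<in>I. f i x)"
  by (induction I rule: infinite_finite_induct) (auto intro: annih_zero annih_add)

text \<open>Dominated convergence with majorant \<open>C * cmod (m x)\<close>, applied at each
  frequency.\<close>

lemma annih_limit:
  assumes m: "integrable lborel m" and an: "\<And>n. annih (\<lambda>x. q n x * m x)"
    and [measurable]: "\<And>n. q n \<in> borel_measurable borel" "p \<in> borel_measurable borel"
    and bound: "\<And>n x. cmod (q n x) \<le> C" and lim: "\<And>x. (\<lambda>n. q n x) \<longlonglongrightarrow> p x"
  shows "annih (\<lambda>x. p x * m x)"
proof -
  have [measurable]: "m \<in> borel_measurable borel" using m by auto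
  have dom: "integrable lborel (\<lambda>x. C * cmod (m x))" using m by simp
  have le: "norm (q n x * m x) \<le> C * cmod (m x)" for n x
    using mult_right_mono[OF bound[of n x], of "cmod (m x)"] by (simp add: norm_mult)
  have ple: "cmod (p x) \<le> C" for x
    by (rule LIMSEQ_le_const2[OF tendsto_norm[OF lim]]) (use bound in auto)
  show ?thesis
    unfolding annih_def
  proof (intro conjI allI impI)
    show "integrable lborel (\<lambda>x. p x * m x)"
      by (rule integrable_bmf_mult[OF bmfI[OF _ ple] m]) auto
    fix l :: real assume l: "0 \<le> l"
    have "(\<lambda>n. LINT x|lborel. cis (l * x) * (q n x * m x)) \<longlonglongrightarrow> (LINT x|lborel. cis (l * x) * (p x * m x))"
    proof (rule integral_dominated_convergence[OF _ _ dom])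
      show "AE x in lborel. (\<lambda>n. cis (l * x) * (q n x * m x)) \<longlonglongrightarrow> cis (l * x) * (p x * m x)"
        by (intro AE_I2 tendsto_intros lim)
      show "AE x in lborel. norm (cis (l * x) * (q n x * m x)) \<le> C * cmod (m x)" for n
        using le[of n] by (intro AE_I2) (simp add: norm_mult)
    qed auto
    moreover have "(LINT x|lborel. cis (l * x) * (q n x * m x)) = 0" for n
      using an[of n] l by (simp add: annih_def)
    ultimately show "(LINT x|lborel. cis (l * x) * (p x * m x)) = 0"
      by (simp add: LIMSEQ_const_iff)
  qed
qed

section \<open>One-sided spectra\<close>

text \<open>The average of cis(s x) over 0 <= s <= d. Multiplication by it is an average of
  \<open>M_op s\<close>; on the Fourier side multiplication by its conjugate is an average of
  \<open>D_op s\<close>, both with s >= 0.\<close>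

definition havg :: "real \<Rightarrow> real \<Rightarrow> complex" where
  "havg d x = ftr (indf 0 d) (- x) / complex_of_real d"

lemma havg_measurable [measurable]: "havg d \<in> borel_measurable borel"
  unfolding havg_def[abs_def] by measurable

lemma integral_cmod_indf: "a \<le> b \<Longrightarrow> (LINT x|lborel. cmod (indf a b x)) = b - a"
  by simp

lemma havg_bound:
  assumes "0 < d"
  shows "cmod (havg d x) \<le> 1"
proof -
  have "cmod (ftr (indf 0 d) (- x)) \<le> d"
    using ftr_bound[OF integrable_indf[of 0 d], of "-x"] integral_cmod_indf[of 0 d] assms by simp
  then show ?thesis using assms by (simp add: havg_def norm_divide)
qed

lemma bmf_havg: "0 < d \<Longrightarrow> bmf (\<lambda>x. havg d (x - u))"
  by (rule bmfI[of _ 1]) (auto simp: havg_bound)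

lemma bmf_havg0: "0 < d \<Longrightarrow> bmf (havg d)"
  using bmf_havg[of d 0] by simp

lemma cnj_ftr_indf: "cnj (ftr (indf a b) x) = ftr (indf a b) (- x)"
  unfolding ftr_def by (subst Bochner_Integration.integral_cnj[symmetric]) (simp add: cis_cnj)

text \<open>The average decays like 1 / x, so averaging modulations also acts as a cutoff in
  position that makes products with L2 functions integrable.\<close>

lemma havg_sqint:
  assumes "0 < d"
  shows "sqint (havg d)"
proof -
  have "sqint (ftr (indf 0 d))" using ind_P0[of 0 d] assms by (simp add: P0_def ftr_rep_ind)
  then have "sqint (\<lambda>x. 1 / complex_of_real d * cnj (ftr (indf 0 d) x))" by (intro sqint_scale sqint_cnj)
  then show ?thesis by (simp add: havg_def[abs_def] cnj_ftr_indf)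
qed

lemma norm_cis_minus_one: "cmod (cis t - 1) \<le> \<bar>t\<bar>"
proof -
  have "cmod (cis t - 1) = 2 * \<bar>sin (t / 2)\<bar>" unfolding cis_conv_exp by (rule dist_exp_i_1)
  also have "\<dots> \<le> 2 * \<bar>t / 2\<bar>" by (intro mult_left_mono abs_sin_x_le_abs_x) auto
  finally show ?thesis by simp
qed

lemma havg_near_one:
  assumes d: "0 < d"
  shows "cmod (havg d x - 1) \<le> d * \<bar>x\<bar>"
proof -
  have i: "integrable lborel (\<lambda>s. cis (- (- x * s)) * indf 0 d s)"
    by (intro integrable_cis_mult integrable_indf) auto
  have "(LINT s|lborel. indf 0 d s) = complex_of_real d"
    using d by (subst integral_complex_of_real) simp
  then have "ftr (indf 0 d) (- x) - complex_of_real d = (LINT s|lborel. cis (- (- x * s)) * indf 0 d s - indf 0 d s)"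
    unfolding ftr_def by (subst Bochner_Integration.integral_diff[OF i integrable_indf]) simp
  also have "cmod \<dots> \<le> (LINT s|lborel. d * \<bar>x\<bar> * cmod (indf 0 d s))"
  proof (rule order_trans[OF integral_norm_bound integral_mono])
    show "integrable lborel (\<lambda>s. cmod (cis (- (- x * s)) * indf 0 d s - indf 0 d s))"
      by (intro integrable_norm Bochner_Integration.integrable_diff i integrable_indf)
    show "integrable lborel (\<lambda>s. d * \<bar>x\<bar> * cmod (indf 0 d s))"
      by (intro integrable_mult_right integrable_norm integrable_indf)
    fix s
    have "cmod (cis (x * s) - 1) \<le> d * \<bar>x\<bar>" if "0 \<le> s" "s \<le> d"
      using norm_cis_minus_one[of "x * s"] mult_left_mono[OF that(2), of "\<bar>x\<bar>"] that(1)
      by (simp add: abs_mult mult.commute)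
    then show "cmod (cis (- (- x * s)) * indf 0 d s - indf 0 d s) \<le> d * \<bar>x\<bar> * cmod (indf 0 d s)"
      by (auto simp: indicator_def)
  qed
  also have "\<dots> = d * \<bar>x\<bar> * d" using integral_cmod_indf[of 0 d] d by simp
  finally have le: "cmod (ftr (indf 0 d) (- x) - complex_of_real d) \<le> d * \<bar>x\<bar> * d" .
  have "havg d x - 1 = (ftr (indf 0 d) (- x) - complex_of_real d) / complex_of_real d"
    using d by (simp add: havg_def diff_divide_distrib)
  then have "cmod (havg d x - 1) = cmod (ftr (indf 0 d) (- x) - complex_of_real d) / d"
    using d by (simp add: norm_divide)
  also have "\<dots> \<le> d * \<bar>x\<bar> * d / d" using le d by (intro divide_right_mono) auto
  finally show ?thesis using d by simp
qed

abbreviation dn :: "nat \<Rightarrow> real" where "dn n \<equiv> inverse (real (Suc n))"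

lemma havg_tendsto: "(\<lambda>n. havg (dn n) x) \<longlonglongrightarrow> 1"
proof (rule LIM_zero_cancel, rule Lim_null_comparison)
  show "\<forall>\<^sub>F n in sequentially. norm (havg (dn n) x - 1) \<le> dn n * \<bar>x\<bar>"
    by (intro always_eventually allI havg_near_one) simp
  show "(\<lambda>n. dn n * \<bar>x\<bar>) \<longlonglongrightarrow> 0"
    using tendsto_mult[OF LIMSEQ_inverse_real_of_nat tendsto_const[of "\<bar>x\<bar>"]] by simp
qed

lemma integral_reflect: "(LINT x|lborel. f (u - x)) = (LINT x|lborel. f x)" for f :: "real \<Rightarrow> complex"
  by (subst lborel_integral_real_affine[of "-1" f u]) simp_all

text \<open>In essence the average of \<open>annih_cis\<close> over the frequencies in [0, d], with
  a phase from the shift \<open>u\<close>. The multiplication formula replaces this average by an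
  integral over [0, d] of the transform of the reflected density, which vanishes there.\<close>

lemma annih_havg:
  assumes m: "annih m" and d: "0 < d"
  shows "annih (\<lambda>x. havg d (x - u) * m x)"
  unfolding annih_def
proof (intro conjI allI impI)
  have mi: "integrable lborel m" using m by (simp add: annih_def)
  then have [measurable]: "m \<in> borel_measurable borel" by auto
  show "integrable lborel (\<lambda>x. havg d (x - u) * m x)"
    by (rule integrable_bmf_mult[OF bmf_havg[OF d] mi])
  fix l :: real assume l: "0 \<le> l"
  \<comment> \<open>Reflecting at u / 2 turns the frequency -s of \<open>ftr\<close> into +s, and
    turns \<open>havg d (x - u)\<close> into the transform of the interval at x, divided by
    d.\<close>
  define g where "g x = cis (l * (u - x)) * m (u - x)" for x
  have "integrable lborel (\<lambda>x. m (u + (-1) * x))" by (rule lborel_integrable_real_affine[OF mi]) simp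
  then have gi: "integrable lborel g" unfolding g_def by (intro integrable_cis_mult) auto
  have "ftr g s = 0" if "0 \<le> s" for s
  proof -
    have "ftr g s = (LINT x|lborel. cis (- (s * x)) * g x)" by (simp add: ftr_def)
    also have "\<dots> = (LINT x|lborel. cis (- (s * (u - x))) * g (u - x))"
      by (rule integral_reflect[symmetric])
    also have "\<dots> = (LINT x|lborel. cis (- (s * u)) * (cis ((s + l) * x) * m x))"
    proof (rule Bochner_Integration.integral_cong[OF refl])
      show "cis (- (s * (u - x))) * g (u - x) = cis (- (s * u)) * (cis ((s + l) * x) * m x)" for x
      proof -
        have "cis (- (s * (u - x))) * cis (l * x) = cis (- (s * u)) * cis ((s + l) * x)"
          unfolding cis_mult by (simp add: algebra_simps)
        then show ?thesis by (simp add: g_def flip: mult.assoc)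
      qed
    qed
    also have "\<dots> = cis (- (s * u)) * (LINT x|lborel. cis ((s + l) * x) * m x)"
      by (rule integral_mult_right_zero)
    also have "\<dots> = 0" using m l that by (simp add: annih_def)
    finally show ?thesis .
  qed
  then have z: "indf 0 d s * ftr g s = 0" for s by (simp add: indicator_def)
  have "(LINT x|lborel. cis (l * x) * (havg d (x - u) * m x))
      = (LINT x|lborel. cis (l * (u - x)) * (havg d (u - x - u) * m (u - x)))"
    by (rule integral_reflect[symmetric])
  also have "\<dots> = (LINT x|lborel. 1 / complex_of_real d * (g x * ftr (indf 0 d) x))"
    by (simp add: g_def havg_def mult_ac)
  also have "\<dots> = 1 / complex_of_real d * (LINT x|lborel. g x * ftr (indf 0 d) x)"
    by (rule integral_mult_right_zero)
  also have "\<dots> = 0"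
    unfolding integral_mult_ftr[OF integrable_indf gi] by (simp add: z)
  finally show "(LINT x|lborel. cis (l * x) * (havg d (x - u) * m x)) = 0" .
qed

section \<open>Strong continuity of translations\<close>

lemma D_op_Fo: "D_op x f = Foi (mulop (\<lambda>t. cis (- (x * t))) (Fo f))"
  using arg_cong[OF Fo_D_op[of x f], of Foi] by (simp add: M_op_eq)

lemma tendsto_bop: "bop T \<Longrightarrow> f \<longlonglongrightarrow> x \<Longrightarrow> (\<lambda>n. T (f n)) \<longlonglongrightarrow> T x"
  by (rule bounded_linear.tendsto[OF bop_bounded_linear])

text \<open>On the Fourier side translations are multiplications by phases, which converge boundedly
  and pointwise.\<close>

lemma D_op_continuous: "continuous_on UNIV (\<lambda>x. D_op x f)"
  unfolding continuous_on_sequentially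
proof (intro allI ballI impI, elim conjE)
  fix X a assume X: "X \<longlonglongrightarrow> (a :: real)"
  have "(\<lambda>n. mulop (\<lambda>t. cis (- (X n * t))) (Fo f)) \<longlonglongrightarrow> mulop (\<lambda>t. cis (- (a * t))) (Fo f)"
    by (rule mulop_tendsto[where C = 1]) (auto intro!: tendsto_intros X)
  then show "((\<lambda>x. D_op x f) \<circ> X) \<longlonglongrightarrow> D_op a f"
    unfolding o_def D_op_Fo by (rule tendsto_bop[OF bop_Foi])
qed

lemma continuous_on_D_op [continuous_intros]:
  "continuous_on S g \<Longrightarrow> continuous_on S (\<lambda>x. D_op (g x) f)"
  by (rule continuous_on_compose2[OF D_op_continuous]) auto

lemma D_op_norm: "norm (D_op m x) = norm x"
  by (simp add: D_op_eq affop_norm)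

lemma D_op_D_op: "D_op a (D_op b x) = D_op (a + b) x"
  by (simp add: D_op_eq affop_affop add.commute)

text \<open>Half-open cells are disjoint, so for N > 0 exactly one of them contains a given
  frequency.\<close>

definition cell :: "nat \<Rightarrow> int \<Rightarrow> real \<Rightarrow> complex" where
  "cell N i \<xi> = complex_of_real (indicator {of_int i / real N..<(of_int i + 1) / real N} \<xi>)"

lemma cell_floor: "N > 0 \<Longrightarrow> cell N i \<xi> = (if \<lfloor>real N * \<xi>\<rfloor> = i then 1 else 0)"
  by (auto simp: cell_def indicator_def floor_eq_iff field_simps)

lemma bmf_cell: "bmf (cell N i)"
  unfolding cell_def by (rule bmfI[of _ 1]) (auto simp: indicator_def)

lemma mulop_scale_fun: "bmf q \<Longrightarrow> mulop (\<lambda>t. c * q t) x = l2_scale c (mulop q x)"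
  by (simp add: l2_scale_mulop mulop_mulop bmf_const)

lemma mulop_add_fun:
  assumes "bmf p" "bmf q"
  shows "mulop (\<lambda>t. p t + q t) x = mulop p x + mulop q x"
proof -
  have "AE t in lborel. p t * rep x t + q t * rep x t = rep (mulop p x + mulop q x) t"
    using rep_mulop[OF assms(1), of x] rep_mulop[OF assms(2), of x] rep_plus[of "mulop p x" "mulop q x"]
    by eventually_elim simp
  then show ?thesis unfolding mulop_def[of "\<lambda>t. p t + q t"] by (intro mk_eqI) (simp add: distrib_right)
qed

lemma bmf_add: "bmf p \<Longrightarrow> bmf q \<Longrightarrow> bmf (\<lambda>t. p t + q t)"
proof -
  assume p: "bmf p" and q: "bmf q"
  then obtain C D where "\<And>t. cmod (p t) \<le> C" "\<And>t. cmod (q t) \<le> D" by (auto simp: bmf_def)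
  then have "cmod (p t + q t) \<le> C + D" for t by (intro order_trans[OF norm_triangle_ineq] add_mono)
  then show ?thesis using p q by (intro bmfI[of _ "C + D"]) (auto simp: bmf_def)
qed

lemma mulop_sum_fun:
  assumes "finite I" "\<And>i. i \<in> I \<Longrightarrow> bmf (q i)"
  shows "mulop (\<lambda>t. \<Sum>i\<in>I. c i * q i t) x = (\<Sum>i\<in>I. l2_scale (c i) (mulop (q i) x)) \<and> bmf (\<lambda>t. \<Sum>i\<in>I. c i * q i t)"
  using assms
proof (induction I rule: finite_induct)
  case empty
  have "mulop (\<lambda>t. 0) x = 0" using l2_scale_0[of x] by (simp add: l2_scale_mulop)
  then show ?case using bmf_const[of 0] by simp
next
  case (insert i I)
  then have b: "bmf (\<lambda>t. c i * q i t)" "bmf (\<lambda>t. \<Sum>i\<in>I. c i * q i t)"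
    by (auto intro!: bmf_mult bmf_const)
  then show ?case using insert by (simp add: mulop_add_fun mulop_scale_fun bmf_add)
qed

text \<open>The character cis(- x xi) sampled at the left end of each cell. With about N^2 cells of
  length 1 / N on either side the sampled range grows like N, so the cutoff disappears in the
  limit.\<close>

definition atr :: "nat \<Rightarrow> real \<Rightarrow> real \<Rightarrow> complex" where
  "atr N x \<xi> = (\<Sum>i\<in>{- (int N)\<^sup>2..(int N)\<^sup>2}. cis (- (x * (of_int i / real N))) * cell N i \<xi>)"

lemma atr_eq:
  assumes "N > 0"
  shows "atr N x \<xi> = (if \<bar>\<lfloor>real N * \<xi>\<rfloor>\<bar> \<le> (int N)\<^sup>2 then cis (- (x * (of_int \<lfloor>real N * \<xi>\<rfloor> / real N))) else 0)"
proof -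
  have "atr N x \<xi> = (\<Sum>i\<in>{- (int N)\<^sup>2..(int N)\<^sup>2}. if \<lfloor>real N * \<xi>\<rfloor> = i then cis (- (x * (of_int i / real N))) else 0)"
    unfolding atr_def cell_floor[OF assms] by (intro sum.cong) auto
  then show ?thesis by (auto simp: sum.delta abs_le_iff)
qed

lemma atr_bound: "N > 0 \<Longrightarrow> cmod (atr N x \<xi>) \<le> 1"
  by (simp add: atr_eq)

lemma atr_measurable [measurable]: "atr N x \<in> borel_measurable borel"
  unfolding atr_def[abs_def] cell_def by measurable

lemma atr_tendsto: "(\<lambda>n. atr (Suc n) x \<xi>) \<longlonglongrightarrow> cis (- (x * \<xi>))"
proof -
  let ?f = "\<lambda>n. of_int \<lfloor>real (Suc n) * \<xi>\<rfloor> / real (Suc n)"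
  have "(\<lambda>n. ?f n - \<xi>) \<longlonglongrightarrow> 0"
  proof (rule Lim_null_comparison)
    have "norm (?f n - \<xi>) \<le> inverse (real (Suc n))" for n
    proof -
      have "?f n - \<xi> = (of_int \<lfloor>real (Suc n) * \<xi>\<rfloor> - real (Suc n) * \<xi>) / real (Suc n)"
        by (simp add: diff_divide_distrib del: of_nat_Suc)
      moreover have "\<bar>of_int \<lfloor>real (Suc n) * \<xi>\<rfloor> - real (Suc n) * \<xi>\<bar> \<le> 1" by linarith
      ultimately have "norm (?f n - \<xi>) \<le> 1 / real (Suc n)"
        unfolding real_norm_def by (simp only: abs_divide abs_of_nat) (intro divide_right_mono, auto)
      then show ?thesis by (simp only: inverse_eq_divide)
    qed
    then show "\<forall>\<^sub>F n in sequentially. norm (?f n - \<xi>) \<le> inverse (real (Suc n))" by simp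
  qed (rule LIMSEQ_inverse_real_of_nat)
  then have f: "?f \<longlonglongrightarrow> \<xi>" by (rule LIM_zero_cancel)
  then have "(\<lambda>n. cis (- (x * ?f n))) \<longlonglongrightarrow> cis (- (x * \<xi>))" by (intro tendsto_intros)
  moreover have "\<forall>\<^sub>F n in sequentially. cis (- (x * ?f n)) = atr (Suc n) x \<xi>"
  proof -
    obtain K :: nat where K: "\<bar>\<xi>\<bar> + 1 \<le> real K" using real_arch_simple by blast
    have "cis (- (x * ?f n)) = atr (Suc n) x \<xi>" if "n \<ge> K" for n
    proof -
      let ?N = "real (Suc n)"
      have N: "\<bar>\<xi>\<bar> + 1 \<le> ?N" "1 \<le> ?N" using K that by auto
      have "\<bar>of_int \<lfloor>?N * \<xi>\<rfloor>\<bar> \<le> \<bar>?N * \<xi>\<bar> + 1" by linarith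
      also have "\<dots> \<le> ?N * \<bar>\<xi>\<bar> + ?N" using N by (simp add: abs_mult)
      also have "\<dots> = ?N * (\<bar>\<xi>\<bar> + 1)" by (simp add: distrib_left)
      also have "\<dots> \<le> ?N * ?N" using N by (intro mult_left_mono) auto
      finally have "real_of_int \<bar>\<lfloor>?N * \<xi>\<rfloor>\<bar> \<le> real_of_int ((int (Suc n))\<^sup>2)" by (simp add: power2_eq_square)
      then have "\<bar>\<lfloor>?N * \<xi>\<rfloor>\<bar> \<le> (int (Suc n))\<^sup>2" by (simp only: of_int_le_iff)
      then show ?thesis by (simp add: atr_eq del: of_nat_Suc)
    qed
    then show ?thesis using eventually_sequentially by blast
  qed
  ultimately show ?thesis by (rule Lim_transform_eventually)
qed

text \<open>Momentum is cut into cells of length \<open>1/N\<close>; replacing the translation group by a scalar on each cell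
  turns the matrix coefficient into a trigonometric polynomial.\<close>
lemma annih_matrix_coeff:
  assumes T: "bop T" and tri: "\<And>a x y. supp_ge a (Fo x) \<Longrightarrow> supp_le a (Fo y) \<Longrightarrow> l2_inner (T x) y = 0"
    and m: "annih m"
  shows "annih (\<lambda>x. l2_inner (T (D_op x f)) (D_op x g) * m x)"
proof -
  let ?I = "\<lambda>N::nat. {- (int N)\<^sup>2..(int N)\<^sup>2}"
  define A where "A N x f = Foi (mulop (atr N x) (Fo f))" for N x f
  define pc where "pc N i f = Foi (mulop (cell N i) (Fo f))" for N i f
  obtain C where C: "C \<ge> 0" "\<And>x. norm (T x) \<le> C * norm x" using bop_bound[OF T] by blast
  have lin: "linear T" "linear Foi" by (auto intro: bounded_linear.linear bop_bounded_linear T bop_Foi)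
  have A_sum: "A N x f = (\<Sum>i\<in>?I N. l2_scale (cis (- (x * (of_int i / real N)))) (pc N i f))" for N x f
    unfolding A_def pc_def atr_def
    using mulop_sum_fun[of "?I N" "cell N"]
    by (simp add: bmf_cell linear_sum[OF lin(2)] bop_scale[OF bop_Foi])
  have A_lim: "(\<lambda>n. A (Suc n) x f) \<longlonglongrightarrow> D_op x f" for x f
    unfolding A_def D_op_Fo
    by (intro tendsto_bop[OF bop_Foi] mulop_tendsto[where C = 1] atr_tendsto) (auto simp: atr_bound)
  have A_norm: "norm (A (Suc n) x f) \<le> norm f" for n x f
  proof -
    have "norm (A (Suc n) x f) = norm (mulop (atr (Suc n) x) (Fo f))"
      unfolding A_def by (rule isometry_norm[OF Foi_inner])
    also have "\<dots> \<le> 1 * norm (Fo f)" by (rule norm_mulop_le) (auto simp: atr_bound)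
    finally show ?thesis by (simp add: isometry_norm[OF Fo_inner])
  qed
  \<comment> \<open>For integers j < i means j + 1 <= i, so cell j ends no later than cell i begins,
    and the left end of cell i separates the two supports.\<close>
  have pc_tri: "l2_inner (T (pc N i f)) (pc N j g) = 0" if "j < i" "N > 0" for N i j
  proof (rule tri[of "of_int i / real N"])
    show "supp_ge (of_int i / real N) (Fo (pc N i f))"
      unfolding supp_ge_def pc_def Fo_Foi using rep_mulop[OF bmf_cell[of N i], of "Fo f"]
      by eventually_elim (auto simp: cell_def indicator_def)
    have le: "(of_int j + 1) / real N \<le> of_int i / real N" using that by (simp add: divide_right_mono)
    show "supp_le (of_int i / real N) (Fo (pc N j g))"
      unfolding supp_le_def pc_def Fo_Foi using rep_mulop[OF bmf_cell[of N j], of "Fo g"]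
      by eventually_elim (use le in \<open>auto simp: cell_def indicator_def\<close>)
  qed
  define b where "b N x = l2_inner (T (A N x f)) (A N x g)" for N x
  \<comment> \<open>Input cell i and output cell j contribute the frequency (j - i) / N; by
    \<open>pc_tri\<close> the negative ones have coefficient 0.\<close>
  have b_eq: "b N x = (\<Sum>i\<in>?I N. \<Sum>j\<in>?I N.
      cis ((of_int j - of_int i) / real N * x) * l2_inner (T (pc N i f)) (pc N j g))" for N x
  proof -
    have "b N x = (\<Sum>j\<in>?I N. \<Sum>i\<in>?I N.
        cnj (cis (- (x * (of_int j / real N)))) * (cis (- (x * (of_int i / real N))) * l2_inner (T (pc N i f)) (pc N j g)))"
      unfolding b_def A_sum linear_sum[OF lin(1)] l2_inner_sum_left l2_inner_sum_right
      by (simp add: bop_scale[OF T] l2_inner_scale_left l2_inner_scale_right)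
    also have "\<dots> = (\<Sum>i\<in>?I N. \<Sum>j\<in>?I N.
        cis (- (x * (of_int i / real N))) * (cnj (cis (- (x * (of_int j / real N)))) * l2_inner (T (pc N i f)) (pc N j g)))"
      by (subst sum.swap) (intro sum.cong refl mult.left_commute)
    also have "\<dots> = (\<Sum>i\<in>?I N. \<Sum>j\<in>?I N.
      cis ((of_int j - of_int i) / real N * x) * l2_inner (T (pc N i f)) (pc N j g))"
    proof (intro sum.cong refl)
      fix i j
      have "cis (- (x * (of_int i / real N))) * cnj (cis (- (x * (of_int j / real N)))) = cis ((of_int j - of_int i) / real N * x)"
        unfolding cis_cnj cis_mult by (rule arg_cong[of _ _ cis]) (simp add: diff_divide_distrib algebra_simps)
      then show "cis (- (x * (of_int i / real N))) * (cnj (cis (- (x * (of_int j / real N)))) * l2_inner (T (pc N i f)) (pc N j g))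
          = cis ((of_int j - of_int i) / real N * x) * l2_inner (T (pc N i f)) (pc N j g)"
        by (simp only: mult.assoc[symmetric])
    qed
    finally show ?thesis .
  qed
  have b_measurable: "b N \<in> borel_measurable borel" for N
    unfolding b_eq[abs_def] by measurable
  have b_annih: "annih (\<lambda>x. b (Suc n) x * m x)" for n
  proof -
    have "annih (\<lambda>x. cis ((of_int j - of_int i) / real (Suc n) * x) * l2_inner (T (pc (Suc n) i f)) (pc (Suc n) j g) * m x)" for i j
    proof (cases "j < i")
      case True
      then show ?thesis using pc_tri[of j i "Suc n"] by (simp add: annih_zero del: of_nat_Suc)
    next
      case False
      then have "annih (\<lambda>x. l2_inner (T (pc (Suc n) i f)) (pc (Suc n) j g) * (cis ((of_int j - of_int i) / real (Suc n) * x) * m x))"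
        by (intro annih_scale annih_cis[OF m]) (simp del: of_nat_Suc)
      then show ?thesis by (simp only: mult_ac)
    qed
    then show ?thesis unfolding b_eq sum_distrib_right by (intro annih_sum)
  qed
  have cont: "continuous_on UNIV (\<lambda>x. l2_inner (T (D_op x f)) (D_op x g))"
    by (intro continuous_intros continuous_on_bop[OF T])
  show ?thesis
  proof (rule annih_limit[of m "\<lambda>n. b (Suc n)" _ "C * norm f * norm g"])
    show "integrable lborel m" using m by (simp add: annih_def)
    show "cmod (b (Suc n) x) \<le> C * norm f * norm g" for n x
    proof -
      have "cmod (b (Suc n) x) \<le> norm (T (A (Suc n) x f)) * norm (A (Suc n) x g)"
        unfolding b_def by (rule l2_Cauchy_Schwarz)
      also have "\<dots> \<le> (C * norm f) * norm g"
        by (intro mult_mono order_trans[OF C(2)] mult_left_mono A_norm) (use C in auto)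
      finally show ?thesis .
    qed
    show "(\<lambda>n. b (Suc n) x) \<longlonglongrightarrow> l2_inner (T (D_op x f)) (D_op x g)" for x
      unfolding b_def by (intro tendsto_intros tendsto_bop[OF T] A_lim)
  qed (auto simp: b_annih b_measurable intro: borel_measurable_continuous_onI cont)
qed

section \<open>Smoothing operators\<close>

text \<open>Replacing both functions by their moduli changes no norm and turns Cauchy-Schwarz for
  \<open>l2_inner\<close> into a bound for the integral of the moduli.\<close>

lemma integral_cmod_mult_le:
  assumes f: "sqint f" and g: "sqint g"
  shows "(LINT t|lborel. cmod (f t) * cmod (g t)) \<le> norm (mk f) * norm (mk g)"
proof -
  have a: "sqint (\<lambda>t. complex_of_real (cmod (h t)))" "norm (mk (\<lambda>t. complex_of_real (cmod (h t)))) = norm (mk h)" if "sqint h" for h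
  proof -
    show s: "sqint (\<lambda>t. complex_of_real (cmod (h t)))" using that by (auto simp: sqint_def)
    have "(norm (mk (\<lambda>t. complex_of_real (cmod (h t)))))\<^sup>2 = (norm (mk h))\<^sup>2"
      using norm_mk[OF s] norm_mk[OF that] by simp
    then show "norm (mk (\<lambda>t. complex_of_real (cmod (h t)))) = norm (mk h)" by (simp add: power2_eq_iff_nonneg)
  qed
  have "l2_inner (mk (\<lambda>t. complex_of_real (cmod (f t)))) (mk (\<lambda>t. complex_of_real (cmod (g t))))
      = complex_of_real (LINT t|lborel. cmod (f t) * cmod (g t))"
    unfolding l2_inner_mk[OF a(1)[OF f] a(1)[OF g]]
    by (subst integral_complex_of_real[symmetric]) simp
  then have "\<bar>LINT t|lborel. cmod (f t) * cmod (g t)\<bar> \<le> norm (mk f) * norm (mk g)"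
    using l2_Cauchy_Schwarz[of "mk (\<lambda>t. complex_of_real (cmod (f t)))" "mk (\<lambda>t. complex_of_real (cmod (g t)))"]
    by (simp add: a f g)
  then show ?thesis by simp
qed

lemma integral_cmod_rep_le: "(LINT t|lborel. cmod (rep x t * cnj (rep y t))) \<le> norm x * norm y"
  using integral_cmod_mult_le[of "rep x" "rep y"] by (simp add: norm_mult)

text \<open>On multiplication operators a normal functional is integration against an L1 density: by
  Cauchy-Schwarz the products of \<open>rep (F k)\<close> with the conjugates of
  \<open>rep (G k)\<close> are absolutely summable in L1, and \<open>m\<close> is their sum.\<close>

lemma normal_functional_density:
  assumes F: "summable (\<lambda>k. (norm (F k))\<^sup>2)" and G: "summable (\<lambda>k. (norm (G k))\<^sup>2)"
  obtains m where "integrable lborel m"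
    "\<And>q. bmf q \<Longrightarrow> (\<Sum>k. LINT x|lborel. q x * (rep (F k) x * cnj (rep (G k) x))) = (LINT x|lborel. q x * m x)"
proof -
  let ?f = "\<lambda>k x. rep (F k) x * cnj (rep (G k) x)"
  have int: "integrable lborel (?f k)" for k by (rule l2_inner_integrable)
  have sm: "summable (\<lambda>k. LINT x|lborel. cmod (?f k x))"
  proof (rule summable_comparison_test'[OF summable_norm_prod[OF F G], of 0])
    show "norm (LINT x|lborel. cmod (?f n x)) \<le> norm (F n) * norm (G n)" for n
      using integral_cmod_rep_le[of "F n" "G n"] by simp
  qed
  have ae: "AE x in lborel. summable (\<lambda>k. cmod (?f k x))"
    by (rule AE_summable_of_integrals[OF int sm])
  define m where "m x = (\<Sum>k. ?f k x)" for x
  have [measurable]: "m \<in> borel_measurable borel" unfolding m_def by measurable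
  have mi: "integrable lborel m"
    unfolding m_def by (rule integrable_suminf[OF int]) (use ae sm in auto)
  have "(\<Sum>k. LINT x|lborel. q x * ?f k x) = (LINT x|lborel. q x * m x)" if q: "bmf q" for q
  proof -
    have [measurable]: "q \<in> borel_measurable borel" using q by (simp add: bmf_def)
    obtain C where C: "\<And>t. cmod (q t) \<le> C" using q by (auto simp: bmf_def)
    have qle: "cmod (q x * ?f k x) \<le> C * cmod (?f k x)" for x k
      unfolding norm_mult[of "q x"] by (rule mult_right_mono[OF C]) simp
    have qint: "integrable lborel (\<lambda>x. q x * ?f k x)" for k
      by (rule integrable_bmf_mult[OF q int])
    have qae: "AE x in lborel. summable (\<lambda>k. cmod (q x * ?f k x))"
      using ae
    proof eventually_elim
      case (elim x)
      show ?case
        by (rule summable_comparison_test'[OF summable_mult[OF elim, of C], of 0]) (use qle in simp)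
    qed
    have qsm: "summable (\<lambda>k. LINT x|lborel. cmod (q x * ?f k x))"
    proof (rule summable_comparison_test'[OF summable_mult[OF sm, of C], of 0])
      fix n
      have "(LINT x|lborel. cmod (q x * ?f n x)) \<le> (LINT x|lborel. C * cmod (?f n x))"
        using qint[of n] int[of n] qle by (intro integral_mono integrable_norm integrable_mult_right) auto
      then show "norm (LINT x|lborel. cmod (q x * ?f n x)) \<le> C * (LINT x|lborel. cmod (?f n x))"
        by simp
    qed
    have "(\<Sum>k. LINT x|lborel. q x * ?f k x) = (LINT x|lborel. (\<Sum>k. q x * ?f k x))"
      by (rule integral_suminf[OF qint qae qsm, symmetric])
    also have "\<dots> = (LINT x|lborel. q x * m x)"
    proof (rule integral_cong_AE)
      show "AE x in lborel. (\<Sum>k. q x * ?f k x) = q x * m x"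
        using ae by eventually_elim (simp add: m_def suminf_mult summable_norm_cancel)
    qed measurable
    finally show ?thesis .
  qed
  then show ?thesis using that mi by blast
qed

text \<open>A Fourier multiplier is convolution with a vector \<open>p\<close> whose transform is
  the symbol, stated weakly as an average of translates of \<open>p\<close> weighted by
  \<open>x\<close>. The factor \<open>foc\<close> appears in the hypothesis because
  \<open>Fo\<close> is \<open>foc\<close> times the integral transform.\<close>

lemma fourier_multiplier_integral:
  assumes q: "bmf q" and p: "AE \<xi> in lborel. rep (Fo p) \<xi> = complex_of_real foc * q \<xi>"
    and x: "integrable lborel (rep x)"
  shows "l2_inner (Foi (mulop q (Fo x))) w = (LINT y|lborel. rep x y * l2_inner (D_op y p) w)"
proof -
  have [measurable]: "q \<in> borel_measurable borel" using q by (simp add: bmf_def)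
  define g where "g \<xi> = complex_of_real foc * q \<xi> * cnj (rep (Fo w) \<xi>)" for \<xi>
  have [measurable]: "g \<in> borel_measurable borel" unfolding g_def by measurable
  have "integrable lborel (\<lambda>\<xi>. rep (Fo p) \<xi> * cnj (rep (Fo w) \<xi>)) \<longleftrightarrow> integrable lborel g"
    by (intro integrable_cong_AE) (use p in \<open>auto simp: g_def elim!: eventually_mono\<close>)
  then have g: "integrable lborel g" using l2_inner_integrable by simp
  have ftr_g: "ftr g y = l2_inner (D_op y p) w" for y
  proof -
    have "l2_inner (D_op y p) w = l2_inner (M_op (- y) (Fo p)) (Fo w)"
      using Fo_inner[of "D_op y p" w] by (simp add: Fo_D_op)
    also have "\<dots> = (LINT \<xi>|lborel. (cis (- y * \<xi>) * (complex_of_real foc * q \<xi>)) * cnj (rep (Fo w) \<xi>))"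
    proof (rule l2_inner_eqI)
      show "AE \<xi> in lborel. rep (M_op (- y) (Fo p)) \<xi> = cis (- y * \<xi>) * (complex_of_real foc * q \<xi>)"
        using rep_M_op[of "- y" "Fo p"] p by eventually_elim simp
    qed auto
    finally show ?thesis by (simp add: ftr_def g_def mult.assoc)
  qed
  have "l2_inner (Foi (mulop q (Fo x))) w = (LINT \<xi>|lborel. q \<xi> * (rep (Fo x) \<xi> * cnj (rep (Fo w) \<xi>)))"
    unfolding Foi_Fo_inner by (rule l2_inner_mulop[OF q])
  also have "\<dots> = (LINT \<xi>|lborel. g \<xi> * ftr (rep x) \<xi>)"
    by (rule integral_cong_AE) (use rep_Fo[OF x] in \<open>auto simp: g_def elim!: eventually_mono\<close>)
  also have "\<dots> = (LINT y|lborel. rep x y * l2_inner (D_op y p) w)"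
    unfolding integral_mult_ftr[OF x g] ftr_g ..
  finally show ?thesis .
qed

text \<open>Each smoothing multiplier is an average of translates, so \<open>T\<close> is tested
  only on translates of two fixed vectors; these matrix coefficients form the integral
  kernel.\<close>

lemma multiplier_sandwich_integral:
  assumes T: "bop T"
    and p: "bmf p" "AE \<xi> in lborel. rep (Fo f0) \<xi> = complex_of_real foc * p \<xi>"
    and q: "bmf q" "AE \<xi> in lborel. rep (Fo g0) \<xi> = complex_of_real foc * q \<xi>"
    and f: "integrable lborel (rep f)" and g: "integrable lborel (rep g)"
  shows "l2_inner (T (Foi (mulop p (Fo f)))) (Foi (mulop q (Fo g)))
    = (LINT y|lborel. LINT x|lborel. rep f y * (cnj (rep g x) * l2_inner (T (D_op y f0)) (D_op x g0)))"
proof -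
  let ?Z = "Foi (mulop q (Fo g))"
  \<comment> \<open>The adjoint vector absorbs \<open>T\<close>, so that the convolution formula
    applies in the first slot.\<close>
  obtain w' where w': "\<And>v. l2_inner (T v) ?Z = l2_inner v w'" using bop_adjoint[OF T] by blast
  have Z: "l2_inner v ?Z = (LINT x|lborel. cnj (rep g x) * l2_inner v (D_op x g0))" for v
  proof -
    have "l2_inner v ?Z = cnj (LINT x|lborel. rep g x * l2_inner (D_op x g0) v)"
      using l2_inner_commute[of v ?Z] by (simp add: fourier_multiplier_integral[OF q g])
    also have "\<dots> = (LINT x|lborel. cnj (rep g x * l2_inner (D_op x g0) v))"
      by (rule Bochner_Integration.integral_cnj[symmetric])
    finally show ?thesis by (simp flip: l2_inner_commute)
  qed
  have "l2_inner (T (Foi (mulop p (Fo f)))) ?Z = (LINT y|lborel. rep f y * l2_inner (T (D_op y f0)) ?Z)"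
    unfolding w' by (rule fourier_multiplier_integral[OF p f])
  then show ?thesis unfolding Z by simp
qed

text \<open>Normalised indicators on either side of 0: convolution with \<open>phi\<close> averages
  the translations over [0, d], and its reflection \<open>theta\<close> belongs to the adjoint
  average. Their one-sided supports make the kernel vanish for x <= y.\<close>

definition phi :: "real \<Rightarrow> L2" where "phi d = l2_scale (1 / complex_of_real d) (ind 0 d)"
definition theta :: "real \<Rightarrow> L2" where "theta d = l2_scale (1 / complex_of_real d) (ind (-d) 0)"

lemma rep_Fo_phi: "AE \<xi> in lborel. rep (Fo (phi d)) \<xi> = complex_of_real foc * cnj (havg d \<xi>)"
  unfolding phi_def Fo_scale
  using rep_l2_scale[of "1 / complex_of_real d" "Fo (ind 0 d)"] rep_Fo[OF integrable_rep_ind[of 0 d]]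
  by eventually_elim (simp add: havg_def ftr_rep_ind cnj_ftr_indf)

lemma rep_Fo_theta: "AE \<xi> in lborel. rep (Fo (theta d)) \<xi> = complex_of_real foc * havg d \<xi>"
  unfolding theta_def Fo_scale
  using rep_l2_scale[of "1 / complex_of_real d" "Fo (ind (-d) 0)"] rep_Fo[OF integrable_rep_ind[of "-d" 0]]
  by eventually_elim (use ftr_indf_neg[of d 0] in \<open>simp add: havg_def ftr_rep_ind cnj_ftr_indf\<close>)

lemma supp_ge_ind: "supp_ge a (ind a b)"
  unfolding supp_ge_def using rep_ind[of a b] by eventually_elim (auto simp: indicator_def)

lemma supp_le_ind: "supp_le b (ind a b)"
  unfolding supp_le_def using rep_ind[of a b] by eventually_elim (auto simp: indicator_def)

lemma supp_phi: "supp_ge y (D_op y (phi d))"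
  using supp_ge_scale[OF supp_ge_ind[of y "d + y"]] by (simp add: phi_def bop_scale[OF bop_D_op] D_op_ind)

lemma supp_theta: "x \<le> y \<Longrightarrow> supp_le y (D_op x (theta d))"
proof -
  assume "x \<le> y"
  have "supp_le x (D_op x (theta d))"
    using supp_le_scale[OF supp_le_ind[of x "-d + x"]] by (simp add: theta_def bop_scale[OF bop_D_op] D_op_ind)
  then show ?thesis unfolding supp_le_def by eventually_elim (use \<open>x \<le> y\<close> in auto)
qed

text \<open>The factor in position acts first, making the vector integrable for the convolution
  formula. The adjoint of \<open>Zop d\<close> is the average of D_s followed by the average of M_s,
  so the compression multiplies \<open>T\<close> on both sides by averages over s >= 0.\<close>

definition Xop :: "real \<Rightarrow> L2 \<Rightarrow> L2" where
  "Xop d f = Foi (mulop (\<lambda>\<xi>. cnj (havg d \<xi>)) (Fo (mulop (havg d) f)))"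
definition Zop :: "real \<Rightarrow> L2 \<Rightarrow> L2" where
  "Zop d g = Foi (mulop (havg d) (Fo (mulop (\<lambda>x. cnj (havg d x)) g)))"

text \<open>Strong convergence of products: the outer factors are contractions, so they do not
  enlarge the error of the inner factor.\<close>

lemma multiplier_product_tendsto:
  fixes p q :: "nat \<Rightarrow> real \<Rightarrow> complex"
  assumes p: "\<And>n. p n \<in> borel_measurable borel" "\<And>n t. cmod (p n t) \<le> 1" "\<And>t. (\<lambda>n. p n t) \<longlonglongrightarrow> 1"
    and q: "\<And>n. q n \<in> borel_measurable borel" "\<And>n t. cmod (q n t) \<le> 1" "\<And>t. (\<lambda>n. q n t) \<longlonglongrightarrow> 1"
  shows "(\<lambda>n. Foi (mulop (p n) (Fo (mulop (q n) f)))) \<longlonglongrightarrow> f"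
    "norm (Foi (mulop (p n) (Fo (mulop (q n) f)))) \<le> norm f"
proof -
  have contr: "norm (Foi (mulop (p n) (Fo x))) \<le> norm x" for n x
    using norm_mulop_le[OF p(1,2), of n "Fo x"] by (simp add: isometry_norm[OF Foi_inner] isometry_norm[OF Fo_inner])
  have qn: "norm (mulop (q n) f) \<le> norm f" for n
    using norm_mulop_le[OF q(1,2), of n f] by simp
  show "norm (Foi (mulop (p n) (Fo (mulop (q n) f)))) \<le> norm f"
    by (rule order_trans[OF contr qn])
  have bp: "bmf (p n)" for n using p by (intro bmfI) auto
  have ql: "(\<lambda>n. mulop (q n) f) \<longlonglongrightarrow> f"
    using mulop_tendsto[OF q(1) _ q(2,3), of f] by simp
  have pl: "(\<lambda>n. Foi (mulop (p n) (Fo f))) \<longlonglongrightarrow> f"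
    using tendsto_bop[OF bop_Foi mulop_tendsto[OF p(1) _ p(2,3), of "Fo f"]] by simp
  have "(\<lambda>n. Foi (mulop (p n) (Fo (mulop (q n) f - f)))) \<longlonglongrightarrow> 0"
  proof (rule Lim_null_comparison)
    show "\<forall>\<^sub>F n in sequentially. norm (Foi (mulop (p n) (Fo (mulop (q n) f - f)))) \<le> norm (mulop (q n) f - f)"
      by (intro always_eventually allI contr)
    show "(\<lambda>n. norm (mulop (q n) f - f)) \<longlonglongrightarrow> 0"
      using ql by (simp add: LIM_zero tendsto_norm_zero)
  qed
  from tendsto_add[OF this pl]
  have "(\<lambda>n. Foi (mulop (p n) (Fo (mulop (q n) f - f))) + Foi (mulop (p n) (Fo f))) \<longlonglongrightarrow> f" by simp
  moreover have "Foi (mulop (p n) (Fo (mulop (q n) f - f))) + Foi (mulop (p n) (Fo f)) = Foi (mulop (p n) (Fo (mulop (q n) f)))" for n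
    by (simp flip: bop_add[OF bop_Foi] mulop_add[OF bp] Fo_add)
  ultimately show "(\<lambda>n. Foi (mulop (p n) (Fo (mulop (q n) f)))) \<longlonglongrightarrow> f" by simp
qed

lemma havg_cnj_tendsto: "(\<lambda>n. cnj (havg (dn n) x)) \<longlonglongrightarrow> 1"
  using tendsto_cnj[OF havg_tendsto[of x]] by simp

lemma Xop_tendsto: "(\<lambda>n. Xop (dn n) f) \<longlonglongrightarrow> f"
  and Xop_norm: "norm (Xop (dn n) f) \<le> norm f"
  unfolding Xop_def
  by (rule multiplier_product_tendsto; (auto simp: havg_bound intro: havg_tendsto havg_cnj_tendsto simp del: of_nat_Suc)[1])+

lemma Zop_tendsto: "(\<lambda>n. Zop (dn n) f) \<longlonglongrightarrow> f"
  and Zop_norm: "norm (Zop (dn n) f) \<le> norm f"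
  unfolding Zop_def
  by (rule multiplier_product_tendsto; (auto simp: havg_bound intro: havg_tendsto havg_cnj_tendsto simp del: of_nat_Suc)[1])+

section \<open>Kernels of smoothed operators\<close>

text \<open>Integral kernel of \<open>T\<close> smoothed by translation averages on both sides, with
  output variable \<open>x\<close> and input variable \<open>y\<close>.\<close>

definition ck :: "(L2 \<Rightarrow> L2) \<Rightarrow> real \<Rightarrow> real \<Rightarrow> real \<Rightarrow> complex" where
  "ck T d x y = l2_inner (T (D_op y (phi d))) (D_op x (theta d))"

text \<open>The kernel with both position cutoffs, on the parallel where the input variable is x -
  u; this slice contributes the operator \<open>mulop (sy T d u) \<circ> D_op u\<close>.\<close>

definition sy :: "(L2 \<Rightarrow> L2) \<Rightarrow> real \<Rightarrow> real \<Rightarrow> real \<Rightarrow> complex" where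
  "sy T d u x = havg d (x - u) * (havg d x * ck T d x (x - u))"

definition Iu :: "(L2 \<Rightarrow> L2) \<Rightarrow> real \<Rightarrow> L2 \<Rightarrow> L2 \<Rightarrow> real \<Rightarrow> complex" where
  "Iu T d f g u = (LINT x|lborel. sy T d u x * (rep (D_op u f) x * cnj (rep g x)))"

lemma ck_bound:
  assumes "bop T"
  obtains K where "K \<ge> 0" "\<And>x y. cmod (ck T d x y) \<le> K"
proof -
  obtain C where C: "C \<ge> 0" "\<And>x. norm (T x) \<le> C * norm x" using bop_bound[OF assms] by blast
  have "cmod (ck T d x y) \<le> C * norm (phi d) * norm (theta d)" for x y
    unfolding ck_def
    using order_trans[OF l2_Cauchy_Schwarz mult_right_mono[OF C(2)[of "D_op y (phi d)"] norm_ge_zero[of "D_op x (theta d)"]]]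
    by (simp add: D_op_norm)
  moreover have "0 \<le> C * norm (phi d) * norm (theta d)" using C by simp
  ultimately show ?thesis using that by blast
qed

lemma continuous_on_ck:
  assumes "bop T" "continuous_on S f" "continuous_on S g"
  shows "continuous_on S (\<lambda>p. ck T d (f p) (g p))"
  unfolding ck_def by (intro continuous_intros continuous_on_bop[OF assms(1)] assms)

lemma bmf_sy:
  assumes T: "bop T" and d: "0 < d"
  shows "bmf (sy T d u)"
proof -
  obtain K where K: "K \<ge> 0" "\<And>x y. cmod (ck T d x y) \<le> K" using ck_bound[OF T] by blast
  have "continuous_on UNIV (\<lambda>x. ck T d x (x - u))"
    by (intro continuous_on_ck[OF T] continuous_intros)
  then have "bmf (\<lambda>x. ck T d x (x - u))"
    using K by (intro bmfI borel_measurable_continuous_onI) auto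
  then show ?thesis unfolding sy_def by (intro bmf_mult bmf_havg bmf_havg0 d)
qed

text \<open>One constant \<open>K\<close> serves all \<open>f\<close> and \<open>g\<close>. The
  pointwise bound makes the series of a normal functional converge for each u, and the bound on the
  integral over u allows that series to be integrated termwise.\<close>

lemma sandwich_eq_integral_Iu:
  assumes T: "bop T" and d: "0 < d"
  obtains K where "K \<ge> 0"
    "\<And>f g. integrable lborel (Iu T d f g)"
    "\<And>f g. l2_inner (T (Xop d f)) (Zop d g) = (LINT u|lborel. Iu T d f g u)"
    "\<And>f g. (LINT u|lborel. cmod (Iu T d f g u)) \<le> K * (norm f * norm g)"
    "\<And>f g u. cmod (Iu T d f g u) \<le> K * (norm f * norm g)"
proof -
  obtain C where C: "C \<ge> 0" "\<And>x y. cmod (ck T d x y) \<le> C" using ck_bound[OF T] by blast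
  let ?h = "havg d"
  define H where "H = norm (mk ?h)"
  \<comment> \<open>The first summand bounds the integral over u, through the L2 norm
    \<open>H\<close> of the cutoff; the second bounds each single value.\<close>
  define K where "K = C * (H * H) + C"
  have H0: "H \<ge> 0" by (simp add: H_def)
  have hsq: "sqint ?h" by (rule havg_sqint[OF d])
  have main: "integrable lborel (Iu T d f g) \<and>
      l2_inner (T (Xop d f)) (Zop d g) = (LINT u|lborel. Iu T d f g u) \<and>
      (LINT u|lborel. cmod (Iu T d f g u)) \<le> C * (H * H) * (norm f * norm g)" for f g
  proof -
    let ?f = "mulop ?h f" and ?g = "mulop (\<lambda>x. cnj (?h x)) g"
    define F1 where "F1 y = ?h y * rep f y" for y
    define G1 where "G1 x = ?h x * cnj (rep g x)" for x
    have [measurable]: "F1 \<in> borel_measurable borel" "G1 \<in> borel_measurable borel"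
      unfolding F1_def G1_def by measurable
    have F1: "integrable lborel F1" and G1: "integrable lborel G1"
      unfolding F1_def G1_def using hsq by (auto intro!: sqint_integrable_mult sqint_cnj)
    have nF1: "(LINT y|lborel. cmod (F1 y)) \<le> H * norm f"
      using integral_cmod_mult_le[OF hsq sqint_rep[of f]] by (simp add: F1_def norm_mult H_def)
    have nG1: "(LINT y|lborel. cmod (G1 y)) \<le> H * norm g"
      using integral_cmod_mult_le[OF hsq sqint_rep[of g]] by (simp add: G1_def norm_mult H_def)
    have bh: "bmf ?h" by (rule bmf_havg0[OF d])
    have bc: "bmf (\<lambda>x. cnj (?h x))" by (rule bmf_cnj[OF bh])
    have rf: "AE y in lborel. rep ?f y = F1 y"
      using rep_mulop[OF bh, of f] by eventually_elim (simp add: F1_def)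
    have rg: "AE x in lborel. cnj (rep ?g x) = G1 x"
      using rep_mulop[OF bc, of g] by eventually_elim (simp add: G1_def)
    have if': "integrable lborel (rep ?f)"
      using F1 integrable_cong_AE[OF _ _ rf] by simp
    have ig': "integrable lborel (rep ?g)"
    proof -
      have "integrable lborel (\<lambda>x. cnj (rep ?g x))"
        using G1 integrable_cong_AE[OF _ _ rg] by simp
      then show ?thesis by simp
    qed
    \<comment> \<open>Coordinates (y, u) with x = y + u: integrating over u first gives the kernel
      form, over y first gives \<open>Iu\<close>.\<close>
    define k where "k p = F1 (fst p) * (G1 (fst p + snd p) * ck T d (fst p + snd p) (fst p))" for p
    have "continuous_on UNIV (\<lambda>p. ck T d (fst p + snd p) (fst p))"
      by (intro continuous_on_ck[OF T] continuous_intros)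
    then have [measurable]: "(\<lambda>p. ck T d (fst p + snd p) (fst p)) \<in> borel_measurable (lborel \<Otimes>\<^sub>M lborel)"
      unfolding lborel_prod by (simp add: borel_measurable_continuous_onI)
    have km [measurable]: "k \<in> borel_measurable (lborel \<Otimes>\<^sub>M lborel)" unfolding k_def by measurable
    have kle: "cmod (k (y, u)) \<le> (C * cmod (F1 y)) * cmod (G1 (y + u))" for y u
    proof -
      have "cmod (k (y, u)) = cmod (F1 y) * cmod (G1 (y + u)) * cmod (ck T d (y + u) y)"
        by (simp add: k_def norm_mult)
      also have "\<dots> \<le> cmod (F1 y) * cmod (G1 (y + u)) * C"
        by (intro mult_left_mono C) auto
      finally show ?thesis by (simp add: mult_ac)
    qed
    have CF: "integrable lborel (\<lambda>y. C * cmod (F1 y))" using F1 by simp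
    have CG: "integrable lborel (\<lambda>u. cmod (G1 (y + u)))" "(LINT u|lborel. cmod (G1 (y + u))) = (LINT x|lborel. cmod (G1 x))" for y
      using lborel_integrable_real_affine[OF integrable_norm[OF G1], of 1 y]
        lborel_integral_real_affine[of 1 "\<lambda>x. cmod (G1 x)" y] by simp_all
    note kint = integrable_pair_bound[OF km CF CG kle]
    have kint': "integrable (lborel \<Otimes>\<^sub>M lborel) (case_prod (\<lambda>y u. k (y, u)))"
      using kint(1) by simp
    have knint: "integrable (lborel \<Otimes>\<^sub>M lborel) (case_prod (\<lambda>y u. cmod (k (y, u))))"
      using integrable_norm[OF kint(1)] by (simp add: split_beta')
    have Iu_eq: "Iu T d f g u = (LINT y|lborel. k (y, u))" for u
    proof -
      have "(LINT y|lborel. k (y, u)) = (LINT x|lborel. k (- u + 1 * x, u))"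
        by (subst lborel_integral_real_affine[of 1 _ "-u"]) simp_all
      also have "\<dots> = Iu T d f g u"
        unfolding Iu_def
      proof (rule integral_cong_AE)
        show "AE x in lborel. k (- u + 1 * x, u) = sy T d u x * (rep (D_op u f) x * cnj (rep g x))"
          using rep_D_op[of u f] by eventually_elim (simp add: k_def F1_def G1_def sy_def)
        show "(\<lambda>x. sy T d u x * (rep (D_op u f) x * cnj (rep g x))) \<in> borel_measurable lborel"
          using bmf_measurable[OF bmf_sy[OF T d, of u]] by simp
        have "(\<lambda>x. k (- u + 1 * x, u)) = k \<circ> (\<lambda>x. (- u + 1 * x, u))" by auto
        also have "\<dots> \<in> borel_measurable lborel"
          by (rule measurable_comp[OF _ km]) measurable
        finally show "(\<lambda>x. k (- u + 1 * x, u)) \<in> borel_measurable lborel" .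
      qed
      finally show ?thesis by simp
    qed
    have 1: "integrable lborel (Iu T d f g)"
      unfolding Iu_eq using lborel_pair.integrable_snd[OF kint'] by simp
    have "l2_inner (T (Xop d f)) (Zop d g) = (LINT y|lborel. LINT x|lborel. rep ?f y * (cnj (rep ?g x) * ck T d x y))"
      unfolding Xop_def Zop_def ck_def
      by (rule multiplier_sandwich_integral[OF T bc rep_Fo_phi bh rep_Fo_theta if' ig'])
    also have "\<dots> = (LINT y|lborel. rep ?f y * (LINT x|lborel. G1 x * ck T d x y))"
    proof (rule Bochner_Integration.integral_cong[OF refl])
      fix y
      have "continuous_on UNIV (\<lambda>x. ck T d x y)" by (intro continuous_on_ck[OF T] continuous_intros)
      then have [measurable]: "(\<lambda>x. ck T d x y) \<in> borel_measurable borel" by (rule borel_measurable_continuous_onI)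
      have "(LINT x|lborel. cnj (rep ?g x) * ck T d x y) = (LINT x|lborel. G1 x * ck T d x y)"
        by (rule integral_cong_AE) (use rg in \<open>auto elim!: eventually_mono\<close>)
      then show "(LINT x|lborel. rep ?f y * (cnj (rep ?g x) * ck T d x y))
          = rep ?f y * (LINT x|lborel. G1 x * ck T d x y)" by simp
    qed
    also have "\<dots> = (LINT y|lborel. rep ?f y * (LINT u|lborel. G1 (y + u) * ck T d (y + u) y))"
      by (subst lborel_integral_real_affine[of 1 "\<lambda>x. G1 x * ck T d x y" y for y]) simp_all
    also have "\<dots> = (LINT y|lborel. LINT u|lborel. k (y, u))"
    proof (rule integral_cong_AE)
      have *: "(LINT u|lborel. k (y, u)) = F1 y * (LINT u|lborel. G1 (y + u) * ck T d (y + u) y)" for y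
        by (simp add: k_def)
      show "AE y in lborel. rep ?f y * (LINT u|lborel. G1 (y + u) * ck T d (y + u) y) = (LINT u|lborel. k (y, u))"
        unfolding * using rf by eventually_elim simp
      have "(\<lambda>(y, u). G1 (y + u) * ck T d (y + u) y) \<in> borel_measurable (lborel \<Otimes>\<^sub>M lborel)"
        unfolding split_beta' by measurable
      then show "(\<lambda>y. rep ?f y * (LINT u|lborel. G1 (y + u) * ck T d (y + u) y)) \<in> borel_measurable lborel"
        by (intro borel_measurable_times lborel.borel_measurable_lebesgue_integral) auto
      show "(\<lambda>y. LINT u|lborel. k (y, u)) \<in> borel_measurable lborel" by measurable
    qed
    also have "\<dots> = (LINT u|lborel. LINT y|lborel. k (y, u))"
      by (rule lborel_pair.Fubini_integral[OF kint', symmetric])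
    finally have 2: "l2_inner (T (Xop d f)) (Zop d g) = (LINT u|lborel. Iu T d f g u)" unfolding Iu_eq .
    have "(LINT u|lborel. cmod (Iu T d f g u)) \<le> (LINT u|lborel. LINT y|lborel. cmod (k (y, u)))"
    proof (rule integral_mono)
      show "integrable lborel (\<lambda>u. cmod (Iu T d f g u))" using 1 by simp
      show "integrable lborel (\<lambda>u. LINT y|lborel. cmod (k (y, u)))"
        using lborel_pair.integrable_snd[OF knint] by simp
      show "cmod (Iu T d f g u) \<le> (LINT y|lborel. cmod (k (y, u)))" for u
        unfolding Iu_eq by (rule integral_norm_bound)
    qed
    also have "\<dots> = (LINT y|lborel. LINT u|lborel. cmod (k (y, u)))"
      by (rule lborel_pair.Fubini_integral[OF knint])
    also have "\<dots> \<le> (LINT y|lborel. C * cmod (F1 y)) * (LINT x|lborel. cmod (G1 x))" by (rule kint(2))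
    also have "\<dots> = C * ((LINT y|lborel. cmod (F1 y)) * (LINT x|lborel. cmod (G1 x)))" by simp
    also have "\<dots> \<le> C * ((H * norm f) * (H * norm g))"
      by (intro mult_left_mono mult_mono nF1 nG1) (auto simp: C H0)
    finally have 3: "(LINT u|lborel. cmod (Iu T d f g u)) \<le> C * (H * H) * (norm f * norm g)" by (simp add: mult_ac)
    show ?thesis using 1 2 3 by blast
  qed
  \<comment> \<open>For fixed u the operator is an isometry followed by multiplication by a symbol
    bounded by \<open>C\<close>.\<close>
  have pt: "cmod (Iu T d f g u) \<le> C * (norm f * norm g)" for f g u
  proof -
    have sb: "cmod (sy T d u x) \<le> C" for x
    proof -
      have "cmod (sy T d u x) = cmod (?h (x - u)) * (cmod (?h x) * cmod (ck T d x (x - u)))" by (simp add: sy_def norm_mult)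
      also have "\<dots> \<le> 1 * (1 * C)" by (intro mult_mono havg_bound C d) auto
      finally show ?thesis by simp
    qed
    have b: "bmf (sy T d u)" by (rule bmf_sy[OF T d])
    have "Iu T d f g u = l2_inner (mulop (sy T d u) (D_op u f)) g"
      by (simp add: Iu_def l2_inner_mulop[OF b])
    then have "cmod (Iu T d f g u) \<le> norm (mulop (sy T d u) (D_op u f)) * norm g"
      using l2_Cauchy_Schwarz by simp
    also have "\<dots> \<le> (C * norm (D_op u f)) * norm g"
      by (intro mult_right_mono norm_mulop_le bmf_measurable[OF b] sb) auto
    finally show ?thesis by (simp add: D_op_norm mult.assoc)
  qed
  have le: "C * (H * H) * z \<le> K * z" "C * z \<le> K * z" if "z \<ge> 0" for z
    using that C H0 by (auto simp: K_def intro!: mult_right_mono)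
  show ?thesis
  proof (rule that)
    show "K \<ge> 0" using C H0 by (simp add: K_def)
    show "integrable lborel (Iu T d f g)" "l2_inner (T (Xop d f)) (Zop d g) = (LINT u|lborel. Iu T d f g u)" for f g
      using main by blast+
    show "(LINT u|lborel. cmod (Iu T d f g u)) \<le> K * (norm f * norm g)" for f g
      using main[of f g] le(1)[of "norm f * norm g"] by auto
    show "cmod (Iu T d f g u) \<le> K * (norm f * norm g)" for f g u
      using pt[of f g u] le(2)[of "norm f * norm g"] by auto
  qed
qed

section \<open>Equality of the two closures\<close>

text \<open>The compression is an integral over u, and the functional kills each slice, so one
  parallel can be treated at a time.\<close>

lemma functional_sandwich_zero:
  fixes F G :: "nat \<Rightarrow> nat \<Rightarrow> L2" and c :: "nat \<Rightarrow> complex"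
  assumes T: "bop T" and d: "0 < d"
    and pos: "\<And>a x y. supp_ge a x \<Longrightarrow> supp_le a y \<Longrightarrow> l2_inner (T x) y = 0"
    and mom: "\<And>a x y. supp_ge a (Fo x) \<Longrightarrow> supp_le a (Fo y) \<Longrightarrow> l2_inner (T x) y = 0"
    and F: "\<And>j. j < m \<Longrightarrow> summable (\<lambda>k. (norm (F j k))\<^sup>2)"
    and G: "\<And>j. j < m \<Longrightarrow> summable (\<lambda>k. (norm (G j k))\<^sup>2)"
    and kill: "\<And>l u. 0 \<le> l \<Longrightarrow> 0 \<le> u \<Longrightarrow> (\<Sum>j<m. c j * (\<Sum>k. l2_inner (M_op l (D_op u (F j k))) (G j k))) = 0"
  shows "(\<Sum>j<m. c j * (\<Sum>k. l2_inner (T (Xop d (F j k))) (Zop d (G j k)))) = 0"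
proof -
  obtain K where K: "K \<ge> 0"
    "\<And>f g. integrable lborel (Iu T d f g)"
    "\<And>f g. l2_inner (T (Xop d f)) (Zop d g) = (LINT u|lborel. Iu T d f g u)"
    "\<And>f g. (LINT u|lborel. cmod (Iu T d f g u)) \<le> K * (norm f * norm g)"
    "\<And>f g u. cmod (Iu T d f g u) \<le> K * (norm f * norm g)"
    using sandwich_eq_integral_Iu[OF T d] by blast
  define S where "S j u = (\<Sum>k. Iu T d (F j k) (G j k) u)" for j u
  have S: "integrable lborel (S j)" "(\<Sum>k. l2_inner (T (Xop d (F j k))) (Zop d (G j k))) = (LINT u|lborel. S j u)" if j: "j < m" for j
  proof -
    have sm: "summable (\<lambda>k. K * (norm (F j k) * norm (G j k)))"
      by (intro summable_mult summable_norm_prod F G j)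
    have a: "AE u in lborel. summable (\<lambda>k. norm (Iu T d (F j k) (G j k) u))"
      by (intro AE_I2 summable_comparison_test'[OF sm, of 0]) (use K(5) in simp)
    have b: "summable (\<lambda>k. LINT u|lborel. norm (Iu T d (F j k) (G j k) u))"
      by (rule summable_comparison_test'[OF sm, of 0]) (use K(4) in simp)
    show "integrable lborel (S j)" unfolding S_def by (rule integrable_suminf[OF K(2) a b])
    show "(\<Sum>k. l2_inner (T (Xop d (F j k))) (Zop d (G j k))) = (LINT u|lborel. S j u)"
      unfolding S_def K(3) by (rule integral_suminf[OF K(2) a b, symmetric])
  qed
  have zero: "(\<Sum>j<m. c j * S j u) = 0" for u
  proof (cases "0 \<le> u")
    case False
    \<comment> \<open>For u < 0 the point x - u separates the supports of D_{x-u} phi and D_x theta,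
      so triangularity in position applies.\<close>
    have "ck T d x (x - u) = 0" for x
      unfolding ck_def by (rule pos[OF supp_phi supp_theta]) (use False in simp)
    then show ?thesis by (simp add: S_def Iu_def sy_def)
  next
    case True
    let ?dens = "\<lambda>j mj. integrable lborel mj \<and> (\<forall>q. bmf q \<longrightarrow>
        (\<Sum>k. LINT x|lborel. q x * (rep (D_op u (F j k)) x * cnj (rep (G j k) x))) = (LINT x|lborel. q x * mj x))"
    have "\<forall>j\<in>{..<m}. \<exists>mj. ?dens j mj"
    proof
      fix j assume "j \<in> {..<m}"
      then have j: "j < m" by simp
      have "summable (\<lambda>k. (norm (D_op u (F j k)))\<^sup>2)" using F[OF j] by (simp add: D_op_norm)
      from normal_functional_density[OF this G[OF j]] show "\<exists>mj. ?dens j mj" by blast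
    qed
    from bchoice[OF this] obtain M where "\<forall>j\<in>{..<m}. ?dens j (M j)" by (rule exE)
    then have M: "\<And>j. j < m \<Longrightarrow> integrable lborel (M j)"
      "\<And>j q. j < m \<Longrightarrow> bmf q \<Longrightarrow>
        (\<Sum>k. LINT x|lborel. q x * (rep (D_op u (F j k)) x * cnj (rep (G j k) x))) = (LINT x|lborel. q x * M j x)"
      by auto
    \<comment> \<open>Density of the whole combined functional on the operators
      \<open>mulop q \<circ> D_op u\<close>, with u fixed.\<close>
    let ?M = "\<lambda>x. \<Sum>j<m. c j * M j x"
    have lin: "(\<Sum>j<m. c j * (\<Sum>k. LINT x|lborel. q x * (rep (D_op u (F j k)) x * cnj (rep (G j k) x))))
        = (LINT x|lborel. q x * ?M x)" if q: "bmf q" for q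
    proof -
      have qM: "integrable lborel (\<lambda>x. q x * M j x)" if "j < m" for j
        by (rule integrable_bmf_mult[OF q M(1)[OF that]])
      have "(LINT x|lborel. q x * ?M x) = (LINT x|lborel. (\<Sum>j<m. c j * (q x * M j x)))"
        by (simp add: sum_distrib_left mult_ac)
      also have "\<dots> = (\<Sum>j<m. LINT x|lborel. c j * (q x * M j x))"
        using qM by (intro Bochner_Integration.integral_sum) auto
      also have "\<dots> = (\<Sum>j<m. c j * (LINT x|lborel. q x * M j x))" by simp
      also have "\<dots> = (\<Sum>j<m. c j * (\<Sum>k. LINT x|lborel. q x * (rep (D_op u (F j k)) x * cnj (rep (G j k) x))))"
        using M(2)[OF _ q] by (intro sum.cong) auto
      finally show ?thesis by simp
    qed
    \<comment> \<open>This is the hypothesis on M_l D_u for the fixed u and all l >= 0.\<close>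
    have "annih ?M"
      unfolding annih_def
    proof (intro conjI allI impI)
      show "integrable lborel ?M" using M(1) by auto
      fix l :: real assume "0 \<le> l"
      have bl: "bmf (\<lambda>x. cis (l * x))" by (intro bmf_cis) auto
      show "(LINT x|lborel. cis (l * x) * ?M x) = 0"
        unfolding lin[OF bl, symmetric] using kill[OF \<open>0 \<le> l\<close> True]
        by (simp add: M_op_eq l2_inner_mulop[OF bl])
    qed
    \<comment> \<open>\<open>ck T d x (x - u)\<close> is the matrix coefficient for the vectors
      D_{-u} phi and theta, both moved by D_x.\<close>
    then have "annih (\<lambda>x. l2_inner (T (D_op x (D_op (- u) (phi d)))) (D_op x (theta d)) * ?M x)"
      by (intro annih_matrix_coeff[OF T]) (rule mom)
    \<comment> \<open>The shifts u and 0 supply the two cutoffs at x - u and at x that occur in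
      \<open>sy\<close>.\<close>
    then have "annih (\<lambda>x. havg d (x - u) * (havg d (x - 0) * (l2_inner (T (D_op x (D_op (- u) (phi d)))) (D_op x (theta d)) * ?M x)))"
      by (intro annih_havg d)
    then have "annih (\<lambda>x. sy T d u x * ?M x)"
      by (simp add: sy_def ck_def D_op_D_op mult.assoc)
    then have "(LINT x|lborel. sy T d u x * ?M x) = 0" by (rule annih_integral)
    then show ?thesis
      unfolding lin[OF bmf_sy[OF T d], symmetric] by (simp add: S_def Iu_def)
  qed
  have "(\<Sum>j<m. c j * (\<Sum>k. l2_inner (T (Xop d (F j k))) (Zop d (G j k)))) = (\<Sum>j<m. LINT u|lborel. c j * S j u)"
    using S(2) by (intro sum.cong) auto
  also have "\<dots> = (LINT u|lborel. (\<Sum>j<m. c j * S j u))"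
    using S(1) by (intro Bochner_Integration.integral_sum[symmetric]) auto
  also have "\<dots> = 0" by (simp add: zero)
  finally show ?thesis .
qed

text \<open>Tannery's theorem: each term converges, and as \<open>Xop\<close> and \<open>Zop\<close>
  are contractions it is bounded by \<open>C * (norm (F k) * norm (G k))\<close>, which is summable
  because the functional is normal.\<close>

lemma suminf_sandwich_tendsto:
  assumes T: "bop T" and F: "summable (\<lambda>k. (norm (F k))\<^sup>2)" and G: "summable (\<lambda>k. (norm (G k))\<^sup>2)"
  shows "(\<lambda>n. \<Sum>k. l2_inner (T (Xop (dn n) (F k))) (Zop (dn n) (G k)))
    \<longlonglongrightarrow> (\<Sum>k. l2_inner (T (F k)) (G k))"
proof -
  obtain C where C: "C \<ge> 0" "\<And>x. norm (T x) \<le> C * norm x" using bop_bound[OF T] by blast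
  let ?a = "\<lambda>k n. l2_inner (T (Xop (dn n) (F k))) (Zop (dn n) (G k))"
  have bound: "norm (?a k n) \<le> C * (norm (F k) * norm (G k))" for k n
  proof -
    have "norm (?a k n) \<le> norm (T (Xop (dn n) (F k))) * norm (Zop (dn n) (G k))"
      by (rule l2_Cauchy_Schwarz)
    also have "\<dots> \<le> (C * norm (F k)) * norm (G k)"
      by (intro mult_mono order_trans[OF C(2)] mult_left_mono Xop_norm Zop_norm) (use C in auto)
    finally show ?thesis by (simp add: mult.assoc)
  qed
  have "(\<lambda>n. ?a k n) \<longlonglongrightarrow> l2_inner (T (F k)) (G k)" for k
    by (intro tendsto_intros tendsto_bop[OF T] Xop_tendsto Zop_tendsto)
  moreover have "\<forall>\<^sub>F (k, n) in at_top \<times>\<^sub>F sequentially. norm (?a k n) \<le> C * (norm (F k) * norm (G k))"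
    by (intro always_eventually) (use bound in auto)
  moreover have "summable (\<lambda>k. C * (norm (F k) * norm (G k)))"
    by (intro summable_mult summable_norm_prod F G)
  ultimately show ?thesis
    using tannerys_theorem[of ?a "\<lambda>k. l2_inner (T (F k)) (G k)" sequentially] by auto
qed

abbreviation quadrant :: "(real \<times> real) set" where "quadrant \<equiv> {(l, m). l \<ge> 0 \<and> m \<ge> 0}"

lemma A_p_subset: "A_p \<subseteq> A_cone quadrant"
proof
  fix T assume "T \<in> A_p"
  then have wot: "T \<in> wot_closure (oalg p_gens)" by (simp add: A_p_def)
  then have T: "bop T" by (simp add: wot_closure_def)
  show "T \<in> A_cone quadrant"
    unfolding A_cone_def
  proof (rule wstar_closure_ospanI[OF _ T])
    show "bop V" if "V \<in> {M_op lam \<circ> D_op mu | lam mu. (lam, mu) \<in> quadrant}" for V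
      using that by (auto intro!: bop_compose bop_M_op bop_D_op)
    fix m c and F G :: "nat \<Rightarrow> nat \<Rightarrow> L2"
    assume F: "\<And>j. j < m \<Longrightarrow> summable (\<lambda>k. (norm (F j k))\<^sup>2)"
      and G: "\<And>j. j < m \<Longrightarrow> summable (\<lambda>k. (norm (G j k))\<^sup>2)"
      and kill: "\<And>S. S \<in> {M_op lam \<circ> D_op mu | lam mu. (lam, mu) \<in> quadrant} \<Longrightarrow>
        (\<Sum>j<m. c j * (\<Sum>k. l2_inner (S (F j k)) (G j k))) = 0"
    have kill': "(\<Sum>j<m. c j * (\<Sum>k. l2_inner (M_op l (D_op u (F j k))) (G j k))) = 0" if "0 \<le> l" "0 \<le> u" for l u
      using kill[of "M_op l \<circ> D_op u"] that by auto
    have "(\<lambda>n. \<Sum>j<m. c j * (\<Sum>k. l2_inner (T (Xop (dn n) (F j k))) (Zop (dn n) (G j k))))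
      \<longlonglongrightarrow> (\<Sum>j<m. c j * (\<Sum>k. l2_inner (T (F j k)) (G j k)))"
      by (intro tendsto_sum tendsto_mult tendsto_const suminf_sandwich_tendsto T F G) auto
    moreover have "(\<Sum>j<m. c j * (\<Sum>k. l2_inner (T (Xop (dn n) (F j k))) (Zop (dn n) (G j k)))) = 0" for n
    proof (rule functional_sandwich_zero[OF T])
      show "0 < dn n" by simp
      show "l2_inner (T x) y = 0" if "supp_ge a x" "supp_le a y" for a x y
        using wot_position_triangular[OF wot that] .
      show "l2_inner (T x) y = 0" if "supp_ge a (Fo x)" "supp_le a (Fo y)" for a x y
        using wot_momentum_triangular[OF wot that] .
    qed (use F G kill' in auto)
    ultimately show "(\<Sum>j<m. c j * (\<Sum>k. l2_inner (T (F j k)) (G j k))) = 0"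
      by (simp add: LIMSEQ_const_iff)
  qed
qed

text \<open>A WOT neighbourhood is a weak* neighbourhood given by sequences with a single nonzero
  term.\<close>

lemma wstar_closure_subset_wot_closure:
  assumes "A \<subseteq> B"
  shows "wstar_closure A \<subseteq> wot_closure B"
proof
  fix T assume T: "T \<in> wstar_closure A"
  have "\<exists>S\<in>B. \<forall>j<m. cmod (l2_inner (T (F j)) (G j) - l2_inner (S (F j)) (G j)) < e"
    if e: "e > 0" for m :: nat and F G :: "nat \<Rightarrow> L2" and e :: real
  proof -
    define F' where "F' j k = (if k = 0 then F j else 0)" for j k :: nat
    define G' where "G' j k = (if k = 0 then G j else 0)" for j k :: nat
    have sm: "summable (\<lambda>k. (l2_norm (F' j k))\<^sup>2)" "summable (\<lambda>k. (l2_norm (G' j k))\<^sup>2)" for j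
      by (rule summable_finite[of "{0}"]; simp add: F'_def G'_def flip: norm_L2_def)+
    have single: "(\<Sum>k. l2_inner (S (F' j k)) (G' j k)) = l2_inner (S (F j)) (G j)" for S j
      by (subst suminf_finite[of "{0}"]) (auto simp: F'_def G'_def)
    have "\<forall>(m::nat) F G e. e > 0 \<and> (\<forall>j<m. summable (\<lambda>k. (l2_norm (F j k))\<^sup>2) \<and> summable (\<lambda>k. (l2_norm (G j k))\<^sup>2))
        \<longrightarrow> (\<exists>S\<in>A. \<forall>j<m. cmod ((\<Sum>k. l2_inner (T (F j k)) (G j k)) - (\<Sum>k. l2_inner (S (F j k)) (G j k))) < e)"
      using T by (simp add: wstar_closure_def)
    note this[THEN spec[of _ m], THEN spec[of _ F'], THEN spec[of _ G'], THEN spec[of _ e], THEN mp]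
    moreover have "e > 0 \<and> (\<forall>j<m. summable (\<lambda>k. (l2_norm (F' j k))\<^sup>2) \<and> summable (\<lambda>k. (l2_norm (G' j k))\<^sup>2))"
      using sm e by simp
    ultimately have "\<exists>S\<in>A. \<forall>j<m. cmod (l2_inner (T (F j)) (G j) - l2_inner (S (F j)) (G j)) < e"
      unfolding single .
    then show ?thesis by (rule bexE) (rule bexI, assumption, rule subsetD[OF assms])
  qed
  then show "T \<in> wot_closure B" using T by (simp add: wot_closure_def wstar_closure_def)
qed

lemma A_cone_quadrant_eq: "A_cone quadrant = A_p"
proof
  have "ospan {M_op lam \<circ> D_op mu | lam mu. (lam, mu) \<in> quadrant} \<subseteq> oalg p_gens"
  proof
    fix S assume "S \<in> ospan {M_op lam \<circ> D_op mu | lam mu. (lam, mu) \<in> quadrant}"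
    then show "S \<in> oalg p_gens"
    proof induction
      case (base V)
      then obtain l u where "V = M_op l \<circ> D_op u" "0 \<le> l" "0 \<le> u" by auto
      then show ?case by (simp only:) (rule oalg.comp; rule oalg.base; blast)
    next
      case zero
      show ?case by (rule oalg.zero)
    next
      case (add S T)
      show ?case by (rule oalg.add[OF add.IH])
    next
      case (scale T c)
      show ?case by (rule oalg.scale[OF scale.IH])
    qed
  qed
  then show "A_cone quadrant \<subseteq> A_p"
    unfolding A_cone_def A_p_def by (rule wstar_closure_subset_wot_closure)
qed (rule A_p_subset)

theorem theorem2p3:
  fixes r1 r2 :: "real \<times> real"
  assumes "\<forall>a b :: real. a *\<^sub>R r1 + b *\<^sub>R r2 = 0 \<longrightarrow> a = 0 \<and> b = 0"
  shows "\<exists>W. unitary W \<and>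
    (\<lambda>T. W \<circ> T \<circ> inv W) ` A_cone {a *\<^sub>R r1 + b *\<^sub>R r2 | a b :: real. a \<ge> 0 \<and> b \<ge> 0} = A_p"
proof -
  obtain p1 q1 p2 q2 where r: "r1 = (p1, q1)" "r2 = (p2, q2)" by (metis surj_pair)
  have det: "p1 * q2 - p2 * q1 \<noteq> 0"
  proof
    assume 0: "p1 * q2 - p2 * q1 = 0"
    \<comment> \<open>A vanishing determinant gives these two relations; independence then forces
      both coordinates of \<open>r1\<close> to be 0, which contradicts independence once
      more.\<close>
    have "q2 *\<^sub>R r1 + (- q1) *\<^sub>R r2 = 0" "p2 *\<^sub>R r1 + (- p1) *\<^sub>R r2 = 0"
      using 0 by (auto simp: r zero_prod_def algebra_simps)
    then have "- q1 = 0" "- p1 = 0" using assms by blast+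
    then have "1 *\<^sub>R r1 + 0 *\<^sub>R r2 = 0" by (simp add: r zero_prod_def)
    then have "(1::real) = 0" using assms by blast
    then show False by simp
  qed
  show ?thesis
  proof (cases "p1 * q2 - p2 * q1 > 0")
    case True
    show ?thesis using cone_unitary_equiv_quadrant[OF True] unfolding r A_cone_quadrant_eq .
  next
    case False
    \<comment> \<open>Exchanging the two generators reverses the orientation and leaves the cone
      unchanged.\<close>
    then have "p2 * q1 - p1 * q2 > 0" using det by simp
    moreover have "{a *\<^sub>R r1 + b *\<^sub>R r2 | a b :: real. a \<ge> 0 \<and> b \<ge> 0}
        = {a *\<^sub>R (p2, q2) + b *\<^sub>R (p1, q1) | a b :: real. a \<ge> 0 \<and> b \<ge> 0}"
      unfolding r by (rule Collect_cong, subst ex_comm) (simp only: add.commute conj_commute)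
    ultimately show ?thesis using cone_unitary_equiv_quadrant[of p2 q1 p1 q2] unfolding A_cone_quadrant_eq by (simp only:)
  qed
qed

end
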